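(* Let $u\in\mathbb{Q}^\times$ and consider the elliptic curve \[ E_u:\ y^2=x^3-264u^2x+1694u^3 . \] Then $E_u$ has complex multiplication by the ring of integers of $\mathbb{Q}(\sqrt{-11})$, and $E_u$ has no $2$-torsion point and no $3$-torsion point with rational $x$-coordinate. In particular, for every integer $k\ge 1$ with $6\mid k$, there is no $k$-torsion point $P\in E_u(\overline{\mathbb{Q}})$ such that $x(P)\in\mathbb{Q}$.
   Context: A $k$-torsion point on an elliptic curve $E/\mathbb{Q}$ means a point $P\in E(\overline{\mathbb{Q}})$, different from the point at infinity, with $[k]P$ equal to the point at infinity (not necessarily of exact order $k$). "CM by an order $\mathcal{O}$" means that the endomorphism ring of $E$ over $\overline{\mathbb{Q}}$ is isomorphic to $\mathcal{O}$. *)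

theory Defs
  imports Complex_Main "HOL-Library.FuncSet" "HOL-Algebra.Algebraic_Closure_Type"
begin

text \<open>\<open>Weierstrass a b\<close> stands for the curve \<open>y\<^sup>2 = x\<^sup>3 + a x + b\<close>. Base change along a field
  embedding is the map function of the datatype.\<close>

datatype 'a weierstrass = Weierstrass (coeff_a: 'a) (coeff_b: 'a)

definition discriminant :: "'a::field weierstrass \<Rightarrow> 'a" where
  "discriminant E = - 16 * (4 * coeff_a E ^ 3 + 27 * coeff_b E ^ 2)"

definition elliptic_curve :: "'a::field weierstrass \<Rightarrow> bool" where
  "elliptic_curve E \<longleftrightarrow> discriminant E \<noteq> 0"

datatype 'a point = Infinity | Affine 'a 'a

fun on_curve :: "'a::field weierstrass \<Rightarrow> 'a point \<Rightarrow> bool" where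
  "on_curve E Infinity \<longleftrightarrow> True"
| "on_curve E (Affine x y) \<longleftrightarrow> y ^ 2 = x ^ 3 + coeff_a E * x + coeff_b E"

definition points :: "'a::field weierstrass \<Rightarrow> 'a point set" where
  "points E = {P. on_curve E P}"

text \<open>The chord-tangent law, in characteristic different from 2. For two points of the curve with
  the same \<open>x\<close>-coordinate that are not opposite to each other, the points coincide and have
  \<open>y \<noteq> 0\<close>, so the tangent slope is well defined.\<close>

fun add_points :: "'a::field weierstrass \<Rightarrow> 'a point \<Rightarrow> 'a point \<Rightarrow> 'a point" where
  "add_points E Infinity Q = Q"
| "add_points E (Affine x1 y1) Infinity = Affine x1 y1"
| "add_points E (Affine x1 y1) (Affine x2 y2) =
     (if x1 = x2 \<and> y1 = - y2 then Infinity
      else let l = (if x1 = x2 then (3 * x1 ^ 2 + coeff_a E) / (2 * y1)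
                    else (y2 - y1) / (x2 - x1));
               x3 = l ^ 2 - x1 - x2
           in Affine x3 (l * (x1 - x3) - y1))"

definition mult_point :: "'a::field weierstrass \<Rightarrow> nat \<Rightarrow> 'a point \<Rightarrow> 'a point" where
  "mult_point E k P = (add_points E P ^^ k) Infinity"

text \<open>Homogeneous polynomials of degree \<open>d\<close> in three variables, given by their coefficients.\<close>

definition ternary_form :: "nat \<Rightarrow> (nat \<Rightarrow> nat \<Rightarrow> 'a::field) \<Rightarrow> 'a \<times> 'a \<times> 'a \<Rightarrow> 'a" where
  "ternary_form d c = (\<lambda>(x, y, z). \<Sum>i\<le>d. \<Sum>j\<le>d - i. c i j * x ^ i * y ^ j * z ^ (d - i - j))"

fun homog_coords :: "'a::field point \<Rightarrow> 'a \<times> 'a \<times> 'a" where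
  "homog_coords Infinity = (0, 1, 0)"
| "homog_coords (Affine x y) = (x, y, 1)"

definition proj_equal :: "'a::field \<times> 'a \<times> 'a \<Rightarrow> 'a \<times> 'a \<times> 'a \<Rightarrow> bool" where
  "proj_equal v w \<longleftrightarrow>
     (\<exists>t. t \<noteq> 0 \<and> fst v = t * fst w \<and> fst (snd v) = t * fst (snd w) \<and> snd (snd v) = t * snd (snd w))"

text \<open>A morphism from the projective curve to itself (over an algebraically closed field): around
  every point it is given by a triple of forms of the same degree without common zero at that point.
  Such a triple describes the map wherever the three forms do not vanish simultaneously.\<close>

definition curve_morphism ::
    "'a::field weierstrass \<Rightarrow> ('a point \<Rightarrow> 'a point) \<Rightarrow> bool" where
  "curve_morphism E f \<longleftrightarrow> f \<in> points E \<rightarrow> points E \<and>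
     (\<forall>P\<in>points E. \<exists>d c0 c1 c2.
        let F = (\<lambda>Q. (ternary_form d c0 (homog_coords Q), ternary_form d c1 (homog_coords Q),
                      ternary_form d c2 (homog_coords Q)))
        in F P \<noteq> (0, 0, 0) \<and>
           (\<forall>Q\<in>points E. F Q \<noteq> (0, 0, 0) \<longrightarrow> proj_equal (F Q) (homog_coords (f Q))))"

text \<open>Endomorphisms are the morphisms of curves that are homomorphisms for the group law. They are
  represented by functions that are extensional on the points of the curve.\<close>

definition endomorphisms :: "'a::field weierstrass \<Rightarrow> ('a point \<Rightarrow> 'a point) set" where
  "endomorphisms E = {f \<in> extensional (points E). curve_morphism E f \<and>
     (\<forall>P\<in>points E. \<forall>Q\<in>points E. f (add_points E P Q) = add_points E (f P) (f Q))}"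

definition endomorphism_ring :: "'a::field weierstrass \<Rightarrow> ('a point \<Rightarrow> 'a point) ring" where
  "endomorphism_ring E =
     \<lparr>carrier = endomorphisms E,
      monoid.mult = compose (points E),
      one = (\<lambda>P\<in>points E. P),
      zero = (\<lambda>P\<in>points E. Infinity),
      add = (\<lambda>f g. \<lambda>P\<in>points E. add_points E (f P) (g P))\<rparr>"

definition geometric :: "rat weierstrass \<Rightarrow> rat alg_closure weierstrass" where
  "geometric E = map_weierstrass to_ac E"

definition torsion_point :: "rat weierstrass \<Rightarrow> nat \<Rightarrow> rat alg_closure point \<Rightarrow> bool" where
  "torsion_point E k P \<longleftrightarrow>
     P \<in> points (geometric E) \<and> P \<noteq> Infinity \<and> mult_point (geometric E) k P = Infinity"

definition rational_x :: "rat alg_closure point \<Rightarrow> bool" where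
  "rational_x P \<longleftrightarrow> (\<exists>x y. P = Affine (to_ac x) y)"

definition has_CM_by :: "rat weierstrass \<Rightarrow> 'b ring \<Rightarrow> bool" where
  "has_CM_by E R \<longleftrightarrow> endomorphism_ring (geometric E) \<simeq> R"

definition quadratic_field :: "int \<Rightarrow> complex set" where
  "quadratic_field D = {of_rat a + of_rat b * csqrt (of_int D) | a b. True}"

definition quadratic_integers :: "int \<Rightarrow> complex ring" where
  "quadratic_integers D =
     \<lparr>carrier = {z \<in> quadratic_field D. algebraic_int z},
      monoid.mult = (*), one = 1, zero = 0, add = (+)\<rparr>"

definition curve_E :: "rat \<Rightarrow> rat weierstrass" where
  "curve_E u = Weierstrass (- 264 * u ^ 2) (1694 * u ^ 3)"

end

theory Submission
  imports Defs
begin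

text \<open>The two assertions, on endomorphisms and on torsion, have independent proofs.

  \<^bold>\<open>Endomorphisms.\<close> An endomorphism commutes with negation, so on \<open>x\<close>-coordinates
  it is a rational function \<open>p/q\<close>, taken in lowest terms (\<open>x_map\<close>). It fixes the point
  at infinity, whence \<open>deg q < deg p\<close>. Two numbers are read off at infinity: the degree
  \<open>deg p\<close>, and the slope, the value of \<open>x q / p\<close> there, which is the square of the
  derivative of the endomorphism at the origin. Both are multiplicative under composition. The classical
  biquadratic relations between \<open>x(U)\<close>, \<open>x(V)\<close> and \<open>x(U + V)\<close>,
  \<open>x(U - V)\<close> give the parallelogram law for the degree, and for the slope they give the same law
  together with \<open>e(f + g) e(f - g) = (e f - e g)\<^sup>2\<close>, the relations for the square of an
  additive function (\<open>parallelogram\<close>).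

  These laws determine the ring as soon as it has an element \<open>x\<close> of norm 3 and trace 1. An element
  \<open>g\<close> of trace zero satisfies \<open>g\<^sup>2 = - N g\<close> and has slope \<open>- N g\<close>.
  Put \<open>w = 2 x - 1\<close>, of trace zero and norm 11, and let \<open>z\<close> be orthogonal to
  \<open>1\<close> and to \<open>w\<close>. Then \<open>w z\<close> has trace zero too, so its slope is
  \<open>- 11 N z\<close>; but \<open>w\<close> and \<open>z\<close> have slopes \<open>- 11\<close> and
  \<open>- N z\<close>, with product \<open>11 N z\<close>. The slopes lie in a field of characteristic zero, so
  \<open>N z = 0\<close> and \<open>z = 0\<close>: this is where noncommutative endomorphism rings are excluded.
  Hence every element is a rational combination of \<open>1\<close> and \<open>x\<close>, and since the order of
  discriminant -11 is norm-Euclidean, an integral one (\<open>generated_by_root\<close>). The ring is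
  \<open>\<int>[x]\<close> with \<open>x\<^sup>2 = x - 3\<close>, which is the ring of integers
  (\<open>quadratic_integers_carrier\<close>).

  The element of norm 3 is a 3-isogeny given by Velu's formulas. Its kernel is generated by a point with
  \<open>x\<close>-coordinate \<open>u (11 + w)\<close>, where \<open>w\<^sup>2 = - 11\<close>, and its target
  is the curve itself, rescaled by \<open>c\<close> with \<open>c\<^sup>2 = (- 5 - w) / 2\<close>. The slope
  \<open>c\<^sup>2\<close> is a root of \<open>T\<^sup>2 + 5 T + 9\<close>, the polynomial whose roots are the
  squares of the roots of \<open>T\<^sup>2 - T + 3\<close>, and this forces the trace to be \<open>1\<close> or
  \<open>- 1\<close>.

  To speak of endomorphisms one needs the group law and a manageable notion of morphism. Associativity is verified
  by explicit chord slopes for points in general position and extended to all points by cancelling a generic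
  point. Morphisms are given by triples of forms around each point; this is equivalent to the condition that the
  translates of the map by almost all points have regular affine coordinates, and with this condition sums of
  morphisms are visibly morphisms.

  \<^bold>\<open>Torsion.\<close> Write \<open>x = u (6 r - 2)\<close>. Up to a twist the curve becomes
  \<open>Y\<^sup>2 + Y = r\<^sup>3 - r\<^sup>2 - 7 r + 10\<close>, which has supersingular reduction at 2: every
  point with coordinate \<open>r\<close> in the field of two elements is killed by 3 modulo 2. So for rational
  \<open>r\<close>, either \<open>r(P)\<close> or \<open>r(3 P)\<close> has a pole at 2, unless
  \<open>3 P = 0\<close>, and that is impossible because the 3-division polynomial in \<open>r\<close> has no
  root modulo 7. From then on each doubling increases the order of the 2-adic pole by 2. Thus \<open>P\<close>
  has infinitely many multiples and is not a torsion point.\<close>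

section \<open>The group law\<close>

fun neg_point :: "'a::field point \<Rightarrow> 'a point" where
  "neg_point Infinity = Infinity"
| "neg_point (Affine x y) = Affine x (- y)"

locale elliptic =
  fixes E :: "'k::{alg_closed_field,field_char_0} weierstrass"
  assumes elliptic: "elliptic_curve E"
begin

abbreviation "a \<equiv> coeff_a E"
abbreviation "b \<equiv> coeff_b E"

abbreviation plus_point (infixl "\<boxplus>" 65) where "P \<boxplus> Q \<equiv> add_points E P Q"

text \<open>Vieta's relations for the intersection of the line \<open>y = l x + m\<close> with the curve:
  \<open>x1\<close>, \<open>x2\<close>, \<open>x3\<close> are the roots, with multiplicity, of
  \<open>x\<^sup>3 + a x + b - (l x + m)\<^sup>2\<close>. In this form chords and tangents are treated alike.\<close>

definition collinear :: "'k \<Rightarrow> 'k \<Rightarrow> 'k \<Rightarrow> 'k \<Rightarrow> 'k \<Rightarrow> bool" where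
  "collinear l m x1 x2 x3 \<longleftrightarrow> x1 + x2 + x3 = l ^ 2 \<and> x1 * x2 + x1 * x3 + x2 * x3 = a - 2 * l * m
     \<and> x1 * x2 * x3 = m ^ 2 - b"

lemma double_nonzero: "y \<noteq> 0 \<Longrightarrow> 2 * y \<noteq> (0::'k)"
  by simp

lemma double_cancel: "2 * x = 2 * y \<Longrightarrow> x = (y::'k)"
  by simp

lemma disc_nonzero: "4 * a ^ 3 + 27 * b ^ 2 \<noteq> 0"
proof -
  have "discriminant E \<noteq> 0" using elliptic by (simp add: elliptic_curve_def)
  then show ?thesis unfolding discriminant_def by (metis mult_zero_right)
qed

lemma simple_roots: "x ^ 3 + a * x + b = 0 \<Longrightarrow> 3 * x ^ 2 + a = 0 \<Longrightarrow> False"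
proof -
  assume 1: "x ^ 3 + a * x + b = 0" and 2: "3 * x ^ 2 + a = 0"
  have "a = - 3 * x ^ 2" "b = 2 * x ^ 3" using 1 2 by Groebner_Basis.algebra+
  then have "4 * a ^ 3 + 27 * b ^ 2 = 0" by Groebner_Basis.algebra
  then show False using disc_nonzero by simp
qed

lemma points_Infinity [simp]: "Infinity \<in> points E"
  by (simp add: points_def)

lemma points_Affine [simp]: "Affine x y \<in> points E \<longleftrightarrow> y ^ 2 = x ^ 3 + a * x + b"
  by (simp add: points_def)

lemma collinear_perm:
  "collinear l m x1 x2 x3 \<Longrightarrow> collinear l m x2 x1 x3"
  "collinear l m x1 x2 x3 \<Longrightarrow> collinear l m x3 x2 x1"
  "collinear l m x1 x2 x3 \<Longrightarrow> collinear (- l) (- m) x1 x2 x3"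
  by (auto simp: collinear_def algebra_simps)

lemma collinearD:
  assumes "collinear l m x1 x2 x3"
  shows "x3 = l ^ 2 - x1 - x2" "a = x1 * x2 + x1 * x3 + x2 * x3 + 2 * l * m" "b = m ^ 2 - x1 * x2 * x3"
  using assms by (auto simp: collinear_def algebra_simps)

lemma collinear_on_curve:
  assumes "collinear l m x1 x2 x3"
  shows "(l * x1 + m) ^ 2 = x1 ^ 3 + a * x1 + b"
  using collinearD[OF assms] by Groebner_Basis.algebra

text \<open>The tangent case needs \<open>l x1 + m \<noteq> 0\<close>: at a point with \<open>y = 0\<close> the
  line would meet the cubic doubly, which the simplicity of its roots forbids.\<close>

lemma add_collinear:
  assumes c: "collinear l m x1 x2 x3"
  shows "Affine x1 (l * x1 + m) \<boxplus> Affine x2 (l * x2 + m) = Affine x3 (- (l * x3 + m))"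
proof (cases "x1 = x2")
  case True
  have t: "3 * x1 ^ 2 + a = 2 * l * (l * x1 + m)"
    using collinearD[OF c] True by Groebner_Basis.algebra
  have nz: "l * x1 + m \<noteq> 0"
  proof
    assume 0: "l * x1 + m = 0"
    show False using simple_roots[of x1] t collinear_on_curve[OF c] 0 by simp
  qed
  have l: "(3 * x1 ^ 2 + a) / (2 * (l * x1 + m)) = l"
  proof -
    have "2 * (l * x1 + m) \<noteq> 0" using nz by (simp only: double_nonzero not_False_eq_True)
    from nonzero_mult_div_cancel_right[OF this, of l] show ?thesis unfolding t by (simp only: ac_simps)
  qed
  have x3: "x3 = l\<^sup>2 - x1 - x1" using collinearD(1)[OF c] True by simp
  have "l * x1 + m \<noteq> - (l * x1 + m)" using nz by (metis add_eq_0_iff mult_2 mult_eq_0_iff zero_neq_numeral)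
  then show ?thesis using True l by (simp add: Let_def x3 algebra_simps)
next
  case False
  have l: "(l * x2 + m - (l * x1 + m)) / (x2 - x1) = l"
    using False by (simp add: field_simps)
  have x3: "x3 = l\<^sup>2 - x1 - x2" using collinearD(1)[OF c] .
  show ?thesis using False l by (simp add: Let_def x3 algebra_simps)
qed

declare add_points.simps(3) [simp del]

lemma collinear_exists:
  assumes P: "Affine x1 y1 \<in> points E" and Q: "Affine x2 y2 \<in> points E"
    and n: "\<not> (x1 = x2 \<and> y1 = - y2)"
  obtains l m x3 where "collinear l m x1 x2 x3" "y1 = l * x1 + m" "y2 = l * x2 + m"
proof -
  have P': "y1 ^ 2 = x1 ^ 3 + a * x1 + b" and Q': "y2 ^ 2 = x2 ^ 3 + a * x2 + b"
    using P Q by auto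
  define l where "l = (if x1 = x2 then (3 * x1 ^ 2 + a) / (2 * y1) else (y2 - y1) / (x2 - x1))"
  define m where "m = y1 - l * x1"
  have y12: "y1 = y2 \<and> y1 \<noteq> 0" if "x1 = x2"
  proof -
    have "y1 ^ 2 = y2 ^ 2" using P' Q' that by simp
    then have "y1 = y2" using n that by (auto simp: power2_eq_iff)
    moreover have "y1 \<noteq> 0" using calculation n that by auto
    ultimately show ?thesis by simp
  qed
  have y2: "y2 = l * x2 + m"
  proof (cases "x1 = x2")
    case False
    then have "l * (x2 - x1) = y2 - y1" by (simp add: l_def)
    then show ?thesis unfolding m_def by Groebner_Basis.algebra
  qed (use y12 in \<open>simp add: m_def\<close>)
  have "a - 2 * l * m = x1 * x2 + x1 * (l\<^sup>2 - x1 - x2) + x2 * (l\<^sup>2 - x1 - x2)"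
  proof (cases "x1 = x2")
    case True
    then have "2 * y1 \<noteq> 0" using y12 by auto
    then have "2 * y1 * l = 3 * x1 ^ 2 + a" using True
      by (simp only: l_def if_True refl times_divide_eq_right) (rule nonzero_mult_div_cancel_left)
    then show ?thesis using True unfolding m_def by Groebner_Basis.algebra
  next
    case False
    then have ne: "x2 - x1 \<noteq> 0" by simp
    have "(x2 - x1) * (a - 2 * l * m - (x1 * x2 + x1 * (l\<^sup>2 - x1 - x2) + x2 * (l\<^sup>2 - x1 - x2))) = 0"
      using P' Q' y2 m_def by Groebner_Basis.algebra
    then show ?thesis using ne by simp
  qed
  moreover have "x1 * x2 * (l\<^sup>2 - x1 - x2) = m\<^sup>2 - b"
    using calculation P' m_def by Groebner_Basis.algebra
  ultimately have "collinear l m x1 x2 (l\<^sup>2 - x1 - x2)" by (simp add: collinear_def)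
  then show ?thesis using that y2 by (simp add: m_def)
qed

lemma add_Infinity_right [simp]: "P \<boxplus> Infinity = P"
  by (cases P) auto

lemma neg_neg [simp]: "neg_point (neg_point P) = P"
  by (cases P) auto

lemma neg_closed [simp]: "P \<in> points E \<Longrightarrow> neg_point P \<in> points E"
  by (cases P) auto

lemma neg_eq_Infinity [simp]: "neg_point P = Infinity \<longleftrightarrow> P = Infinity"
  by (cases P) auto

lemma neg_inj [simp]: "neg_point P = neg_point Q \<longleftrightarrow> P = Q"
  by (metis neg_neg)

lemma add_neg [simp]: "P \<boxplus> neg_point P = Infinity" "neg_point P \<boxplus> P = Infinity"
  by (cases P; simp add: add_points.simps(3))+

lemma add_points_cases:
  assumes "P \<in> points E" "Q \<in> points E"
  obtains "P = Infinity" | "Q = Infinity" | "Q = neg_point P"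
  | l m x1 x2 x3 where "collinear l m x1 x2 x3" "P = Affine x1 (l * x1 + m)" "Q = Affine x2 (l * x2 + m)"
    "P \<boxplus> Q = Affine x3 (- (l * x3 + m))"
proof (cases P)
  case P: (Affine x1 y1)
  show ?thesis
  proof (cases Q)
    case Q: (Affine x2 y2)
    show ?thesis
    proof (cases "x1 = x2 \<and> y1 = - y2")
      case False
      then show ?thesis
        using collinear_exists[of x1 y1 x2 y2] assms P Q add_collinear that(4) by metis
    qed (use P Q that(3) in auto)
  qed (use that(2) in auto)
qed (use that(1) in auto)

lemma add_closed [simp]:
  assumes "P \<in> points E" "Q \<in> points E"
  shows "P \<boxplus> Q \<in> points E"
  using assms
proof (cases rule: add_points_cases)
  case (4 l m x1 x2 x3)
  then show ?thesis
    using collinear_on_curve[of l m x3 x2 x1] collinear_perm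
    by (metis power2_minus points_Affine)
qed (use assms in auto)

lemma add_commute:
  assumes "P \<in> points E" "Q \<in> points E"
  shows "P \<boxplus> Q = Q \<boxplus> P"
  using assms
proof (cases rule: add_points_cases)
  case (4 l m x1 x2 x3)
  then show ?thesis using add_collinear collinear_perm by metis
qed auto

text \<open>A special case of associativity that is immediate: the line through \<open>P + Q\<close> and
  \<open>- Q\<close> is the reflection of the line through \<open>P\<close> and \<open>Q\<close>. It makes
  cancellation available before associativity.\<close>

lemma add_neg_cancel:
  assumes "P \<in> points E" "Q \<in> points E"
  shows "P \<boxplus> Q \<boxplus> neg_point Q = P"
  using assms
proof (cases rule: add_points_cases)
  case (4 l m x1 x2 x3)
  have "collinear (- l) (- m) x3 x2 x1" using 4(1) collinear_perm by blast
  from add_collinear[OF this] 4 show ?thesis by (simp add: algebra_simps)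
qed auto

lemma add_neg_cancel_left:
  assumes "P \<in> points E" "Q \<in> points E"
  shows "P \<boxplus> (neg_point P \<boxplus> Q) = Q"
  using assms add_neg_cancel[of Q "neg_point P"] add_commute by simp

lemma add_right_cancel:
  assumes "P \<in> points E" "Q \<in> points E" "R \<in> points E"
  shows "P \<boxplus> R = Q \<boxplus> R \<longleftrightarrow> P = Q"
  using assms add_neg_cancel by metis

lemma neg_add:
  assumes "P \<in> points E" "Q \<in> points E"
  shows "neg_point (P \<boxplus> Q) = neg_point P \<boxplus> neg_point Q"
  using assms
proof (cases rule: add_points_cases)
  case (4 l m x1 x2 x3)
  have "collinear (- l) (- m) x1 x2 x3" using 4(1) collinear_perm by blast
  from add_collinear[OF this] 4 show ?thesis by (simp add: algebra_simps)
qed auto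

text \<open>Affine coordinates, with the default value 0 at infinity.\<close>

fun xc where "xc Infinity = 0" | "xc (Affine x y) = x"
fun yc where "yc Infinity = 0" | "yc (Affine x y) = y"

lemma same_x_iff:
  assumes "P \<in> points E" "Q \<in> points E" "P \<noteq> Infinity" "Q \<noteq> Infinity"
  shows "xc P = xc Q \<longleftrightarrow> P = Q \<or> P = neg_point Q"
proof (cases P; cases Q)
  fix x1 y1 x2 y2 assume 1: "P = Affine x1 y1" "Q = Affine x2 y2"
  show ?thesis
  proof
    assume "xc P = xc Q"
    then have "y1 ^ 2 = y2 ^ 2" using 1 assms by simp
    then show "P = Q \<or> P = neg_point Q" using \<open>xc P = xc Q\<close> 1 by (auto simp: power2_eq_iff)
  qed (use 1 in auto)
qed (use assms in auto)

text \<open>Associativity when all additions involved are chords, except that \<open>P + Q\<close> and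
  \<open>Q + R\<close> may be tangents. With \<open>l1\<close>, \<open>l2\<close> the slopes for
  \<open>P + Q\<close> and \<open>Q + R\<close>, and \<open>p'\<close>, \<open>r'\<close> the
  \<open>x\<close>-coordinates of these sums, the slopes of the remaining two chords are
  \<open>n1 = l2 + e\<close> and \<open>n2 = n1 + d\<close>, where \<open>d = l1 - l2\<close> and
  \<open>e = (r' - p') / d\<close>. Expressing everything through \<open>l2\<close>, \<open>d\<close>,
  \<open>e\<close>, \<open>r\<close>, \<open>p'\<close> turns both sides into the same polynomials.\<close>

lemma add_assoc_distinct:
  assumes P: "P \<in> points E" and Q: "Q \<in> points E" and R: "R \<in> points E"
    and affine: "P \<noteq> Infinity" "Q \<noteq> Infinity" "R \<noteq> Infinity"
    and PQ: "Q \<noteq> neg_point P" and QR: "R \<noteq> neg_point Q"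
    and d1: "xc (P \<boxplus> Q) \<noteq> xc R" and d2: "xc P \<noteq> xc (Q \<boxplus> R)"
  shows "P \<boxplus> Q \<boxplus> R = P \<boxplus> (Q \<boxplus> R)"
proof -
  obtain l1 m1 p q p' where 1: "collinear l1 m1 p q p'" "P = Affine p (l1 * p + m1)"
      "Q = Affine q (l1 * q + m1)" "P \<boxplus> Q = Affine p' (- (l1 * p' + m1))"
    by (rule add_points_cases[OF P Q]) (use affine PQ in blast)+
  obtain l2 m2 q2 r r' where 2: "collinear l2 m2 q2 r r'" "Q = Affine q2 (l2 * q2 + m2)"
      "R = Affine r (l2 * r + m2)" "Q \<boxplus> R = Affine r' (- (l2 * r' + m2))"
    by (rule add_points_cases[OF Q R]) (use affine QR in blast)+
  have q2: "q2 = q" and m: "l2 * q + m2 = l1 * q + m1" using 1 2 by auto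
  have d1': "r - p' \<noteq> 0" and d2': "r' - p \<noteq> 0" using d1 d2 1 2 by auto
  note c = collinearD[OF 1(1)] collinearD[OF 2(1)[unfolded q2]]
  show ?thesis
  proof (cases "l1 = l2")
    case True
    have "(r - p) * (r - p') = 0" using c m True by Groebner_Basis.algebra
    then have "R = P" using d1' True m 1 2 by auto
    then show ?thesis using P Q add_commute by simp
  next
    case False
    define d where "d = l1 - l2"
    have d: "d \<noteq> 0" using False by (simp add: d_def)
    define e where "e = (r' - p') / d"
    have r': "r' = p' + d * e" using d by (simp add: e_def)
    have l1: "l1 = l2 + d" by (simp add: d_def)
    have p: "p = r + d * (2 * l2 + e + d)" using c(1,4) r' l1 by Groebner_Basis.algebra
    have q: "q = (l2 + d) ^ 2 - p - p'" using c(1) l1 by Groebner_Basis.algebra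
    have m2: "m2 = m1 + d * q" using m l1 by Groebner_Basis.algebra
    have "d * (2 * m1 - (r * e - q * d - (2 * l2 + e + d) * p')) = 0"
      using c(2,5) unfolding m2 l1 r' p by Groebner_Basis.algebra
    then have m1: "2 * m1 = r * e - q * d - (2 * l2 + e + d) * p'" using d by simp
    define n1 where "n1 = l2 + e"
    define n2 where "n2 = n1 + d"
    have "2 * ((l2 * r + m2) + (l1 * p' + m1)) = 2 * (n1 * (r - p'))"
      using m1 unfolding m2 l1 n1_def by Groebner_Basis.algebra
    then have n1: "(l2 * r + m2 - - (l1 * p' + m1)) / (r - p') = n1"
      using d1' by (simp only: mult_cancel_left nonzero_divide_eq_eq diff_minus_eq_add) simp
    have "2 * (- (l2 * r' + m2) - (l1 * p + m1)) = 2 * (n2 * (r' - p))"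
      using m1 unfolding m2 l1 n2_def n1_def r' p by Groebner_Basis.algebra
    then have n2: "(- (l2 * r' + m2) - (l1 * p + m1)) / (r' - p) = n2"
      using d2' by (simp only: mult_cancel_left nonzero_divide_eq_eq) simp
    have x: "n1 ^ 2 - p' - r = n2 ^ 2 - p - r'"
      unfolding n2_def n1_def r' p by Groebner_Basis.algebra
    have y: "n1 * (p' - (n1 ^ 2 - p' - r)) + (l1 * p' + m1) =
          n2 * (p - (n1 ^ 2 - p' - r)) - (l1 * p + m1)"
      by (rule double_cancel) (use m1 q in \<open>unfold n2_def n1_def l1 r' p, Groebner_Basis.algebra\<close>)
    have L: "P \<boxplus> Q \<boxplus> R = Affine (n1 ^ 2 - p' - r) (n1 * (p' - (n1 ^ 2 - p' - r)) + (l1 * p' + m1))"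
      using d1' unfolding 1(4) 2(3) by (simp add: n1[simplified] Let_def add_points.simps(3))
    have "P \<boxplus> (Q \<boxplus> R) = Affine (n2 ^ 2 - p - r') (n2 * (p - (n2 ^ 2 - p - r')) - (l1 * p + m1))"
      using d2' unfolding 2(4) 1(2) by (simp add: n2[simplified] Let_def add_points.simps(3))
    then show ?thesis using L x y by simp
  qed
qed

lemma finite_points_xc: "finite {P \<in> points E. P = Infinity \<or> xc P = x}"
proof -
  obtain y where y: "y ^ 2 = x ^ 3 + a * x + b" using nth_root_exists[of 2] by auto
  have "{P \<in> points E. P = Infinity \<or> xc P = x} \<subseteq> {Infinity, Affine x y, Affine x (- y)}"
  proof
    fix P assume "P \<in> {P \<in> points E. P = Infinity \<or> xc P = x}"
    then show "P \<in> {Infinity, Affine x y, Affine x (- y)}"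
      using y by (cases P) (auto simp: power2_eq_iff[symmetric])
  qed
  then show ?thesis by (rule finite_subset) simp
qed

lemma finite_points_xc_set: "finite S \<Longrightarrow> finite {P \<in> points E. P = Infinity \<or> xc P \<in> S}"
proof -
  assume "finite S"
  then have "finite (insert Infinity (\<Union>x\<in>S. {P \<in> points E. P = Infinity \<or> xc P = x}))"
    using finite_points_xc by auto
  then show ?thesis by (rule rev_finite_subset) auto
qed

lemma exists_y: "\<exists>y. Affine x y \<in> points E"
  using nth_root_exists[of 2] by auto

lemma infinite_points: "infinite (points E)"
proof
  assume "finite (points E)"
  then have "finite (xc ` points E)" by simp
  moreover have "x \<in> xc ` points E" for x using exists_y[of x] by (metis image_eqI xc.simps(2))
  then have "xc ` points E = UNIV" by blast
  ultimately show False using infinite_UNIV_char_0 by metis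
qed

text \<open>For given \<open>P\<close> and \<open>Q\<close> the coincidences excluded in the chord case occur
  for finitely many \<open>T\<close> only.\<close>

lemma add_assoc_generic:
  assumes P: "P \<in> points E" and Q: "Q \<in> points E"
  shows "finite {T \<in> points E. P \<boxplus> Q \<boxplus> T \<noteq> P \<boxplus> (Q \<boxplus> T)}"
proof (cases "P = Infinity \<or> Q = Infinity \<or> Q = neg_point P")
  case True
  have "{T \<in> points E. P \<boxplus> Q \<boxplus> T \<noteq> P \<boxplus> (Q \<boxplus> T)} = {}"
    using True P Q add_neg_cancel_left[of P] by auto
  then show ?thesis by (simp only: finite.emptyI)
next
  case False
  let ?B = "{T \<in> points E. T = Infinity \<or> xc T \<in> {xc Q, xc (P \<boxplus> Q)}}
     \<union> {P \<boxplus> neg_point Q, neg_point P \<boxplus> neg_point Q}"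
  have "finite ?B" using finite_points_xc_set[of "{xc Q, xc (P \<boxplus> Q)}"] by (simp only: finite.emptyI finite_insert finite_Un)
  moreover have "P \<boxplus> Q \<boxplus> T = P \<boxplus> (Q \<boxplus> T)" if T: "T \<in> points E" "T \<notin> ?B" for T
  proof (rule add_assoc_distinct)
    show "T \<noteq> neg_point Q" using T Q by (cases Q) auto
    show "xc P \<noteq> xc (Q \<boxplus> T)"
    proof
      assume "xc P = xc (Q \<boxplus> T)"
      moreover have ne: "Q \<boxplus> T \<noteq> Infinity"
        using T(1) Q \<open>T \<noteq> neg_point Q\<close> by (metis add_closed add_commute add_neg_cancel add_neg(2) add_right_cancel neg_closed neg_neg)
      ultimately have "Q \<boxplus> T = P \<or> Q \<boxplus> T = neg_point P"
        using same_x_iff[of P "Q \<boxplus> T"] P Q T False by (metis add_closed neg_neg)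
      moreover have "T \<boxplus> Q \<boxplus> neg_point Q = T" using add_neg_cancel T Q by blast
      ultimately have "T = P \<boxplus> neg_point Q \<or> T = neg_point P \<boxplus> neg_point Q"
        using T Q add_commute by metis
      then show False using T by auto
    qed
  qed (use T P Q False in auto)
  then have "{T \<in> points E. P \<boxplus> Q \<boxplus> T \<noteq> P \<boxplus> (Q \<boxplus> T)} \<subseteq> ?B" by auto
  ultimately show ?thesis by (rule finite_subset[rotated])
qed

lemma finite_translate:
  assumes "R \<in> points E" "finite {T \<in> points E. A T}"
  shows "finite {T \<in> points E. A (R \<boxplus> T)}"
proof (rule finite_imageD)
  show "finite ((\<lambda>T. R \<boxplus> T) ` {T \<in> points E. A (R \<boxplus> T)})"
    by (rule finite_subset[OF _ assms(2)]) (use assms in auto)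
  show "inj_on (\<lambda>T. R \<boxplus> T) {T \<in> points E. A (R \<boxplus> T)}"
    using assms add_right_cancel add_commute by (auto simp: inj_on_def)
qed

lemma exists_generic:
  assumes "finite {T \<in> points E. A T}"
  shows "\<exists>T\<in>points E. \<not> A T"
proof (rule ccontr)
  assume "\<not> ?thesis"
  then have "{T \<in> points E. A T} = points E" by auto
  then show False using assms infinite_points by simp
qed

text \<open>Adding a generic point \<open>T\<close> to both sides brings every reassociation under the generic
  case; then \<open>T\<close> is cancelled.\<close>

lemma add_assoc:
  assumes P: "P \<in> points E" and Q: "Q \<in> points E" and R: "R \<in> points E"
  shows "P \<boxplus> Q \<boxplus> R = P \<boxplus> (Q \<boxplus> R)"
proof -
  let ?A = "\<lambda>P Q T. P \<boxplus> Q \<boxplus> T \<noteq> P \<boxplus> (Q \<boxplus> T)"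
  have "finite ({T \<in> points E. ?A (P \<boxplus> Q) R T} \<union> {T \<in> points E. ?A Q R T} \<union>
      {T \<in> points E. ?A P (Q \<boxplus> R) T} \<union> {T \<in> points E. ?A P Q (R \<boxplus> T)})"
    using finite_translate[of R "?A P Q"] add_assoc_generic P Q R by auto
  then have "finite {T \<in> points E. ?A (P \<boxplus> Q) R T \<or> ?A Q R T \<or> ?A P (Q \<boxplus> R) T \<or> ?A P Q (R \<boxplus> T)}"
    by (rule rev_finite_subset) auto
  from exists_generic[OF this] obtain T where T: "T \<in> points E" and
    "\<not> ?A (P \<boxplus> Q) R T" "\<not> ?A Q R T" "\<not> ?A P (Q \<boxplus> R) T" "\<not> ?A P Q (R \<boxplus> T)" by auto
  then have "P \<boxplus> Q \<boxplus> R \<boxplus> T = P \<boxplus> (Q \<boxplus> R) \<boxplus> T" by simp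
  then show ?thesis using add_right_cancel P Q R T by simp
qed

lemma add_left_commute:
  assumes "P \<in> points E" "Q \<in> points E" "R \<in> points E"
  shows "P \<boxplus> (Q \<boxplus> R) = Q \<boxplus> (P \<boxplus> R)"
  using assms add_assoc add_commute by metis

end

section \<open>Forms on the curve as polynomials in x and y\<close>

text \<open>Restrictions of forms of degree \<open>d\<close> to the chosen representatives of points. Values
  depend on the representative, but ratios and vanishing do not.\<close>

definition form :: "nat \<Rightarrow> ('a::field point \<Rightarrow> 'a) \<Rightarrow> bool" where
  "form d h \<longleftrightarrow> (\<exists>c. \<forall>Q. h Q = ternary_form d c (homog_coords Q))"

fun hx :: "'a::field point \<Rightarrow> 'a" where "hx Infinity = 0" | "hx (Affine x y) = x"
fun hy :: "'a::field point \<Rightarrow> 'a" where "hy Infinity = 1" | "hy (Affine x y) = y"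
fun hz :: "'a::field point \<Rightarrow> 'a" where "hz Infinity = 0" | "hz (Affine x y) = 1"

lemma homog_coords_eq: "homog_coords Q = (hx Q, hy Q, hz Q)"
  by (cases Q) auto

lemma form_ternary_form: "form d (\<lambda>Q. ternary_form d c (homog_coords Q))"
  by (auto simp: form_def)

lemma form_zero: "form d (\<lambda>Q. 0)"
  unfolding form_def by (rule exI[of _ "\<lambda>i j. 0"]) (auto simp: ternary_form_def)

lemma form_add:
  assumes "form d h" "form d k"
  shows "form d (\<lambda>Q. h Q + k Q)"
proof -
  obtain c1 c2 where "\<And>Q. h Q = ternary_form d c1 (homog_coords Q)"
    "\<And>Q. k Q = ternary_form d c2 (homog_coords Q)"
    using assms unfolding form_def by auto
  then have "h Q + k Q = ternary_form d (\<lambda>i j. c1 i j + c2 i j) (homog_coords Q)" for Q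
    by (simp add: ternary_form_def homog_coords_eq sum.distrib distrib_right)
  then show ?thesis unfolding form_def by blast
qed

lemma form_scale:
  assumes "form d h"
  shows "form d (\<lambda>Q. r * h Q)"
proof -
  obtain c where "\<And>Q. h Q = ternary_form d c (homog_coords Q)"
    using assms unfolding form_def by auto
  then have "r * h Q = ternary_form d (\<lambda>i j. r * c i j) (homog_coords Q)" for Q
    by (simp add: ternary_form_def homog_coords_eq sum_distrib_left mult.assoc)
  then show ?thesis unfolding form_def by blast
qed

lemma form_sum: "(\<And>i. i \<in> S \<Longrightarrow> form d (h i)) \<Longrightarrow> form d (\<lambda>Q. \<Sum>i\<in>S. h i Q)"
  by (induction S rule: infinite_finite_induct) (auto intro: form_zero form_add)

lemma form_diff: "form d h \<Longrightarrow> form d k \<Longrightarrow> form d (\<lambda>Q. h Q - k Q)"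
  using form_add[of d h "\<lambda>Q. -1 * k Q"] form_scale[of d k "-1"] by simp

definition coord_monomial :: "nat \<Rightarrow> nat \<Rightarrow> nat \<Rightarrow> 'a::field point \<Rightarrow> 'a" where
  "coord_monomial i j k Q = hx Q ^ i * hy Q ^ j * hz Q ^ k"

lemma form_coord_monomial:
  assumes "d = i + j + k"
  shows "form d (coord_monomial i j k)"
  unfolding form_def
proof (intro exI allI)
  fix Q :: "'a point"
  have inner: "(\<Sum>j'\<le>d - i'. (if i' = i \<and> j' = j then 1 else 0) * hx Q ^ i' * hy Q ^ j' * hz Q ^ (d - i' - j'))
     = (if i' = i then coord_monomial i j k Q else 0)" for i'
  proof (cases "i' = i")
    case True
    have "(\<Sum>j'\<le>d - i'. (if i' = i \<and> j' = j then 1 else 0) * hx Q ^ i' * hy Q ^ j' * hz Q ^ (d - i' - j'))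
        = (\<Sum>j'\<le>d - i. if j' = j then coord_monomial i j k Q else 0)"
      using True assms by (intro sum.cong) (auto simp: coord_monomial_def)
    then show ?thesis using True assms by simp
  qed simp
  show "coord_monomial i j k Q = ternary_form d (\<lambda>i' j'. if i' = i \<and> j' = j then 1 else 0) (homog_coords Q)"
    unfolding ternary_form_def homog_coords_eq prod.case inner using assms by simp
qed

lemma form_expand:
  assumes "form d h"
  obtains c where "h = (\<lambda>Q. \<Sum>i\<le>d. \<Sum>j\<le>d - i. c i j * coord_monomial i j (d - i - j) Q)"
proof -
  obtain c where c: "\<And>Q. h Q = ternary_form d c (homog_coords Q)"
    using assms unfolding form_def by auto
  have "h = (\<lambda>Q. \<Sum>i\<le>d. \<Sum>j\<le>d - i. c i j * coord_monomial i j (d - i - j) Q)"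
    by (rule ext) (simp add: c ternary_form_def homog_coords_eq coord_monomial_def mult.assoc)
  then show ?thesis using that by blast
qed

lemma form_mult:
  assumes "form d h" "form e k"
  shows "form (d + e) (\<lambda>Q. h Q * k Q)"
proof -
  obtain c where h: "h = (\<lambda>Q. \<Sum>i\<le>d. \<Sum>j\<le>d - i. c i j * coord_monomial i j (d - i - j) Q)"
    using assms(1) by (rule form_expand)
  obtain c' where k: "k = (\<lambda>Q. \<Sum>i\<le>e. \<Sum>j\<le>e - i. c' i j * coord_monomial i j (e - i - j) Q)"
    using assms(2) by (rule form_expand)
  have *: "(\<lambda>Q. h Q * k Q) = (\<lambda>Q. \<Sum>i\<le>d. \<Sum>i'\<le>e. \<Sum>j\<le>d - i. \<Sum>j'\<le>e - i'.
      c i j * c' i' j' * coord_monomial (i + i') (j + j') ((d - i - j) + (e - i' - j')) Q)"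
    unfolding h k sum_product
    by (intro ext sum.cong refl) (simp only: coord_monomial_def power_add mult_ac)
  show ?thesis unfolding * by (intro form_sum form_scale form_coord_monomial) auto
qed

lemma form_const: "form 0 (\<lambda>Q. r)"
  using form_scale[OF form_coord_monomial[of 0 0 0 0], of r] by (simp add: coord_monomial_def)

lemma form_power: "form d h \<Longrightarrow> form (n * d) (\<lambda>Q. h Q ^ n)"
  by (induction n) (auto intro: form_const form_mult)

lemma form_hx: "form 1 hx" and form_hy: "form 1 hy" and form_hz: "form 1 hz"
  using form_coord_monomial[of 1 1 0 0] form_coord_monomial[of 1 0 1 0] form_coord_monomial[of 1 0 0 1]
  by (simp_all add: coord_monomial_def[abs_def])

lemma coeff_mult_bound:
  fixes p q :: "'a::comm_semiring_1 poly"
  assumes "degree p \<le> m" "degree q \<le> n"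
  shows "coeff (p * q) (m + n) = coeff p m * coeff q n"
proof -
  have "coeff (p * q) (m + n) = (\<Sum>i\<le>m + n. coeff p i * coeff q (m + n - i))"
    by (rule coeff_mult)
  also have "\<dots> = (\<Sum>i\<le>m + n. if i = m then coeff p m * coeff q n else 0)"
  proof (rule sum.cong)
    fix i
    show "coeff p i * coeff q (m + n - i) = (if i = m then coeff p m * coeff q n else 0)"
      using assms coeff_eq_0[of p i] coeff_eq_0[of q "m + n - i"]
      by (cases i m rule: linorder_cases) auto
  qed simp
  finally show ?thesis by simp
qed

context elliptic
begin

definition cubic :: "'k poly" where "cubic = [:b, a, 0, 1:]"

lemma poly_cubic [simp]: "poly cubic x = x ^ 3 + a * x + b"
  by (simp add: cubic_def power3_eq_cube algebra_simps)

lemma degree_cubic [simp]: "degree cubic = 3" and lead_cubic: "coeff cubic 3 = 1"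
  by (simp_all add: cubic_def numeral_3_eq_3)

text \<open>The function \<open>A(x) + y B(x)\<close> has a pole of order at most \<open>3 d\<close> at
  infinity, where \<open>x\<close> and \<open>y\<close> have poles of order 2 and 3; the even orders come from
  \<open>A\<close> and the odd ones from \<open>B\<close>. The number \<open>r\<close> is the coefficient of the
  term of order exactly \<open>3 d\<close>, which for a form of degree \<open>d\<close> is its value at infinity
  (\<open>y\<close> being the coordinate that does not vanish there).\<close>

definition pole_bound :: "nat \<Rightarrow> 'k \<Rightarrow> 'k poly \<Rightarrow> 'k poly \<Rightarrow> bool" where
  "pole_bound d r A B \<longleftrightarrow> (\<forall>i. 2 * i > 3 * d \<longrightarrow> coeff A i = 0) \<and>
     (\<forall>i. 2 * i + 3 > 3 * d \<longrightarrow> coeff B i = 0) \<and>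
     r = (if even d then coeff A (3 * (d div 2)) else coeff B (3 * (d div 2)))"

lemma pole_bound_sum:
  "(\<And>i. i \<in> S \<Longrightarrow> pole_bound d (r i) (A i) (B i)) \<Longrightarrow>
     pole_bound d (\<Sum>i\<in>S. r i) (\<Sum>i\<in>S. A i) (\<Sum>i\<in>S. B i)"
  by (induction S rule: infinite_finite_induct) (auto simp: pole_bound_def)

lemma pole_bound_scale:
  "pole_bound d r A B \<Longrightarrow> pole_bound d (s * r) (smult s A) (smult s B)"
  by (auto simp: pole_bound_def)

lemma monic_cubic_power: "degree (monom 1 i * cubic ^ m) = i + 3 * m" "coeff (monom 1 i * cubic ^ m) (i + 3 * m) = 1"
proof -
  have nz: "cubic \<noteq> 0" using degree_cubic by fastforce
  have l: "lead_coeff cubic = 1" using lead_cubic by simp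
  show d: "degree (monom 1 i * cubic ^ m) = i + 3 * m"
    using nz by (simp add: degree_mult_eq degree_monom_eq degree_power_eq)
  show "coeff (monom 1 i * cubic ^ m) (i + 3 * m) = 1"
    using lead_coeff_mult[of "monom 1 i" "cubic ^ m"] unfolding d
    by (simp only: lead_coeff_power l) (simp add: degree_monom_eq)
qed

definition yeval :: "'k poly \<Rightarrow> 'k poly \<Rightarrow> 'k \<Rightarrow> 'k \<Rightarrow> 'k" where
  "yeval A B x y = poly A x + y * poly B x"

lemma coord_monomial_affine:
  assumes "d = i + j + k"
  shows "\<exists>A B. pole_bound d (coord_monomial i j k Infinity) A B \<and>
     (\<forall>x y. Affine x y \<in> points E \<longrightarrow> coord_monomial i j k (Affine x y) = yeval A B x y)"
proof -
  have z: "coeff (monom 1 i * cubic ^ m) n = 0" if "n > i + 3 * m" for n m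
    using monic_cubic_power(1)[of i m] that by (metis coeff_eq_0)
  show ?thesis
  proof (cases "even j")
    case True
    then obtain m where j: "j = 2 * m" by (elim evenE)
    let ?h = "monom 1 i * cubic ^ m"
    have "coord_monomial i j k Infinity = (if even d then coeff ?h (3 * (d div 2)) else coeff 0 (3 * (d div 2)))"
    proof (cases "i = 0 \<and> k = 0")
      case True
      then have "d = 2 * m" using assms j by simp
      then show ?thesis using True monic_cubic_power(2)[of 0 m] by (simp add: coord_monomial_def)
    next
      case False
      then have "3 * (d div 2) > i + 3 * m" if "even d"
      proof -
        obtain e where e: "d = 2 * e" using \<open>even d\<close> by (elim evenE)
        have "2 * e = i + 2 * m + k" using e assms j by simp
        then have "i + 3 * m < 3 * e" using False by linarith
        then show ?thesis using e by simp
      qed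
      then show ?thesis using False z by (auto simp: coord_monomial_def)
    qed
    then have "pole_bound d (coord_monomial i j k Infinity) ?h 0"
      unfolding pole_bound_def using assms j by (auto intro: z)
    moreover have "coord_monomial i j k (Affine x y) = yeval ?h 0 x y" if "Affine x y \<in> points E" for x y
      using that by (simp add: coord_monomial_def yeval_def poly_monom j power_mult)
    ultimately show ?thesis by blast
  next
    case False
    then obtain m where j: "j = Suc (2 * m)" by (elim oddE) simp
    let ?h = "monom 1 i * cubic ^ m"
    have "coord_monomial i j k Infinity = (if even d then coeff 0 (3 * (d div 2)) else coeff ?h (3 * (d div 2)))"
    proof (cases "i = 0 \<and> k = 0")
      case True
      then have "d = Suc (2 * m)" using assms j by simp
      then show ?thesis using True monic_cubic_power(2)[of 0 m] by (simp add: coord_monomial_def)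
    next
      case False
      then have "3 * (d div 2) > i + 3 * m" if "odd d"
      proof -
        obtain e where e: "d = Suc (2 * e)" using \<open>odd d\<close> by (elim oddE) simp
        have "2 * e = i + 2 * m + k" using e assms j by simp
        then have "i + 3 * m < 3 * e" using False by linarith
        then show ?thesis using e by simp
      qed
      then show ?thesis using False z by (auto simp: coord_monomial_def)
    qed
    then have "pole_bound d (coord_monomial i j k Infinity) 0 ?h"
      unfolding pole_bound_def using assms j by (auto intro: z)
    moreover have "coord_monomial i j k (Affine x y) = yeval 0 ?h x y" if "Affine x y \<in> points E" for x y
      using that by (simp add: coord_monomial_def yeval_def poly_monom j power_mult)
    ultimately show ?thesis by blast
  qed
qed

text \<open>Eliminating even powers of \<open>y\<close> with the equation of the curve turns a form into
  \<open>A(x) + y B(x)\<close>. Keeping track of the pole order relates its value at infinity to the top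
  coefficients of \<open>A\<close> and \<open>B\<close>.\<close>

lemma form_affine:
  assumes "form d h"
  shows "\<exists>A B. pole_bound d (h Infinity) A B \<and>
    (\<forall>x y. Affine x y \<in> points E \<longrightarrow> h (Affine x y) = yeval A B x y)"
proof -
  obtain c where h: "h = (\<lambda>Q. \<Sum>i\<le>d. \<Sum>j\<le>d - i. c i j * coord_monomial i j (d - i - j) Q)"
    using assms by (rule form_expand)
  have "\<exists>A B. i + j \<le> d \<longrightarrow> pole_bound d (coord_monomial i j (d - i - j) Infinity) A B \<and>
     (\<forall>x y. Affine x y \<in> points E \<longrightarrow> coord_monomial i j (d - i - j) (Affine x y) = yeval A B x y)" for i j
    using coord_monomial_affine[of d i j "d - i - j"] by (cases "i + j \<le> d") auto
  then obtain A B where AB: "\<And>i j. i + j \<le> d \<Longrightarrow> pole_bound d (coord_monomial i j (d - i - j) Infinity) (A i j) (B i j)"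
    "\<And>i j x y. i + j \<le> d \<Longrightarrow> Affine x y \<in> points E \<Longrightarrow> coord_monomial i j (d - i - j) (Affine x y) = yeval (A i j) (B i j) x y"
    by metis
  let ?A = "\<Sum>i\<le>d. \<Sum>j\<le>d - i. smult (c i j) (A i j)"
  let ?B = "\<Sum>i\<le>d. \<Sum>j\<le>d - i. smult (c i j) (B i j)"
  have "pole_bound d (h Infinity) ?A ?B"
    unfolding h by (intro pole_bound_sum pole_bound_scale AB) auto
  moreover have "h (Affine x y) = yeval ?A ?B x y" if "Affine x y \<in> points E" for x y
  proof -
    have "h (Affine x y) = (\<Sum>i\<le>d. \<Sum>j\<le>d - i. c i j * yeval (A i j) (B i j) x y)"
      unfolding h using that by (intro sum.cong refl arg_cong2[where f="(*)"] AB(2)) auto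
    also have "\<dots> = yeval ?A ?B x y"
      by (simp add: poly_sum yeval_def sum.distrib sum_distrib_left algebra_simps)
    finally show ?thesis .
  qed
  ultimately show ?thesis by blast
qed

text \<open>The norm of \<open>A(x) + y B(x)\<close> to polynomials in \<open>x\<close>: the product with the
  conjugate under \<open>y \<mapsto> - y\<close>.\<close>

definition ynorm :: "'k poly \<Rightarrow> 'k poly \<Rightarrow> 'k poly" where
  "ynorm A B = A * A - cubic * (B * B)"

lemma poly_ynorm: "Affine x y \<in> points E \<Longrightarrow> poly (ynorm A B) x = yeval A B x y * yeval A B x (- y)"
proof -
  assume "Affine x y \<in> points E"
  then have "poly cubic x = y ^ 2" by simp
  then show ?thesis unfolding ynorm_def yeval_def poly_diff poly_mult by Groebner_Basis.algebra
qed

text \<open>The norm form is anisotropic because the cubic has odd degree.\<close>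

lemma ynorm_eq_0: "ynorm A B = 0 \<longleftrightarrow> A = 0 \<and> B = 0"
proof
  assume "ynorm A B = 0"
  then have e: "A * A = cubic * (B * B)" by (simp add: ynorm_def)
  have nz: "cubic \<noteq> 0" using degree_cubic by fastforce
  have "B = 0"
  proof (rule ccontr)
    assume B: "B \<noteq> 0"
    then have "A \<noteq> 0" using e nz by auto
    then have "2 * degree A = 3 + 2 * degree B" using arg_cong[OF e, of degree] B nz
      by (simp add: degree_mult_eq)
    then show False by presburger
  qed
  then show "A = 0 \<and> B = 0" using e by simp
qed (simp add: ynorm_def)

lemma degree_ynorm:
  assumes "pole_bound d r A B"
  shows "degree (ynorm A B) \<le> 3 * d" "coeff (ynorm A B) (3 * d) = (if even d then r ^ 2 else - (r ^ 2))"
proof -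
  have dA: "2 * degree A \<le> 3 * d"
    using assms unfolding pole_bound_def by (metis leading_coeff_0_iff degree_0 linorder_not_le mult_0_right le0)
  have dB: "B = 0 \<or> 2 * degree B + 3 \<le> 3 * d"
    using assms unfolding pole_bound_def by (metis leading_coeff_0_iff linorder_not_le)
  have dAA: "degree (A * A) \<le> 3 * d" using degree_mult_le[of A A] dA by linarith
  have dBB: "degree (cubic * (B * B)) \<le> 3 * d"
    using degree_mult_le[of cubic "B * B"] degree_mult_le[of B B] dB by (cases "B = 0") auto
  show "degree (ynorm A B) \<le> 3 * d" unfolding ynorm_def using dAA dBB by (rule degree_diff_le)
  show "coeff (ynorm A B) (3 * d) = (if even d then r ^ 2 else - (r ^ 2))"
  proof (cases "even d")
    case True
    then have d: "3 * d = 3 * (d div 2) + 3 * (d div 2)" by (elim evenE) simp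
    have "degree A \<le> 3 * (d div 2)" using dA True by (elim evenE) auto
    then have 1: "coeff (A * A) (3 * d) = r ^ 2"
      unfolding d using coeff_mult_bound[of A "3 * (d div 2)" A "3 * (d div 2)"] assms True by (simp only: pole_bound_def power2_eq_square if_True)
    have "coeff (cubic * (B * B)) (3 * d) = 0"
    proof (cases "B = 0")
      case False
      then have "2 * degree B + 3 < 3 * d" using dB True by (elim evenE) presburger
      then show ?thesis using degree_mult_le[of cubic "B * B"] degree_mult_le[of B B]
        by (intro coeff_eq_0) auto
    qed auto
    then show ?thesis using 1 True by (simp add: ynorm_def)
  next
    case False
    then have d: "3 * d = 3 + (3 * (d div 2) + 3 * (d div 2))" by (elim oddE) simp
    have B: "degree B \<le> 3 * (d div 2)" using dB False by (elim oddE) auto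
    then have BB: "degree (B * B) \<le> 3 * (d div 2) + 3 * (d div 2)"
      using degree_mult_le[of B B] by linarith
    have 1: "coeff (cubic * (B * B)) (3 * d) = r ^ 2"
      unfolding d using coeff_mult_bound[of cubic 3 "B * B", OF _ BB] coeff_mult_bound[OF B B] assms False
      by (simp only: pole_bound_def power2_eq_square lead_cubic degree_cubic if_False order_refl mult_1)
    have "2 * degree A < 3 * d" using dA False by (elim oddE) presburger
    then have "coeff (A * A) (3 * d) = 0"
      using degree_mult_le[of A A] by (intro coeff_eq_0) auto
    then show ?thesis using 1 False by (simp add: ynorm_def)
  qed
qed

lemma finite_zeros_yeval:
  assumes "ynorm A B \<noteq> 0"
  shows "finite {Q \<in> points E. Q = Infinity \<or> yeval A B (xc Q) (yc Q) = 0}"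
proof -
  have "finite {x. poly (ynorm A B) x = 0}" using poly_roots_finite assms by blast
  from finite_points_xc_set[OF this] show ?thesis
  proof (rule rev_finite_subset, intro subsetI)
    fix Q assume "Q \<in> {Q \<in> points E. Q = Infinity \<or> yeval A B (xc Q) (yc Q) = 0}"
    then show "Q \<in> {P \<in> points E. P = Infinity \<or> xc P \<in> {x. poly (ynorm A B) x = 0}}"
      by (cases Q) (auto simp: poly_ynorm)
  qed
qed

text \<open>A form that does not vanish at one point has nonzero norm, and its zeros lie over the roots of the
  norm.\<close>

lemma finite_zeros_form:
  assumes h: "form d h" and Q0: "Q0 \<in> points E" "h Q0 \<noteq> 0"
  shows "finite {Q \<in> points E. h Q = 0}"
proof -
  obtain A B where AB: "pole_bound d (h Infinity) A B"
    "\<And>x y. Affine x y \<in> points E \<Longrightarrow> h (Affine x y) = yeval A B x y"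
    using form_affine[OF h] by blast
  have "ynorm A B \<noteq> 0"
  proof (cases Q0)
    case Infinity
    then show ?thesis using degree_ynorm(2)[OF AB(1)] Q0 by (auto split: if_splits)
  next
    case (Affine x y)
    then have "yeval A B x y \<noteq> 0" using AB(2)[of x y] Q0 by simp
    then show ?thesis by (auto simp: ynorm_eq_0 yeval_def)
  qed
  from finite_zeros_yeval[OF this] show ?thesis
  proof (rule rev_finite_subset, intro subsetI)
    fix Q assume "Q \<in> {Q \<in> points E. h Q = 0}"
    then show "Q \<in> {Q \<in> points E. Q = Infinity \<or> yeval A B (xc Q) (yc Q) = 0}"
      using AB(2) by (cases Q) auto
  qed
qed

end

section \<open>Regular functions and regular maps\<close>

context elliptic
begin

text \<open>The cofinite (Zariski) filter on the curve. Statements about generic points become eventualities of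
  this filter.\<close>

definition cofin :: "'k point filter" where
  "cofin = inf cofinite (principal (points E))"

text \<open>The neighbourhood filter of the Zariski topology of the curve: cofinite sets containing
  \<open>Q0\<close>.\<close>

definition near :: "'k point \<Rightarrow> 'k point filter" where
  "near Q0 = sup (principal {Q0}) cofin"

lemma eventually_cofin: "eventually A cofin \<longleftrightarrow> finite {Q \<in> points E. \<not> A Q}"
  unfolding cofin_def eventually_inf_principal eventually_cofinite by (simp add: conj_commute)

lemma eventually_near: "eventually A (near Q0) \<longleftrightarrow> A Q0 \<and> eventually A cofin"
  by (simp add: near_def eventually_sup eventually_principal)

lemma cofin_points: "eventually (\<lambda>Q. Q \<in> points E) cofin"
  by (simp add: eventually_cofin)

lemma near_points: "Q0 \<in> points E \<Longrightarrow> eventually (\<lambda>Q. Q \<in> points E) (near Q0)"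
  by (simp add: eventually_near cofin_points)

lemma cofin_nontrivial: "cofin \<noteq> bot"
  by (auto simp: trivial_limit_def eventually_cofin infinite_points)

lemma cofin_ex:
  assumes "eventually A cofin"
  shows "\<exists>T\<in>points E. A T"
proof -
  have "eventually (\<lambda>T. T \<in> points E \<and> A T) cofin"
    using assms cofin_points by eventually_elim simp
  from eventually_happens'[OF cofin_nontrivial this] show ?thesis by blast
qed

lemma cofin_translate:
  assumes "R \<in> points E" "eventually A cofin"
  shows "eventually (\<lambda>T. A (R \<boxplus> T)) cofin"
  using finite_translate[of R "\<lambda>T. \<not> A T"] assms by (simp add: eventually_cofin)

lemma cofin_neg:
  assumes "eventually A cofin"
  shows "eventually (\<lambda>T. A (neg_point T)) cofin"
proof -
  have "finite (neg_point ` {Q \<in> points E. \<not> A Q})" using assms by (simp add: eventually_cofin)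
  moreover have "{Q \<in> points E. \<not> A (neg_point Q)} \<subseteq> neg_point ` {Q \<in> points E. \<not> A Q}"
    by (auto intro!: image_eqI[of _ neg_point "neg_point _"])
  ultimately show ?thesis by (auto simp: eventually_cofin intro: finite_subset)
qed

lemma cofin_xc:
  assumes "finite S"
  shows "eventually (\<lambda>T. T \<noteq> Infinity \<and> xc T \<notin> S) cofin"
  using finite_points_xc_set[OF assms] by (simp add: eventually_cofin conj_disj_distribL)

lemma cofin_neq: "eventually (\<lambda>T. T \<noteq> R) cofin"
  unfolding eventually_cofin by (rule finite_subset[of _ "{R}"]) auto

text \<open>Elements of the local ring at \<open>Q0\<close>: quotients of forms of equal degree whose
  denominator does not vanish at \<open>Q0\<close>. The value at \<open>Q0\<close> itself is included, since
  \<open>Q0\<close> belongs to every set of the filter.\<close>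

definition regular_at :: "'k point \<Rightarrow> ('k point \<Rightarrow> 'k) \<Rightarrow> bool" where
  "regular_at Q0 h \<longleftrightarrow> (\<exists>d N D. form d N \<and> form d D \<and> D Q0 \<noteq> 0 \<and> (\<forall>\<^sub>F Q in near Q0. h Q * D Q = N Q))"

lemma form_nonzero_near:
  assumes "Q0 \<in> points E" "form d D" "D Q0 \<noteq> 0"
  shows "\<forall>\<^sub>F Q in near Q0. D Q \<noteq> 0"
  using finite_zeros_form[OF assms(2,1,3)] assms by (simp add: eventually_near eventually_cofin)

lemma regular_at_const: "regular_at Q0 (\<lambda>Q. r)"
  unfolding regular_at_def by (rule exI[of _ 0], rule exI[of _ "\<lambda>_. r"], rule exI[of _ "\<lambda>_. 1"])
    (simp add: form_const)

lemma regular_at_cong: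
  assumes "regular_at Q0 h" "\<forall>\<^sub>F Q in near Q0. h Q = k Q"
  shows "regular_at Q0 k"
proof -
  obtain d N D where 1: "form d N" "form d D" "D Q0 \<noteq> 0" and 2: "\<forall>\<^sub>F Q in near Q0. h Q * D Q = N Q"
    using assms unfolding regular_at_def by blast
  have "\<forall>\<^sub>F Q in near Q0. k Q * D Q = N Q" using 2 assms(2) by eventually_elim simp
  then show ?thesis using 1 unfolding regular_at_def by blast
qed

lemma regular_at_add:
  assumes "regular_at Q0 h" "regular_at Q0 k"
  shows "regular_at Q0 (\<lambda>Q. h Q + k Q)"
proof -
  obtain d N D where 1: "form d N" "form d D" "D Q0 \<noteq> 0" and 2: "\<forall>\<^sub>F Q in near Q0. h Q * D Q = N Q"
    using assms(1) unfolding regular_at_def by blast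
  obtain e M C where 3: "form e M" "form e C" "C Q0 \<noteq> 0" and 4: "\<forall>\<^sub>F Q in near Q0. k Q * C Q = M Q"
    using assms(2) unfolding regular_at_def by blast
  have "\<forall>\<^sub>F Q in near Q0. (h Q + k Q) * (D Q * C Q) = N Q * C Q + D Q * M Q"
    using 2 4 by eventually_elim (simp add: algebra_simps)
  moreover have "form (d + e) (\<lambda>Q. N Q * C Q + D Q * M Q)" "form (d + e) (\<lambda>Q. D Q * C Q)"
    using 1 3 by (auto intro: form_add form_mult)
  ultimately show ?thesis using 1 3 unfolding regular_at_def
    by (intro exI[of _ "d + e"] exI[of _ "\<lambda>Q. N Q * C Q + D Q * M Q"] exI[of _ "\<lambda>Q. D Q * C Q"]) auto
qed

lemma regular_at_mult:
  assumes "regular_at Q0 h" "regular_at Q0 k"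
  shows "regular_at Q0 (\<lambda>Q. h Q * k Q)"
proof -
  obtain d N D where 1: "form d N" "form d D" "D Q0 \<noteq> 0" and 2: "\<forall>\<^sub>F Q in near Q0. h Q * D Q = N Q"
    using assms(1) unfolding regular_at_def by blast
  obtain e M C where 3: "form e M" "form e C" "C Q0 \<noteq> 0" and 4: "\<forall>\<^sub>F Q in near Q0. k Q * C Q = M Q"
    using assms(2) unfolding regular_at_def by blast
  have "\<forall>\<^sub>F Q in near Q0. (h Q * k Q) * (D Q * C Q) = N Q * M Q"
    using 2 4
  proof eventually_elim
    case (elim Q)
    then show ?case unfolding elim[symmetric] by (simp only: mult_ac)
  qed
  moreover have "form (d + e) (\<lambda>Q. N Q * M Q)" "form (d + e) (\<lambda>Q. D Q * C Q)"
    using 1 3 by (auto intro: form_mult)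
  ultimately show ?thesis using 1 3 unfolding regular_at_def
    by (intro exI[of _ "d + e"] exI[of _ "\<lambda>Q. N Q * M Q"] exI[of _ "\<lambda>Q. D Q * C Q"]) auto
qed

lemma regular_at_uminus: "regular_at Q0 h \<Longrightarrow> regular_at Q0 (\<lambda>Q. - h Q)"
  using regular_at_mult[OF regular_at_const[of Q0 "-1"]] by simp

lemma regular_at_diff: "regular_at Q0 h \<Longrightarrow> regular_at Q0 k \<Longrightarrow> regular_at Q0 (\<lambda>Q. h Q - k Q)"
  using regular_at_add[OF _ regular_at_uminus] by simp

lemma regular_at_power: "regular_at Q0 h \<Longrightarrow> regular_at Q0 (\<lambda>Q. h Q ^ n)"
  by (induction n) (auto intro: regular_at_const regular_at_mult)

lemma regular_at_nonzero:
  assumes "Q0 \<in> points E" "regular_at Q0 h" "h Q0 \<noteq> 0"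
  shows "\<forall>\<^sub>F Q in near Q0. h Q \<noteq> 0"
proof -
  obtain d N D where 1: "form d N" "form d D" "D Q0 \<noteq> 0" and 2: "\<forall>\<^sub>F Q in near Q0. h Q * D Q = N Q"
    using assms(2) unfolding regular_at_def by blast
  have "N Q0 \<noteq> 0" using 1(3) 2 assms(3) by (auto simp: eventually_near)
  from form_nonzero_near[OF assms(1) 1(1) this] 2 show ?thesis by eventually_elim auto
qed

lemma regular_at_inverse:
  assumes "Q0 \<in> points E" "regular_at Q0 h" "h Q0 \<noteq> 0"
  shows "regular_at Q0 (\<lambda>Q. inverse (h Q))"
proof -
  obtain d N D where 1: "form d N" "form d D" "D Q0 \<noteq> 0" and 2: "\<forall>\<^sub>F Q in near Q0. h Q * D Q = N Q"
    using assms(2) unfolding regular_at_def by blast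
  have N: "N Q0 \<noteq> 0" using 1(3) 2 assms(3) by (auto simp: eventually_near)
  have "\<forall>\<^sub>F Q in near Q0. inverse (h Q) * N Q = D Q"
    using regular_at_nonzero[OF assms] 2
  proof eventually_elim
    case (elim Q)
    show ?case using elim(1) unfolding elim(2)[symmetric] by (simp add: field_simps)
  qed
  then show ?thesis using 1 N unfolding regular_at_def by blast
qed

lemma regular_at_divide:
  assumes "Q0 \<in> points E" "regular_at Q0 h" "regular_at Q0 k" "k Q0 \<noteq> 0"
  shows "regular_at Q0 (\<lambda>Q. h Q / k Q)"
  unfolding divide_inverse using assms by (intro regular_at_mult regular_at_inverse)

lemmas regular_at_intros = regular_at_const regular_at_add regular_at_diff regular_at_mult regular_at_power regular_at_uminus regular_at_divide

definition affine_near :: "'k point \<Rightarrow> ('k point \<Rightarrow> 'k point) \<Rightarrow> bool" where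
  "affine_near Q0 f \<longleftrightarrow> (\<forall>\<^sub>F Q in near Q0. f Q \<noteq> Infinity) \<and> regular_at Q0 (\<lambda>Q. xc (f Q)) \<and> regular_at Q0 (\<lambda>Q. yc (f Q))"

lemma affine_near_cong:
  assumes "Q0 \<in> points E" "affine_near Q0 f" "\<And>Q. Q \<in> points E \<Longrightarrow> f Q = g Q"
  shows "affine_near Q0 g"
proof -
  have e: "\<forall>\<^sub>F Q in near Q0. f Q = g Q" using near_points[OF assms(1)] by eventually_elim (rule assms)
  have "\<forall>\<^sub>F Q in near Q0. f Q \<noteq> Infinity" using assms(2) by (simp add: affine_near_def)
  then have "\<forall>\<^sub>F Q in near Q0. g Q \<noteq> Infinity" using e by eventually_elim simp
  moreover have "regular_at Q0 (\<lambda>Q. xc (g Q))"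
    by (rule regular_at_cong[of _ "\<lambda>Q. xc (f Q)"]) (use assms(2) e in \<open>auto simp: affine_near_def elim: eventually_mono\<close>)
  moreover have "regular_at Q0 (\<lambda>Q. yc (g Q))"
    by (rule regular_at_cong[of _ "\<lambda>Q. yc (f Q)"]) (use assms(2) e in \<open>auto simp: affine_near_def elim: eventually_mono\<close>)
  ultimately show ?thesis by (simp add: affine_near_def)
qed

lemma affine_near_intro:
  assumes "regular_at Q0 u" "regular_at Q0 v" "\<forall>\<^sub>F Q in near Q0. f Q = Affine (u Q) (v Q)"
  shows "affine_near Q0 f"
  unfolding affine_near_def using assms(3)
  by (intro conjI regular_at_cong[OF assms(1)] regular_at_cong[OF assms(2)]) (auto elim: eventually_mono)

lemma add_distinct:
  assumes "x1 \<noteq> x2"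
  shows "Affine x1 y1 \<boxplus> Affine x2 y2 =
    (let l = (y2 - y1) / (x2 - x1); x3 = l ^ 2 - x1 - x2 in Affine x3 (l * (x1 - x3) - y1))"
  using assms by (simp add: add_points.simps(3) Let_def)

text \<open>Around a point where the two values have different \<open>x\<close>-coordinates the chord formula is
  regular.\<close>

lemma affine_near_add:
  assumes Q0: "Q0 \<in> points E" and f: "affine_near Q0 f" and g: "affine_near Q0 g" and ne: "xc (f Q0) \<noteq> xc (g Q0)"
  shows "affine_near Q0 (\<lambda>Q. f Q \<boxplus> g Q)"
proof -
  define l where "l = (\<lambda>Q. (yc (g Q) - yc (f Q)) / (xc (g Q) - xc (f Q)))"
  define w where "w = (\<lambda>Q. l Q ^ 2 - xc (f Q) - xc (g Q))"
  have ne': "xc (g Q0) - xc (f Q0) \<noteq> 0" using ne by simp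
  have l: "regular_at Q0 l" unfolding l_def using f g Q0 ne' by (auto simp: affine_near_def intro!: regular_at_intros)
  have w: "regular_at Q0 w" unfolding w_def using f g l by (auto simp: affine_near_def intro!: regular_at_intros)
  have "regular_at Q0 (\<lambda>Q. l Q * (xc (f Q) - w Q) - yc (f Q))"
    using f l w by (auto simp: affine_near_def intro!: regular_at_intros)
  moreover have "\<forall>\<^sub>F Q in near Q0. xc (g Q) - xc (f Q) \<noteq> 0"
    by (rule regular_at_nonzero) (use f g Q0 ne' in \<open>auto simp: affine_near_def intro!: regular_at_intros\<close>)
  moreover have "\<forall>\<^sub>F Q in near Q0. f Q \<noteq> Infinity" "\<forall>\<^sub>F Q in near Q0. g Q \<noteq> Infinity"
    using f g by (auto simp: affine_near_def)
  ultimately show ?thesis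
  proof (elim affine_near_intro[OF w])
    assume 1: "\<forall>\<^sub>F Q in near Q0. xc (g Q) - xc (f Q) \<noteq> 0" "\<forall>\<^sub>F Q in near Q0. f Q \<noteq> Infinity"
      "\<forall>\<^sub>F Q in near Q0. g Q \<noteq> Infinity"
    then show "\<forall>\<^sub>F Q in near Q0. f Q \<boxplus> g Q = Affine (w Q) (l Q * (xc (f Q) - w Q) - yc (f Q))"
    proof eventually_elim
      case (elim Q)
      obtain x1 y1 where "f Q = Affine x1 y1" using elim(2) by (cases "f Q") auto
      moreover obtain x2 y2 where "g Q = Affine x2 y2" using elim(3) by (cases "g Q") auto
      ultimately show ?case using elim add_distinct[of x1 x2 y1 y2] by (simp add: w_def l_def Let_def)
    qed
  qed
qed

lemma affine_near_const: "T \<noteq> Infinity \<Longrightarrow> affine_near Q0 (\<lambda>Q. T)"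
  by (auto simp: affine_near_def regular_at_const)

lemma affine_near_neg: "affine_near Q0 f \<Longrightarrow> affine_near Q0 (\<lambda>Q. neg_point (f Q))"
proof -
  assume f: "affine_near Q0 f"
  have x: "xc (neg_point P) = xc P" and y: "yc (neg_point P) = - yc P" for P by (cases P; simp)+
  show ?thesis using f by (auto simp: affine_near_def x y intro: regular_at_uminus)
qed

text \<open>Regularity of \<open>f\<close> at \<open>Q0\<close> without charts at infinity: after translation by
  almost every point \<open>T\<close> the values near \<open>Q0\<close> are affine. The group law does the work
  of changing charts, and closure under addition only needs the chord formula.\<close>

definition map_regular_at :: "'k point \<Rightarrow> ('k point \<Rightarrow> 'k point) \<Rightarrow> bool" where
  "map_regular_at Q0 f \<longleftrightarrow> (\<forall>\<^sub>F T in cofin. affine_near Q0 (\<lambda>Q. f Q \<boxplus> T))"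

lemma aff_imp_map_regular:
  assumes Q0: "Q0 \<in> points E" and f: "affine_near Q0 f"
  shows "map_regular_at Q0 f"
  unfolding map_regular_at_def using cofin_xc[of "{xc (f Q0)}", simplified]
proof eventually_elim
  case (elim T)
  show ?case by (rule affine_near_add) (use Q0 f elim affine_near_const in auto)
qed

lemma map_regular_at_cong:
  assumes "Q0 \<in> points E" "map_regular_at Q0 f" "\<And>Q. Q \<in> points E \<Longrightarrow> f Q = g Q"
  shows "map_regular_at Q0 g"
  using assms(2) unfolding map_regular_at_def
proof (rule eventually_mono)
  fix T assume "affine_near Q0 (\<lambda>Q. f Q \<boxplus> T)"
  then show "affine_near Q0 (\<lambda>Q. g Q \<boxplus> T)" by (rule affine_near_cong[OF assms(1)]) (simp add: assms(3))
qed

lemma map_regular_at_shift: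
  assumes Q0: "Q0 \<in> points E" and f: "f \<in> points E \<rightarrow> points E" and U: "U \<in> points E"
    and s: "map_regular_at Q0 f"
  shows "map_regular_at Q0 (\<lambda>Q. f Q \<boxplus> U)"
  unfolding map_regular_at_def using cofin_translate[OF U s[unfolded map_regular_at_def]] cofin_points
proof eventually_elim
  case (elim T)
  show ?case by (rule affine_near_cong[OF Q0 elim(1)]) (use f U elim(2) add_assoc in \<open>auto simp: Pi_iff\<close>)
qed

lemma map_regular_at_unshift:
  assumes Q0: "Q0 \<in> points E" and f: "f \<in> points E \<rightarrow> points E" and U: "U \<in> points E"
    and s: "map_regular_at Q0 (\<lambda>Q. f Q \<boxplus> U)"
  shows "map_regular_at Q0 f"
proof (rule map_regular_at_cong[OF Q0 map_regular_at_shift[OF Q0 _ _ s, of "neg_point U"]])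
  show "f Q \<boxplus> U \<boxplus> neg_point U = f Q" if "Q \<in> points E" for Q
    using that f U add_neg_cancel by (auto simp: Pi_iff)
qed (use f U in \<open>auto simp: Pi_iff\<close>)

lemma add_interchange:
  assumes "P \<in> points E" "Q \<in> points E" "R \<in> points E" "T \<in> points E"
  shows "(P \<boxplus> Q) \<boxplus> (R \<boxplus> T) = (P \<boxplus> R) \<boxplus> (Q \<boxplus> T)"
  using assms by (metis add_assoc add_closed add_left_commute)

text \<open>Translate \<open>f\<close> and \<open>g\<close> by points that make their values affine with
  different \<open>x\<close>-coordinates at \<open>Q0\<close>, add by the chord formula, and translate back.\<close>

lemma map_regular_at_add:
  assumes Q0: "Q0 \<in> points E" and f: "f \<in> points E \<rightarrow> points E" and g: "g \<in> points E \<rightarrow> points E"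
    and sf: "map_regular_at Q0 f" and sg: "map_regular_at Q0 g"
  shows "map_regular_at Q0 (\<lambda>Q. f Q \<boxplus> g Q)"
proof -
  obtain T where T: "T \<in> points E" "affine_near Q0 (\<lambda>Q. f Q \<boxplus> T)"
    using cofin_ex[OF sf[unfolded map_regular_at_def]] by blast
  have "\<forall>\<^sub>F U in cofin. affine_near Q0 (\<lambda>Q. g Q \<boxplus> U) \<and> xc (g Q0 \<boxplus> U) \<noteq> xc (f Q0 \<boxplus> T)"
    using sg[unfolded map_regular_at_def]
      cofin_translate[OF funcset_mem[OF g Q0] cofin_xc[of "{xc (f Q0 \<boxplus> T)}", simplified]]
  proof eventually_elim
    case (elim U)
    show ?case using elim by auto
  qed
  from cofin_ex[OF this] obtain U where
    U: "U \<in> points E" "affine_near Q0 (\<lambda>Q. g Q \<boxplus> U)" "xc (f Q0 \<boxplus> T) \<noteq> xc (g Q0 \<boxplus> U)"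
    by auto
  have "map_regular_at Q0 (\<lambda>Q. (f Q \<boxplus> T) \<boxplus> (g Q \<boxplus> U))"
    by (rule aff_imp_map_regular[OF Q0 affine_near_add[OF Q0 T(2) U(2,3)]])
  then have "map_regular_at Q0 (\<lambda>Q. (f Q \<boxplus> g Q) \<boxplus> (T \<boxplus> U))"
    by (rule map_regular_at_cong[OF Q0]) (use f g T U add_interchange in \<open>simp add: Pi_iff\<close>)
  then show ?thesis
    by (rule map_regular_at_unshift[OF Q0, rotated 2]) (use f g T U in \<open>auto simp: Pi_iff\<close>)
qed

lemma map_regular_at_neg:
  assumes Q0: "Q0 \<in> points E" and f: "f \<in> points E \<rightarrow> points E" and sf: "map_regular_at Q0 f"
  shows "map_regular_at Q0 (\<lambda>Q. neg_point (f Q))"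
  unfolding map_regular_at_def using cofin_neg[OF sf[unfolded map_regular_at_def]] cofin_points
proof eventually_elim
  case (elim T)
  show ?case by (rule affine_near_cong[OF Q0 affine_near_neg[OF elim(1)]])
      (use f elim(2) in \<open>auto simp: Pi_iff neg_add\<close>)
qed

lemma map_regular_at_const: "Q0 \<in> points E \<Longrightarrow> T \<in> points E \<Longrightarrow> map_regular_at Q0 (\<lambda>Q. T)"
proof -
  assume 0: "Q0 \<in> points E" "T \<in> points E"
  have "\<forall>\<^sub>F U in cofin. T \<boxplus> U \<noteq> Infinity"
    using cofin_translate[OF 0(2) cofin_neq[of Infinity]] .
  then show ?thesis unfolding map_regular_at_def by eventually_elim (rule affine_near_const)
qed

end

section \<open>Projective and translated descriptions of a map\<close>

lemma proj_equal_homog_coords: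
  "proj_equal (r0, r1, r2) (homog_coords P) \<longleftrightarrow> (case P of Infinity \<Rightarrow> r0 = 0 \<and> r1 \<noteq> 0 \<and> r2 = 0
     | Affine x y \<Rightarrow> r2 \<noteq> 0 \<and> r0 = r2 * x \<and> r1 = r2 * y)"
  by (cases P) (auto simp: proj_equal_def)

context elliptic
begin

abbreviation represents :: "('k point \<Rightarrow> 'k point) \<Rightarrow> ('k point \<Rightarrow> 'k) \<Rightarrow> ('k point \<Rightarrow> 'k) \<Rightarrow>
    ('k point \<Rightarrow> 'k) \<Rightarrow> 'k point \<Rightarrow> bool" where
  "represents f r0 r1 r2 Q \<equiv> proj_equal (r0 Q, r1 Q, r2 Q) (homog_coords (f Q))"

text \<open>In the chart \<open>u = x / y\<close>, \<open>v = 1 / y\<close> at infinity, where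
  \<open>u = v = 0\<close>, the coordinates of \<open>P + (t, s)\<close> are regular functions of
  \<open>u\<close> and \<open>v\<close>. The chord formula becomes \<open>0 / 0\<close> there; the relation
  \<open>u\<^sup>3 = v W\<close> with \<open>W = 1 - a u v - b v\<^sup>2\<close> allows one to cancel the common
  factor, leaving the denominators \<open>d\<close> and \<open>k\<close>, which equal 1 at infinity.\<close>

lemma shift_near_Infinity:
  assumes P: "P \<in> points E" "P = Affine x y" and T: "s ^ 2 = t ^ 3 + a * t + b"
    and ynz: "y \<noteq> 0" and u: "u = x / y" and v: "v = 1 / y"
    and W: "W = 1 - a * u * v - b * v ^ 2"
    and n: "n = t * W + (a + t ^ 2) * u ^ 2 - 2 * s * u + (a * t + 2 * b) * u * v"
    and d: "d = W - 2 * t * u ^ 2 + t ^ 2 * u * v" "d \<noteq> 0"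
    and k: "k = W - t * u ^ 2" "k \<noteq> 0"
    and g: "g = W * (1 - s * v) * (2 * s - (a + 3 * t ^ 2) * u + (t ^ 3 - a * t - 2 * b) * v)"
  shows "P \<boxplus> Affine t s = Affine (n / d) (g / (k * d) - s)"
proof -
  have c: "y ^ 2 = x ^ 3 + a * x + b" using P by simp
  have uY: "u * y = x" and vY: "v * y = 1" using u v ynz by auto
  have WY: "W * y ^ 2 = x ^ 3" unfolding W using c uY vY by Groebner_Basis.algebra
  have dY: "d * y ^ 2 = x * (x - t) ^ 2" unfolding d using WY uY vY by Groebner_Basis.algebra
  have kY: "k * y ^ 2 = x ^ 2 * (x - t)" unfolding k using WY uY vY by Groebner_Basis.algebra
  define n' where "n' = t * x ^ 2 + (a + t ^ 2) * x - 2 * s * y + (a * t + 2 * b)"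
  define g' where "g' = (y - s) * (2 * s * y - (a + 3 * t ^ 2) * x + (t ^ 3 - a * t - 2 * b))"
  have nY: "n * y ^ 2 = x * n'" unfolding n n'_def using WY uY vY by Groebner_Basis.algebra
  have gY: "g * y ^ 4 = x ^ 3 * g'" unfolding g g'_def using WY uY vY by Groebner_Basis.algebra
  have "d * y ^ 2 \<noteq> 0" using d ynz by simp
  then have "x \<noteq> 0" and Xt: "x - t \<noteq> 0" using dY by auto
  define l where "l = (y - s) / (x - t)"
  have l: "l * (x - t) = y - s" using Xt by (simp add: l_def)
  have x3: "(l ^ 2 - t - x) * (x - t) ^ 2 = n'"
    unfolding n'_def using l c T by Groebner_Basis.algebra
  have "(l ^ 2 - t - x) * d * y ^ 2 = n * y ^ 2" unfolding mult.assoc dY nY x3[symmetric] by (simp only: ac_simps)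
  then have "(l ^ 2 - t - x) * d = n" using ynz by (simp del: left_diff_distrib)
  then have 1: "n / d = l ^ 2 - t - x" using d(2) by (metis nonzero_mult_div_cancel_right)
  have y3: "l * (t - (l ^ 2 - t - x)) * (x - t) ^ 3 = g'"
    unfolding g'_def using l x3 n'_def c T by Groebner_Basis.algebra
  have "l * (t - (l ^ 2 - t - x)) * (k * y ^ 2 * (d * y ^ 2)) = g * y ^ 4"
    unfolding dY kY gY y3[symmetric] by Groebner_Basis.algebra
  then have "l * (t - (l ^ 2 - t - x)) * (k * d) * y ^ 4 = g * y ^ 4" by Groebner_Basis.algebra
  then have "l * (t - (l ^ 2 - t - x)) * (k * d) = g" using ynz by simp
  then have 2: "g / (k * d) = l * (t - (l ^ 2 - t - x))" using d k by (metis mult_eq_0_iff nonzero_mult_div_cancel_right)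
  have "P \<boxplus> Affine t s = Affine t s \<boxplus> P" using P T by (intro add_commute) auto
  also have "\<dots> = Affine (l ^ 2 - t - x) (l * (t - (l ^ 2 - t - x)) - s)"
    unfolding P(2) using add_distinct[of t x s y] Xt by (simp add: l_def Let_def)
  finally show ?thesis unfolding 1 2 .
qed

text \<open>If \<open>f Q0\<close> is affine, divide by the last coordinate. Otherwise divide by the middle one,
  and use that translation is regular at infinity.\<close>

lemma map_regular_if_represented:
  assumes Q0: "Q0 \<in> points E" and f: "f \<in> points E \<rightarrow> points E"
    and r: "regular_at Q0 r0" "regular_at Q0 r1" "regular_at Q0 r2"
    and rep: "\<forall>\<^sub>F Q in near Q0. represents f r0 r1 r2 Q"
  shows "map_regular_at Q0 f"
proof (cases "f Q0")
  case (Affine x y)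
  have 2: "r2 Q0 \<noteq> 0" using rep Affine by (simp add: eventually_near proj_equal_homog_coords)
  have "affine_near Q0 f"
  proof (rule affine_near_intro)
    show "regular_at Q0 (\<lambda>Q. r0 Q / r2 Q)" "regular_at Q0 (\<lambda>Q. r1 Q / r2 Q)"
      using Q0 r 2 by (auto intro!: regular_at_intros)
    show "\<forall>\<^sub>F Q in near Q0. f Q = Affine (r0 Q / r2 Q) (r1 Q / r2 Q)"
      using rep regular_at_nonzero[OF Q0 r(3) 2]
      by eventually_elim (auto simp: proj_equal_homog_coords split: point.splits)
  qed
  then show ?thesis by (rule aff_imp_map_regular[OF Q0])
next
  case Infinity
  have 1: "r1 Q0 \<noteq> 0" "r0 Q0 = 0" "r2 Q0 = 0"
    using rep Infinity by (simp_all add: eventually_near proj_equal_homog_coords)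
  define u where "u = (\<lambda>Q. r0 Q / r1 Q)"
  define v where "v = (\<lambda>Q. r2 Q / r1 Q)"
  have uv: "regular_at Q0 u" "regular_at Q0 v" unfolding u_def v_def using Q0 r 1 by (auto intro!: regular_at_intros)
  have uv0: "u Q0 = 0" "v Q0 = 0" using 1 by (auto simp: u_def v_def)
  define W where "W = (\<lambda>Q. 1 - a * u Q * v Q - b * v Q ^ 2)"
  have W: "regular_at Q0 W" unfolding W_def using uv by (auto intro!: regular_at_intros)
  have "affine_near Q0 (\<lambda>Q. f Q \<boxplus> T)" if T: "T \<in> points E" "T \<noteq> Infinity" for T
  proof -
    obtain t s where ts: "T = Affine t s" "s ^ 2 = t ^ 3 + a * t + b" using T by (cases T) auto
    define n where "n = (\<lambda>Q. t * W Q + (a + t ^ 2) * u Q ^ 2 - 2 * s * u Q + (a * t + 2 * b) * u Q * v Q)"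
    define d where "d = (\<lambda>Q. W Q - 2 * t * u Q ^ 2 + t ^ 2 * u Q * v Q)"
    define k where "k = (\<lambda>Q. W Q - t * u Q ^ 2)"
    define g where "g = (\<lambda>Q. W Q * (1 - s * v Q) * (2 * s - (a + 3 * t ^ 2) * u Q + (t ^ 3 - a * t - 2 * b) * v Q))"
    have "regular_at Q0 n" "regular_at Q0 d" "regular_at Q0 k" "regular_at Q0 g"
      unfolding n_def d_def k_def g_def using uv W by (auto intro!: regular_at_intros)
    moreover have nz: "d Q0 \<noteq> 0" "k Q0 \<noteq> 0" by (auto simp: d_def k_def W_def uv0)
    ultimately have "regular_at Q0 (\<lambda>Q. n Q / d Q)" "regular_at Q0 (\<lambda>Q. g Q / (k Q * d Q) - s)"
      using Q0 by (auto intro!: regular_at_intros)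
    moreover have "\<forall>\<^sub>F Q in near Q0. f Q \<boxplus> T = Affine (n Q / d Q) (g Q / (k Q * d Q) - s)"
      using rep regular_at_nonzero[OF Q0 r(2) 1(1)] regular_at_nonzero[OF Q0 \<open>regular_at Q0 d\<close> nz(1)]
        regular_at_nonzero[OF Q0 \<open>regular_at Q0 k\<close> nz(2)] near_points[OF Q0]
    proof eventually_elim
      case (elim Q)
      show ?case
      proof (cases "f Q")
        case Infinity
        then have "u Q = 0" "v Q = 0" using elim(1) unfolding proj_equal_homog_coords Infinity by (auto simp: u_def v_def)
        then show ?thesis using Infinity ts by (simp add: n_def d_def k_def g_def W_def)
      next
        case (Affine x y)
        then have "r2 Q \<noteq> 0" "r0 Q = r2 Q * x" "r1 Q = r2 Q * y"
          using elim(1)[unfolded proj_equal_homog_coords] by auto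
        moreover from this have "y \<noteq> 0" using elim(2) by auto
        moreover have "f Q \<in> points E" using f elim by auto
        ultimately show ?thesis
          unfolding ts(1) using elim
          by (intro shift_near_Infinity[OF _ Affine ts(2), where u = "u Q" and v = "v Q" and W = "W Q"])
            (auto simp: u_def v_def W_def n_def d_def k_def g_def)
      qed
    qed
    ultimately show ?thesis by (rule affine_near_intro)
  qed
  then show ?thesis unfolding map_regular_at_def
    using eventually_conj[OF cofin_points cofin_neq[of Infinity]] by (auto elim: eventually_mono)
qed

text \<open>The points with \<open>V = - V\<close> lie over the roots of the cubic.\<close>

lemma finite_two_torsion: "finite {V \<in> points E. V \<boxplus> V = Infinity}"
proof -
  have "cubic \<noteq> 0" using degree_cubic by fastforce
  then have "finite {x. poly cubic x = 0}" by (rule poly_roots_finite)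
  from finite_points_xc_set[OF this] show ?thesis
  proof (rule rev_finite_subset, intro subsetI)
    fix V assume V: "V \<in> {V \<in> points E. V \<boxplus> V = Infinity}"
    have "V = neg_point V" using V add_neg_cancel_left[of "neg_point V" V] by auto
    then have "V = Infinity \<or> yc V = 0" by (cases V) auto
    then show "V \<in> {P \<in> points E. P = Infinity \<or> xc P \<in> {x. poly cubic x = 0}}"
      using V by (cases V) auto
  qed
qed

text \<open>Two solutions of \<open>T + T = W\<close> differ by a point of order dividing 2.\<close>

lemma cofin_double:
  assumes "W \<in> points E"
  shows "\<forall>\<^sub>F T in cofin. T \<boxplus> T \<noteq> W"
proof (cases "\<exists>T1\<in>points E. T1 \<boxplus> T1 = W")
  case True
  then obtain T1 where T1: "T1 \<in> points E" "T1 \<boxplus> T1 = W" by blast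
  have "\<forall>\<^sub>F V in cofin. V \<boxplus> V \<noteq> Infinity"
    using finite_two_torsion by (simp add: eventually_cofin)
  from cofin_translate[OF neg_closed[OF T1(1)] this] cofin_points show ?thesis
  proof eventually_elim
    case (elim T)
    have "(neg_point T1 \<boxplus> T) \<boxplus> (neg_point T1 \<boxplus> T) = neg_point (T1 \<boxplus> T1) \<boxplus> (T \<boxplus> T)"
      unfolding neg_add[OF T1(1) T1(1)] using T1 elim by (simp add: add_interchange[of "neg_point T1" T])
    then show ?case using elim T1 by auto
  qed
next
  case False
  then show ?thesis by (auto intro: eventually_mono[OF cofin_points])
qed

text \<open>Recover \<open>f\<close> by subtracting \<open>T\<close> from its translate. If \<open>f Q0\<close>
  is affine, then for almost all \<open>T\<close> this is a chord. If \<open>f Q0\<close> is the point at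
  infinity, the chord degenerates at \<open>Q0\<close>, and clearing the denominator
  \<open>(x(f Q + T) - x(T))\<^sup>3\<close> gives homogeneous coordinates of \<open>f Q\<close> that stay valid
  there provided that \<open>T \<noteq> - T\<close>.\<close>

lemma represented_if_map_regular:
  assumes Q0: "Q0 \<in> points E" and f: "f \<in> points E \<rightarrow> points E" and s: "map_regular_at Q0 f"
  shows "\<exists>r0 r1 r2. regular_at Q0 r0 \<and> regular_at Q0 r1 \<and> regular_at Q0 r2 \<and> (\<forall>\<^sub>F Q in near Q0. represents f r0 r1 r2 Q)"
proof -
  have fQ0: "f Q0 \<in> points E" using f Q0 by auto
  have cancel: "f Q \<boxplus> T \<boxplus> neg_point T = f Q" if "Q \<in> points E" "T \<in> points E" for Q T
    using that f by (intro add_neg_cancel) auto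
  show ?thesis
  proof (cases "f Q0 = Infinity")
    case False
    have "\<forall>\<^sub>F T in cofin. affine_near Q0 (\<lambda>Q. f Q \<boxplus> T) \<and> T \<noteq> Infinity \<and> xc (f Q0 \<boxplus> T) \<noteq> xc T"
      using s[unfolded map_regular_at_def] cofin_neq[of Infinity] cofin_neq[of "neg_point (f Q0)"]
        cofin_double[OF neg_closed[OF fQ0]] cofin_points
    proof eventually_elim
      case (elim T)
      have 1: "f Q0 \<boxplus> T \<noteq> T" using False add_right_cancel[of "f Q0" Infinity T] fQ0 elim by simp
      have 2: "f Q0 \<boxplus> T \<noteq> neg_point T"
      proof
        assume "f Q0 \<boxplus> T = neg_point T"
        then have "neg_point (f Q0) = neg_point (f Q0) \<boxplus> (f Q0 \<boxplus> T \<boxplus> T)" using elim by simp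
        also have "\<dots> = T \<boxplus> T" using fQ0 elim by (simp add: add_assoc[symmetric])
        finally show False using elim by simp
      qed
      have 3: "f Q0 \<boxplus> T \<noteq> Infinity"
      proof
        assume "f Q0 \<boxplus> T = Infinity"
        then have "T = neg_point (f Q0)" using add_neg_cancel_left[of "neg_point (f Q0)" T] fQ0 elim by auto
        then show False using elim by simp
      qed
      show ?case using 1 2 3 elim fQ0 same_x_iff[of "f Q0 \<boxplus> T" T] by auto
    qed
    from cofin_ex[OF this] obtain T where T: "T \<in> points E" "affine_near Q0 (\<lambda>Q. f Q \<boxplus> T)" "T \<noteq> Infinity"
      "xc (f Q0 \<boxplus> T) \<noteq> xc T" by blast
    have "affine_near Q0 (\<lambda>Q. (f Q \<boxplus> T) \<boxplus> neg_point T)"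
      by (rule affine_near_add[OF Q0 T(2) affine_near_const]) (use T in \<open>cases T; auto\<close>)+
    then have "affine_near Q0 f" by (rule affine_near_cong[OF Q0]) (use cancel T in auto)
    then have "regular_at Q0 (\<lambda>Q. xc (f Q))" "regular_at Q0 (\<lambda>Q. yc (f Q))" "\<forall>\<^sub>F Q in near Q0. f Q \<noteq> Infinity"
      by (auto simp: affine_near_def)
    moreover from this(3) have "\<forall>\<^sub>F Q in near Q0. represents f (\<lambda>Q. xc (f Q)) (\<lambda>Q. yc (f Q)) (\<lambda>Q. 1) Q"
      by eventually_elim (auto simp: proj_equal_homog_coords split: point.splits)
    ultimately show ?thesis using regular_at_const[of Q0 1] by blast
  next
    case True
    have "\<forall>\<^sub>F V in cofin. V \<boxplus> V \<noteq> Infinity"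
      using finite_two_torsion by (simp add: eventually_cofin)
    from cofin_ex[OF eventually_conj[OF s[unfolded map_regular_at_def] this]] obtain T where
      T: "T \<in> points E" "affine_near Q0 (\<lambda>Q. f Q \<boxplus> T)" "T \<boxplus> T \<noteq> Infinity" by blast
    have "T \<noteq> Infinity" using T by auto
    moreover have "T \<noteq> neg_point T" using T(3) by (metis add_neg(1))
    ultimately
    obtain t s where ts: "T = Affine t s" "s \<noteq> 0" by (cases T) auto
    define u where "u = (\<lambda>Q. xc (f Q \<boxplus> T))"
    define v where "v = (\<lambda>Q. yc (f Q \<boxplus> T))"
    have uv: "regular_at Q0 u" "regular_at Q0 v" using T(2) by (auto simp: affine_near_def u_def v_def)
    have uv0: "u Q0 = t" "v Q0 = s" using True ts by (auto simp: u_def v_def)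
    (* With the slope l = (v + s) / (u - t) of the chord through f Q + T and -T, these are the
       coordinates of their sum multiplied by (u - t)^3. *)
    define r0 where "r0 = (\<lambda>Q. (u Q - t) * ((v Q + s) ^ 2 - (u Q + t) * (u Q - t) ^ 2))"
    define r1 where "r1 = (\<lambda>Q. (v Q + s) * (u Q * (u Q - t) ^ 2 - ((v Q + s) ^ 2 - (u Q + t) * (u Q - t) ^ 2))
       - v Q * (u Q - t) ^ 3)"
    define r2 where "r2 = (\<lambda>Q. (u Q - t) ^ 3)"
    have r: "regular_at Q0 r0" "regular_at Q0 r1" "regular_at Q0 r2"
      unfolding r0_def r1_def r2_def using uv by (auto intro!: regular_at_intros)
    have "\<forall>\<^sub>F Q in near Q0. v Q + s \<noteq> 0"
      by (rule regular_at_nonzero[OF Q0]) (use uv uv0 ts in \<open>auto intro!: regular_at_intros\<close>)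
    moreover have "\<forall>\<^sub>F Q in near Q0. f Q \<boxplus> T \<noteq> Infinity" using T(2) by (simp add: affine_near_def)
    ultimately have "\<forall>\<^sub>F Q in near Q0. represents f r0 r1 r2 Q"
      using near_points[OF Q0]
    proof eventually_elim
      case (elim Q)
      have fT: "f Q \<boxplus> T = Affine (u Q) (v Q)" using elim(2) unfolding u_def v_def by (cases "f Q \<boxplus> T") auto
      have fQ: "f Q = Affine (u Q) (v Q) \<boxplus> Affine t (- s)" using cancel[OF elim(3) T(1)] fT ts by simp
      show ?case
      proof (cases "u Q = t")
        case True
        have "Affine (u Q) (v Q) \<in> points E" using fT elim T f by (metis add_closed funcset_mem)
        then have "Affine (u Q) (v Q) = T \<or> Affine (u Q) (v Q) = neg_point T"
          using same_x_iff[of "Affine (u Q) (v Q)" T] T ts True by simp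
        then have "v Q = s" using elim(1) ts by auto
        moreover from this have "f Q = Infinity" using fQ True by (simp add: add_points.simps(3))
        ultimately show ?thesis unfolding proj_equal_homog_coords
          using True ts by (simp add: r0_def r1_def r2_def)
      next
        case False
        define l where "l = (v Q + s) / (u Q - t)"
        have l: "l * (u Q - t) = v Q + s" using False by (simp add: l_def)
        have l': "(- s - v Q) / (t - u Q) = l" using False by (simp add: l_def field_simps)
        have "f Q = Affine (l ^ 2 - u Q - t) (l * (u Q - (l ^ 2 - u Q - t)) - v Q)"
          unfolding fQ using add_distinct[OF False, of "v Q" "- s"] l' by (simp add: Let_def)
        moreover have "r0 Q = r2 Q * (l ^ 2 - u Q - t)"
          unfolding r0_def r2_def using l by Groebner_Basis.algebra
        moreover have "r1 Q = r2 Q * (l * (u Q - (l ^ 2 - u Q - t)) - v Q)"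
          unfolding r1_def r2_def using l by Groebner_Basis.algebra
        ultimately show ?thesis unfolding proj_equal_homog_coords using False by (simp add: r2_def)
      qed
    qed
    then show ?thesis using r by blast
  qed
qed

end

section \<open>The endomorphism ring\<close>

lemma proj_equal_scale:
  "r \<noteq> 0 \<Longrightarrow> proj_equal (r * r0, r * r1, r * r2) v \<longleftrightarrow> proj_equal (r0, r1, r2) v"
proof
  assume r: "r \<noteq> 0"
  assume "proj_equal (r * r0, r * r1, r * r2) v"
  then obtain t where "t \<noteq> 0" "r * r0 = t * fst v" "r * r1 = t * fst (snd v)" "r * r2 = t * snd (snd v)"
    by (auto simp: proj_equal_def)
  then show "proj_equal (r0, r1, r2) v" unfolding proj_equal_def using r
    by (intro exI[of _ "t / r"]) (auto simp: field_simps)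
next
  assume r: "r \<noteq> 0"
  assume "proj_equal (r0, r1, r2) v"
  then obtain t where "t \<noteq> 0" "r0 = t * fst v" "r1 = t * fst (snd v)" "r2 = t * snd (snd v)"
    by (auto simp: proj_equal_def)
  then show "proj_equal (r * r0, r * r1, r * r2) v" unfolding proj_equal_def using r
    by (intro exI[of _ "r * t"]) auto
qed

lemma ternary_form_scale: "ternary_form d c (t * x, t * y, t * z) = t ^ d * ternary_form d c (x, y, z)"
proof -
  have e: "t ^ d = t ^ i * (t ^ j * t ^ (d - i - j))" if "i \<le> d" "j \<le> d - i" for i j
    using that by (simp flip: power_add)
  then have "c i j * (t * x) ^ i * (t * y) ^ j * (t * z) ^ (d - i - j) =
     t ^ d * (c i j * x ^ i * y ^ j * z ^ (d - i - j))" if "i \<le> d" "j \<le> d - i" for i j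
    unfolding power_mult_distrib e[OF that] by (simp only: mult_ac)
  then show ?thesis unfolding ternary_form_def prod.case sum_distrib_left
    by (intro sum.cong refl) auto
qed

lemma form_compose:
  assumes "form e G0" "form e G1" "form e G2"
  shows "form (d * e) (\<lambda>Q. ternary_form d c (G0 Q, G1 Q, G2 Q))"
  unfolding ternary_form_def prod.case
proof (intro form_sum)
  fix i j assume "i \<in> {..d}" "j \<in> {..d - i}"
  then have d: "d * e = 0 + i * e + j * e + (d - i - j) * e"
    by (simp add: add_mult_distrib[symmetric])
  show "form (d * e) (\<lambda>Q. c i j * G0 Q ^ i * G1 Q ^ j * G2 Q ^ (d - i - j))"
    unfolding d using assms by (intro form_mult form_const form_power)
qed

context elliptic
begin

lemma regular_at_quotient:
  assumes "Q0 \<in> points E" "form d N" "form d D" "D Q0 \<noteq> 0"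
  shows "regular_at Q0 (\<lambda>Q. N Q / D Q)"
proof -
  have "\<forall>\<^sub>F Q in near Q0. N Q / D Q * D Q = N Q"
    using form_nonzero_near[OF assms(1,3,4)] by eventually_elim simp
  then show ?thesis unfolding regular_at_def using assms by blast
qed

text \<open>To pass from forms to regular functions divide by a power of a linear form \<open>L\<close> with
  \<open>L Q0 \<noteq> 0\<close>.\<close>

lemma map_regular_if_forms:
  assumes Q0: "Q0 \<in> points E" and f: "f \<in> points E \<rightarrow> points E"
    and r: "form d r0" "form d r1" "form d r2"
    and rep: "\<forall>\<^sub>F Q in near Q0. represents f r0 r1 r2 Q"
  shows "map_regular_at Q0 f"
proof -
  have "\<exists>L. form 1 L \<and> L Q0 \<noteq> 0"
    using form_hy form_hz by (cases Q0) (force intro: exI[of _ hy], force intro: exI[of _ hz])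
  then obtain L where L: "form 1 L" "L Q0 \<noteq> 0" by blast
  have Ld: "form d (\<lambda>Q. L Q ^ d)" using form_power[OF L(1), of d] by simp
  have "\<forall>\<^sub>F Q in near Q0. represents f (\<lambda>Q. r0 Q / L Q ^ d) (\<lambda>Q. r1 Q / L Q ^ d) (\<lambda>Q. r2 Q / L Q ^ d) Q"
    using rep form_nonzero_near[OF Q0 L]
  proof eventually_elim
    case (elim Q)
    then show ?case using proj_equal_scale[of "inverse (L Q ^ d)" "r0 Q" "r1 Q" "r2 Q"]
      by (simp add: divide_inverse mult.commute)
  qed
  then show ?thesis
    by (rule map_regular_if_represented[OF Q0 f, rotated -1]) (use Ld L r Q0 in \<open>auto intro!: regular_at_quotient\<close>)
qed

lemma near_nonzero_forms:
  assumes "Q0 \<in> points E" "form d r0" "form d r1" "form d r2" "(r0 Q0, r1 Q0, r2 Q0) \<noteq> (0, 0, 0)"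
  shows "\<forall>\<^sub>F Q in near Q0. (r0 Q, r1 Q, r2 Q) \<noteq> (0, 0, 0)"
proof -
  consider "r0 Q0 \<noteq> 0" | "r1 Q0 \<noteq> 0" | "r2 Q0 \<noteq> 0" using assms(5) by auto
  then show ?thesis
  proof cases
    case 1 show ?thesis using form_nonzero_near[OF assms(1,2) 1] by eventually_elim auto
  next
    case 2 show ?thesis using form_nonzero_near[OF assms(1,3) 2] by eventually_elim auto
  next
    case 3 show ?thesis using form_nonzero_near[OF assms(1,4) 3] by eventually_elim auto
  qed
qed

abbreviation tform :: "nat \<Rightarrow> (nat \<Rightarrow> nat \<Rightarrow> 'k) \<Rightarrow> 'k point \<Rightarrow> 'k" where
  "tform d c Q \<equiv> ternary_form d c (homog_coords Q)"

lemma curve_morphism_forms: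
  assumes "curve_morphism E f" "P \<in> points E"
  shows "\<exists>d c0 c1 c2. (tform d c0 P, tform d c1 P, tform d c2 P) \<noteq> (0, 0, 0) \<and>
    (\<forall>Q\<in>points E. (tform d c0 Q, tform d c1 Q, tform d c2 Q) \<noteq> (0, 0, 0) \<longrightarrow>
       represents f (tform d c0) (tform d c1) (tform d c2) Q)"
  using assms unfolding curve_morphism_def Let_def by blast

lemma map_regular_if_morphism:
  assumes f: "curve_morphism E f" and Q0: "Q0 \<in> points E"
  shows "map_regular_at Q0 f"
proof -
  obtain d c0 c1 c2 where 1: "(tform d c0 Q0, tform d c1 Q0, tform d c2 Q0) \<noteq> (0, 0, 0)"
    and 2: "\<And>Q. Q \<in> points E \<Longrightarrow> (tform d c0 Q, tform d c1 Q, tform d c2 Q) \<noteq> (0, 0, 0) \<Longrightarrow>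
       represents f (tform d c0) (tform d c1) (tform d c2) Q"
    using curve_morphism_forms[OF f Q0] by blast
  have "\<forall>\<^sub>F Q in near Q0. represents f (tform d c0) (tform d c1) (tform d c2) Q"
    using near_nonzero_forms[OF Q0 form_ternary_form form_ternary_form form_ternary_form 1] near_points[OF Q0]
    by eventually_elim (use 2 in blast)
  then show ?thesis
    using f by (intro map_regular_if_forms[OF Q0 _ form_ternary_form form_ternary_form form_ternary_form])
      (auto simp: curve_morphism_def)
qed

text \<open>Clearing denominators: the common factor is a form that does not vanish near \<open>Q0\<close>.\<close>

lemma forms_if_map_regular:
  assumes Q0: "Q0 \<in> points E" and f: "f \<in> points E \<rightarrow> points E" and s: "map_regular_at Q0 f"
  obtains d r0 r1 r2 where "form d r0" "form d r1" "form d r2"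
    "\<forall>\<^sub>F Q in near Q0. represents f r0 r1 r2 Q"
proof -
  obtain s0 s1 s2 where s: "regular_at Q0 s0" "regular_at Q0 s1" "regular_at Q0 s2" "\<forall>\<^sub>F Q in near Q0. represents f s0 s1 s2 Q"
    using represented_if_map_regular[OF Q0 f s] by blast
  obtain d0 n0 m0 where 0: "form d0 n0" "form d0 m0" "m0 Q0 \<noteq> 0" "\<forall>\<^sub>F Q in near Q0. s0 Q * m0 Q = n0 Q"
    using s(1) unfolding regular_at_def by blast
  obtain d1 n1 m1 where 1: "form d1 n1" "form d1 m1" "m1 Q0 \<noteq> 0" "\<forall>\<^sub>F Q in near Q0. s1 Q * m1 Q = n1 Q"
    using s(2) unfolding regular_at_def by blast
  obtain d2 n2 m2 where 2: "form d2 n2" "form d2 m2" "m2 Q0 \<noteq> 0" "\<forall>\<^sub>F Q in near Q0. s2 Q * m2 Q = n2 Q"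
    using s(3) unfolding regular_at_def by blast
  show ?thesis
  proof
    show "form (d0 + d1 + d2) (\<lambda>Q. n0 Q * m1 Q * m2 Q)" "form (d0 + d1 + d2) (\<lambda>Q. m0 Q * n1 Q * m2 Q)"
      "form (d0 + d1 + d2) (\<lambda>Q. m0 Q * m1 Q * n2 Q)"
      using 0 1 2 by (auto intro!: form_mult)
    show "\<forall>\<^sub>F Q in near Q0. represents f (\<lambda>Q. n0 Q * m1 Q * m2 Q) (\<lambda>Q. m0 Q * n1 Q * m2 Q) (\<lambda>Q. m0 Q * m1 Q * n2 Q) Q"
      using s(4) 0(4) 1(4) 2(4) form_nonzero_near[OF Q0 0(2,3)] form_nonzero_near[OF Q0 1(2,3)]
        form_nonzero_near[OF Q0 2(2,3)]
    proof eventually_elim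
      case (elim Q)
      have "m0 Q * m1 Q * m2 Q \<noteq> 0" using elim by simp
      from proj_equal_scale[OF this, of "s0 Q" "s1 Q" "s2 Q"] elim(1)
      show ?case unfolding elim(2-4)[symmetric] by (simp only: mult_ac)
    qed
  qed
qed

lemma proj_equal_cross:
  assumes "proj_equal (r0, r1, r2) v" "proj_equal (s0, s1, s2) v"
  shows "r0 * s1 = r1 * s0" "r0 * s2 = r2 * s0" "r1 * s2 = r2 * s1"
  using assms by (auto simp: proj_equal_def)

lemma proj_equal_if_cross:
  assumes "r0 * s1 = r1 * s0" "r0 * s2 = r2 * s0" "r1 * s2 = r2 * s1" "(r0, r1, r2) \<noteq> (0, 0, 0)"
    "proj_equal (s0, s1, s2) (homog_coords P)"
  shows "proj_equal (r0, r1, r2) (homog_coords P)"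
  using assms unfolding proj_equal_homog_coords
  by (cases P) auto

lemma form_zero_cofin:
  assumes "form d h" "\<forall>\<^sub>F Q in cofin. h Q = 0" "Q \<in> points E"
  shows "h Q = 0"
proof (rule ccontr)
  assume "h Q \<noteq> 0"
  then have "\<forall>\<^sub>F Q in cofin. h Q \<noteq> 0"
    using form_nonzero_near[OF assms(3,1)] by (simp add: eventually_near)
  then have "\<forall>\<^sub>F Q in cofin. False" using assms(2) by eventually_elim simp
  then show False using cofin_nontrivial by (simp add: trivial_limit_def)
qed

text \<open>A triple of forms that represents \<open>f\<close> near \<open>P\<close> represents it wherever it
  does not vanish. To see this at \<open>Q\<close>, compare it with a triple for \<open>Q\<close>: the cross
  products of the two triples are forms that vanish almost everywhere, hence everywhere.\<close>

lemma morphism_if_map_regular: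
  assumes f: "f \<in> points E \<rightarrow> points E" and s: "\<And>Q. Q \<in> points E \<Longrightarrow> map_regular_at Q f"
  shows "curve_morphism E f"
  unfolding curve_morphism_def
proof (intro conjI f ballI)
  fix P assume P: "P \<in> points E"
  obtain d r0 r1 r2 where r: "form d r0" "form d r1" "form d r2"
    and rep: "\<forall>\<^sub>F Q in near P. represents f r0 r1 r2 Q"
    by (rule forms_if_map_regular[OF P f s[OF P]])
  have nz: "(r0 P, r1 P, r2 P) \<noteq> (0, 0, 0)"
    using rep unfolding eventually_near proj_equal_homog_coords by (auto split: point.splits)
  have all: "represents f r0 r1 r2 Q" if Q: "Q \<in> points E" "(r0 Q, r1 Q, r2 Q) \<noteq> (0, 0, 0)" for Q
  proof -
    obtain e s0 s1 s2 where s: "form e s0" "form e s1" "form e s2"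
      and reps: "\<forall>\<^sub>F Q in near Q. represents f s0 s1 s2 Q"
      by (rule forms_if_map_regular[OF Q(1) f s[OF Q(1)]])
    have rep': "\<forall>\<^sub>F Q in cofin. represents f r0 r1 r2 Q" and reps': "\<forall>\<^sub>F Q in cofin. represents f s0 s1 s2 Q"
      using rep reps by (auto simp: eventually_near)
    have cross: "\<forall>\<^sub>F Q in cofin. r0 Q * s1 Q = r1 Q * s0 Q \<and> r0 Q * s2 Q = r2 Q * s0 Q \<and> r1 Q * s2 Q = r2 Q * s1 Q"
      using rep' reps' by eventually_elim (intro conjI; rule proj_equal_cross)
    have "r0 Q * s1 Q - r1 Q * s0 Q = 0"
      by (rule form_zero_cofin[where h = "\<lambda>Q. r0 Q * s1 Q - r1 Q * s0 Q" and d = "d + e"])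
        (use r s Q(1) cross in \<open>auto intro!: form_diff form_mult elim!: eventually_mono\<close>)
    moreover have "r0 Q * s2 Q - r2 Q * s0 Q = 0"
      by (rule form_zero_cofin[where h = "\<lambda>Q. r0 Q * s2 Q - r2 Q * s0 Q" and d = "d + e"])
        (use r s Q(1) cross in \<open>auto intro!: form_diff form_mult elim!: eventually_mono\<close>)
    moreover have "r1 Q * s2 Q - r2 Q * s1 Q = 0"
      by (rule form_zero_cofin[where h = "\<lambda>Q. r1 Q * s2 Q - r2 Q * s1 Q" and d = "d + e"])
        (use r s Q(1) cross in \<open>auto intro!: form_diff form_mult elim!: eventually_mono\<close>)
    moreover have "represents f s0 s1 s2 Q" using reps by (simp only: eventually_near)
    ultimately show ?thesis unfolding right_minus_eq using Q(2)
      by (intro proj_equal_if_cross[of "r0 Q" "s1 Q" "r1 Q" "s0 Q" "s2 Q" "r2 Q" "f Q"])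
  qed
  obtain c0 c1 c2 where c: "\<And>Q. ternary_form d c0 (homog_coords Q) = r0 Q"
    "\<And>Q. ternary_form d c1 (homog_coords Q) = r1 Q" "\<And>Q. ternary_form d c2 (homog_coords Q) = r2 Q"
    using r unfolding form_def by metis
  show "\<exists>d c0 c1 c2. let F = (\<lambda>Q. (ternary_form d c0 (homog_coords Q), ternary_form d c1 (homog_coords Q),
                      ternary_form d c2 (homog_coords Q)))
        in F P \<noteq> (0, 0, 0) \<and> (\<forall>Q\<in>points E. F Q \<noteq> (0, 0, 0) \<longrightarrow> proj_equal (F Q) (homog_coords (f Q)))"
    unfolding Let_def
    by (rule exI[of _ d], rule exI[of _ c0], rule exI[of _ c1], rule exI[of _ c2])
       (unfold c, use nz all in blast)
qed

abbreviation "Endo \<equiv> endomorphisms E"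

lemma endomorphismsI:
  assumes "f \<in> extensional (points E)" "f \<in> points E \<rightarrow> points E" "\<And>Q. Q \<in> points E \<Longrightarrow> map_regular_at Q f"
    "\<And>P Q. P \<in> points E \<Longrightarrow> Q \<in> points E \<Longrightarrow> f (P \<boxplus> Q) = f P \<boxplus> f Q"
  shows "f \<in> Endo"
  using assms morphism_if_map_regular by (auto simp: endomorphisms_def)

lemma endomorphismsD:
  assumes "f \<in> Endo"
  shows "f \<in> extensional (points E)" "f \<in> points E \<rightarrow> points E" "\<And>Q. Q \<in> points E \<Longrightarrow> map_regular_at Q f"
    "\<And>P Q. P \<in> points E \<Longrightarrow> Q \<in> points E \<Longrightarrow> f (P \<boxplus> Q) = f P \<boxplus> f Q"
    "\<And>P. P \<in> points E \<Longrightarrow> f P \<in> points E" "curve_morphism E f"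
  using assms map_regular_if_morphism by (auto simp: endomorphisms_def curve_morphism_def)

lemma hom_Infinity:
  assumes "f \<in> Endo" shows "f Infinity = Infinity"
proof -
  have "f Infinity \<boxplus> f Infinity = Infinity \<boxplus> f Infinity"
    using endomorphismsD(4)[OF assms, of Infinity Infinity] by simp
  then show ?thesis using add_right_cancel endomorphismsD(5)[OF assms] points_Infinity by blast
qed

lemma hom_neg:
  assumes "f \<in> Endo" "P \<in> points E" shows "f (neg_point P) = neg_point (f P)"
proof -
  have "f (neg_point P) \<boxplus> f P = Infinity"
    using endomorphismsD(4)[OF assms(1), of "neg_point P" P] assms hom_Infinity[OF assms(1)] by simp
  also have "\<dots> = neg_point (f P) \<boxplus> f P" by simp
  finally show ?thesis
    using add_right_cancel endomorphismsD(5)[OF assms(1)] assms(2) neg_closed by blast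
qed

abbreviation endo_zero where "endo_zero \<equiv> \<lambda>P\<in>points E. Infinity"
abbreviation endo_one where "endo_one \<equiv> \<lambda>P\<in>points E. P"
abbreviation endo_add where "endo_add f g \<equiv> \<lambda>P\<in>points E. f P \<boxplus> g P"
abbreviation endo_neg where "endo_neg f \<equiv> \<lambda>P\<in>points E. neg_point (f P)"

lemma restrict_endo:
  assumes f: "f \<in> points E \<rightarrow> points E" and s: "\<And>Q. Q \<in> points E \<Longrightarrow> map_regular_at Q f"
    and h: "\<And>P Q. P \<in> points E \<Longrightarrow> Q \<in> points E \<Longrightarrow> f (P \<boxplus> Q) = f P \<boxplus> f Q"
  shows "(\<lambda>P\<in>points E. f P) \<in> Endo"
proof (rule endomorphismsI)
  show "map_regular_at Q (\<lambda>P\<in>points E. f P)" if "Q \<in> points E" for Q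
    by (rule map_regular_at_cong[OF that s[OF that]]) simp
qed (use f h in auto)

lemma endo_zero: "endo_zero \<in> Endo"
  by (rule restrict_endo) (auto intro: map_regular_at_const)

lemma endo_one: "endo_one \<in> Endo"
proof (rule restrict_endo)
  fix Q0 assume Q0: "Q0 \<in> points E"
  have "represents (\<lambda>P. P) hx hy hz Q" for Q
    using proj_equal_homog_coords[of "hx Q" "hy Q" "hz Q" Q] by (cases Q) auto
  then show "map_regular_at Q0 (\<lambda>P. P)" by (intro map_regular_if_forms[OF Q0 _ form_hx form_hy form_hz]) auto
qed auto

lemma endo_add: "f \<in> Endo \<Longrightarrow> g \<in> Endo \<Longrightarrow> endo_add f g \<in> Endo"
  by (rule restrict_endo)
    (auto intro!: map_regular_at_add simp: endomorphismsD(2-5) add_interchange)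

lemma endo_neg: "f \<in> Endo \<Longrightarrow> endo_neg f \<in> Endo"
  by (rule restrict_endo)
    (auto intro!: map_regular_at_neg simp: endomorphismsD(2-5) neg_add)

text \<open>Forms substituted into forms are forms; homogeneity makes the choice of representatives irrelevant.\<close>

lemma endo_compose:
  assumes f: "f \<in> Endo" and g: "g \<in> Endo"
  shows "compose (points E) f g \<in> Endo"
  unfolding compose_def
proof (rule restrict_endo)
  fix Q0 assume Q0: "Q0 \<in> points E"
  have gQ0: "g Q0 \<in> points E" using g Q0 endomorphismsD by auto
  obtain e s0 s1 s2 where s: "form e s0" "form e s1" "form e s2"
    and reps: "\<forall>\<^sub>F Q in near Q0. represents g s0 s1 s2 Q"
    by (rule forms_if_map_regular[OF Q0 endomorphismsD(2)[OF g] endomorphismsD(3)[OF g Q0]])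
  obtain d c0 c1 c2 where 1: "(tform d c0 (g Q0), tform d c1 (g Q0), tform d c2 (g Q0)) \<noteq> (0, 0, 0)"
    and 2: "\<And>Q. Q \<in> points E \<Longrightarrow> (tform d c0 Q, tform d c1 Q, tform d c2 Q) \<noteq> (0, 0, 0) \<Longrightarrow>
       represents f (tform d c0) (tform d c1) (tform d c2) Q"
    using curve_morphism_forms[OF endomorphismsD(6)[OF f] gQ0] by blast
  let ?h = "\<lambda>c Q. ternary_form d c (s0 Q, s1 Q, s2 Q)"
  have fh: "form (d * e) (?h c)" for c using s by (rule form_compose)
  have sc: "\<exists>t. t \<noteq> 0 \<and> (\<forall>c. ?h c Q = t ^ d * ternary_form d c (homog_coords (g Q)))"
    if "represents g s0 s1 s2 Q" for Q
  proof -
    have "\<exists>t. t \<noteq> 0 \<and> s0 Q = t * hx (g Q) \<and> s1 Q = t * hy (g Q) \<and> s2 Q = t * hz (g Q)"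
      using that unfolding proj_equal_def homog_coords_eq fst_conv snd_conv .
    then obtain t where "t \<noteq> 0" and t: "s0 Q = t * hx (g Q)" "s1 Q = t * hy (g Q)" "s2 Q = t * hz (g Q)"
      by (elim exE conjE)
    have "?h c Q = t ^ d * tform d c (g Q)" for c
      unfolding t by (simp only: ternary_form_scale homog_coords_eq)
    then show ?thesis using \<open>t \<noteq> 0\<close> by blast
  qed
  have "(?h c0 Q0, ?h c1 Q0, ?h c2 Q0) \<noteq> (0, 0, 0)"
  proof -
    have "represents g s0 s1 s2 Q0" using reps by (simp only: eventually_near)
    then obtain t where t: "t \<noteq> 0" "\<And>c. ?h c Q0 = t ^ d * tform d c (g Q0)" using sc by blast
    show ?thesis using 1 t(1) unfolding t(2) by auto
  qed
  from near_nonzero_forms[OF Q0 fh fh fh this] reps near_points[OF Q0]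
  have "\<forall>\<^sub>F Q in near Q0. represents (\<lambda>Q. f (g Q)) (?h c0) (?h c1) (?h c2) Q"
  proof eventually_elim
    case (elim Q)
    obtain t where t: "t \<noteq> 0" "\<And>c. ?h c Q = t ^ d * ternary_form d c (homog_coords (g Q))"
      using sc[OF elim(2)] by blast
    have "g Q \<in> points E" using g elim endomorphismsD by auto
    moreover have "(tform d c0 (g Q), tform d c1 (g Q), tform d c2 (g Q)) \<noteq> (0, 0, 0)"
      using elim(1) unfolding t(2) by auto
    ultimately have "represents f (tform d c0) (tform d c1) (tform d c2) (g Q)" by (rule 2)
    then show ?case unfolding t(2) using t(1) by (subst proj_equal_scale) (simp_all only: power_not_zero not_False_eq_True)
  qed
  then show "map_regular_at Q0 (\<lambda>x. f (g x))"
    by (intro map_regular_if_forms[OF Q0 _ fh fh fh]) (use f g endomorphismsD in auto)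
qed (use f g endomorphismsD in auto)

lemma ring_endomorphism_ring: "ring (endomorphism_ring E)"
proof -
  have eq: "f = g" if "f \<in> Endo" "g \<in> Endo" "\<And>P. P \<in> points E \<Longrightarrow> f P = g P" for f g
    using that endomorphismsD(1) by (metis extensionalityI)
  note D = endomorphismsD(4,5)
  show ?thesis
  proof (rule ringI)
    show "abelian_group (endomorphism_ring E)"
    proof (rule abelian_groupI, unfold endomorphism_ring_def ring_record_simps)
      fix f g h assume f: "f \<in> Endo" and g: "g \<in> Endo" and h: "h \<in> Endo"
      show "endo_add f g \<in> Endo" using f g by (rule endo_add)
      show "endo_add (endo_add f g) h = endo_add f (endo_add g h)"
        by (rule restrict_ext) (use D f g h in \<open>simp add: add_assoc\<close>)
      show "endo_add f g = endo_add g f"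
        by (rule restrict_ext) (use D f g add_commute in simp)
      show "endo_add endo_zero f = f"
        by (rule eq[OF endo_add]) (auto intro: endo_zero[unfolded restrict_def] f simp: restrict_def)
      show "\<exists>k\<in>Endo. endo_add k f = endo_zero"
        by (rule bexI[OF _ endo_neg[OF f]]) (auto intro: restrict_ext)
    qed (rule endo_zero)
    show "Group.monoid (endomorphism_ring E)"
    proof (rule monoidI, unfold endomorphism_ring_def ring_record_simps monoid.simps)
      fix f g h assume f: "f \<in> Endo" and g: "g \<in> Endo" and h: "h \<in> Endo"
      show "compose (points E) f g \<in> Endo" using f g by (rule endo_compose)
      show "compose (points E) (compose (points E) f g) h = compose (points E) f (compose (points E) g h)"
        using h endomorphismsD(5) by (auto simp: compose_def restrict_def)
      show "compose (points E) endo_one f = f"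
        by (rule eq[OF endo_compose]) (use endo_one f D in \<open>auto simp: compose_def\<close>)
      show "compose (points E) f endo_one = f"
        by (rule eq[OF endo_compose]) (use endo_one f D in \<open>auto simp: compose_def\<close>)
    qed (rule endo_one)
  next
    fix f g h
    assume "f \<in> carrier (endomorphism_ring E)" "g \<in> carrier (endomorphism_ring E)" "h \<in> carrier (endomorphism_ring E)"
    then have f: "f \<in> Endo" and g: "g \<in> Endo" and h: "h \<in> Endo" by (auto simp: endomorphism_ring_def)
    show "(f \<oplus>\<^bsub>endomorphism_ring E\<^esub> g) \<otimes>\<^bsub>endomorphism_ring E\<^esub> h =
          f \<otimes>\<^bsub>endomorphism_ring E\<^esub> h \<oplus>\<^bsub>endomorphism_ring E\<^esub> g \<otimes>\<^bsub>endomorphism_ring E\<^esub> h"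
      using h D by (auto simp: endomorphism_ring_def compose_def restrict_def)
    show "h \<otimes>\<^bsub>endomorphism_ring E\<^esub> (f \<oplus>\<^bsub>endomorphism_ring E\<^esub> g) =
          h \<otimes>\<^bsub>endomorphism_ring E\<^esub> f \<oplus>\<^bsub>endomorphism_ring E\<^esub> h \<otimes>\<^bsub>endomorphism_ring E\<^esub> g"
      using f g h D by (auto simp: endomorphism_ring_def compose_def restrict_def)
  qed
qed

end

section \<open>The action of an endomorphism on x-coordinates\<close>

lemma dvd_if_orders_le:
  fixes p q :: "'a::alg_closed_field poly"
  assumes "p \<noteq> 0" "q \<noteq> 0" "\<And>r. order r p \<le> order r q"
  shows "p dvd q"
  using assms
proof (induction "degree p" arbitrary: p q)
  case 0
  then have "is_unit p" by (simp add: is_unit_iff_degree)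
  then show ?case by (rule unit_imp_dvd)
next
  case (Suc n)
  then obtain r where r: "poly p r = 0" using alg_closed_imp_poly_has_root[of p] by auto
  then have "order r p \<noteq> 0" using Suc.prems by (simp add: order_root)
  then have "order r q \<noteq> 0" using Suc.prems(3)[of r] by linarith
  then have "poly q r = 0" using Suc.prems by (simp add: order_root)
  then obtain p1 q1 where p1: "p = [:- r, 1:] * p1" and q1: "q = [:- r, 1:] * q1"
    using r by (auto simp: poly_eq_0_iff_dvd elim!: dvdE)
  have nz: "p1 \<noteq> 0" "q1 \<noteq> 0" using p1 q1 Suc.prems by auto
  have "degree p = Suc (degree p1)" unfolding p1 using nz by (subst degree_mult_eq) auto
  then have "n = degree p1" using Suc.hyps by simp
  then have "p1 dvd q1"
  proof (rule Suc.hyps(1)[OF _ nz])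
    fix s
    have "order s p = order s [:- r, 1:] + order s p1" "order s q = order s [:- r, 1:] + order s q1"
      using order_mult Suc.prems(1,2) unfolding p1 q1 by blast+
    then show "order s p1 \<le> order s q1" using Suc.prems(3)[of s] by linarith
  qed
  then show ?case unfolding p1 q1 by (rule mult_dvd_mono[OF dvd_refl])
qed

text \<open>At each place some entry of either vector does not vanish, so by cross-multiplication corresponding
  entries have the same orders at all places. They differ by a unit, the same one for all entries.\<close>

lemma primitive_vectors_proportional:
  fixes v w :: "nat \<Rightarrow> 'a::alg_closed_field poly"
  assumes v: "\<And>x. \<exists>i\<in>I. poly (v i) x \<noteq> 0" and w: "\<And>x. \<exists>i\<in>I. poly (w i) x \<noteq> 0"
    and cross: "\<And>i j. i \<in> I \<Longrightarrow> j \<in> I \<Longrightarrow> v i * w j = v j * w i"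
  shows "\<exists>c. c \<noteq> 0 \<and> (\<forall>i\<in>I. v i = smult c (w i))"
proof -
  have le: "w i \<noteq> 0 \<and> (\<forall>r. order r (w i) \<le> order r (v i))"
    if w: "\<And>x. \<exists>i\<in>I. poly (w i) x \<noteq> 0" and cross: "\<And>i j. i \<in> I \<Longrightarrow> j \<in> I \<Longrightarrow> v i * w j = v j * w i"
      and i: "i \<in> I" "v i \<noteq> 0" for v w :: "nat \<Rightarrow> 'a poly" and i
  proof -
    have nz: "w i \<noteq> 0"
    proof
      assume "w i = 0"
      then have "w j = 0" if "j \<in> I" for j using cross[OF i(1) that] i(2) by simp
      then show False using w[of 0] by auto
    qed
    moreover have "order r (w i) \<le> order r (v i)" for r
    proof -
      obtain j where j: "j \<in> I" "poly (w j) r \<noteq> 0" using w by blast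
      have c: "v i * w j = v j * w i" by (rule cross) (use i j in auto)
      have wj: "w j \<noteq> 0" using j by auto
      then have vj: "v j \<noteq> 0" using c i by auto
      have "order r (v i) + order r (w j) = order r (v j) + order r (w i)"
        using arg_cong[OF c, of "order r"] i wj vj nz by (simp add: order_mult)
      moreover have "order r (w j) = 0" using j by (simp add: order_root)
      ultimately show ?thesis by linarith
    qed
    ultimately show ?thesis by blast
  qed
  obtain i where i: "i \<in> I" "v i \<noteq> 0" using v[of 0] poly_0 by metis
  have wi: "w i \<noteq> 0" "\<And>r. order r (w i) \<le> order r (v i)" using le[where v = v and w = w, OF w cross i] by auto
  have "\<And>r. order r (v i) \<le> order r (w i)"
  proof -
    have "w i * v j = w j * v i" if "i \<in> I" "j \<in> I" for i j
      using cross[OF that] by (simp only: mult.commute)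
    from le[where v = w and w = v, OF v this i(1) wi(1)] show "order r (v i) \<le> order r (w i)" for r by blast
  qed
  then have "v i dvd w i" "w i dvd v i" using dvd_if_orders_le wi i(2) by auto
  then obtain h k where h: "w i = v i * h" and k: "v i = w i * k" by (elim dvdE)
  have "k * h = 1" using h k wi(1)
  proof -
    have "w i * (k * h) = w i * 1"
      by (simp only: mult.assoc[symmetric] k[symmetric] h[symmetric] mult_1_right)
    then show ?thesis using mult_left_cancel[OF wi(1)] by blast
  qed
  then have "is_unit k" by (metis dvd_triv_left)
  then obtain c where c: "k = [:c:]" "c dvd 1" by (auto simp: is_unit_poly_iff)
  then have "c \<noteq> 0" by auto
  have "v j = smult c (w j)" if "j \<in> I" for j
  proof -
    have "w i * v j = w i * (k * w j)"
      using cross[OF i(1) that] by (simp only: mult.assoc[symmetric] k[symmetric]) (simp only: mult.commute)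
    then have "v j = k * w j" using mult_left_cancel[OF wi(1)] by blast
    then show ?thesis using c by simp
  qed
  then show ?thesis using \<open>c \<noteq> 0\<close> by blast
qed

lemma cancel_common_roots:
  fixes p q :: "'a::field poly"
  assumes "p \<noteq> 0"
  shows "\<exists>g p1 q1. p = g * p1 \<and> q = g * q1 \<and> (\<forall>x. poly p1 x \<noteq> 0 \<or> poly q1 x \<noteq> 0)"
  using assms
proof (induction "degree p" arbitrary: p q rule: less_induct)
  case less
  show ?case
  proof (cases "\<exists>x. poly p x = 0 \<and> poly q x = 0")
    case True
    then obtain r p1 q1 where 1: "p = [:- r, 1:] * p1" "q = [:- r, 1:] * q1"
      by (auto simp: poly_eq_0_iff_dvd elim!: dvdE)
    then have nz: "p1 \<noteq> 0" using less.prems by auto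
    have "degree p = Suc (degree p1)" unfolding 1 using nz by (subst degree_mult_eq) auto
    from less.hyps[of p1 q1] this nz obtain g p2 q2 where
      2: "p1 = g * p2" "q1 = g * q2" "\<forall>x. poly p2 x \<noteq> 0 \<or> poly q2 x \<noteq> 0" by auto
    have "p = ([:- r, 1:] * g) * p2" "q = ([:- r, 1:] * g) * q2"
      unfolding 1 2 by (simp_all only: mult.assoc)
    then show ?thesis using 2 by blast
  next
    case False
    then show ?thesis by (intro exI[of _ 1] exI[of _ p] exI[of _ q]) auto
  qed
qed

text \<open>Coefficients at a nominal degree, which may be zero. Degrees of sums and products are computed in
  this calculus without case distinctions on cancellation.\<close>

definition top_term :: "nat \<Rightarrow> 'a::comm_ring_1 poly \<Rightarrow> 'a \<Rightarrow> bool" where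
  "top_term n p c \<longleftrightarrow> degree p \<le> n \<and> coeff p n = c"

lemma top_term_mult: "top_term m p c \<Longrightarrow> top_term n q d \<Longrightarrow> top_term (m + n) (p * q) (c * d)"
  using degree_mult_le[of p q] coeff_mult_bound[of p m q n] by (auto simp: top_term_def)

lemma top_term_add: "top_term n p c \<Longrightarrow> top_term n q d \<Longrightarrow> top_term n (p + q) (c + d)"
  and top_term_diff: "top_term n p c \<Longrightarrow> top_term n q d \<Longrightarrow> top_term n (p - q) (c - d)"
  by (auto simp: top_term_def degree_add_le degree_diff_le)

lemma top_term_smult: "top_term n p c \<Longrightarrow> top_term n (smult r p) (r * c)"
  using degree_smult_le[of r p] by (auto simp: top_term_def)

lemma top_term_power: "top_term n p c \<Longrightarrow> top_term (k * n) (p ^ k) (c ^ k)"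
  by (induction k) (auto simp: top_term_def[of 0] dest: top_term_mult)

lemma top_term_sum:
  "(\<And>i. i \<in> S \<Longrightarrow> top_term n (p i) (c i)) \<Longrightarrow> top_term n (\<Sum>i\<in>S. p i) (\<Sum>i\<in>S. c i)"
  by (induction S rule: infinite_finite_induct) (auto simp: top_term_add top_term_def[of _ 0])

lemma top_term_unique: "top_term n p c \<Longrightarrow> top_term n p d \<Longrightarrow> c = d"
  by (simp add: top_term_def)

text \<open>Together with \<open>hz\<close> this gives the image of a point on the projective line:
  \<open>(x : 1)\<close>, and \<open>(1 : 0)\<close> at infinity.\<close>

fun xnum :: "'a::field point \<Rightarrow> 'a" where "xnum Infinity = 1" | "xnum (Affine x y) = x"

lemma xnum_hz_neg [simp]: "xnum (neg_point P) = xnum P" "hz (neg_point P) = hz P"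
  by (cases P; simp)+

context elliptic
begin

lemma cofin_xc_poly:
  assumes "r \<noteq> 0"
  shows "\<forall>\<^sub>F Q in cofin. Q \<noteq> Infinity \<and> poly r (xc Q) \<noteq> 0"
  using cofin_xc[OF poly_roots_finite[OF assms]] by simp

lemma poly_zero_if_cofin:
  assumes "\<forall>\<^sub>F Q in cofin. poly r (xc Q) = 0"
  shows "r = 0"
proof (rule ccontr)
  assume "r \<noteq> 0"
  from cofin_xc_poly[OF this] assms have "\<forall>\<^sub>F Q in cofin. False" by eventually_elim simp
  then show False using cofin_nontrivial by (simp add: trivial_limit_def)
qed

text \<open>The endomorphism \<open>f\<close> acts on \<open>x\<close>-coordinates by \<open>p / q\<close> in
  lowest terms. The zero map is \<open>1 / 0\<close>. The degree condition says that infinity is mapped to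
  infinity; it is written with \<open>x q\<close>, which is \<open>pCons 0 q\<close>, in order to cover
  \<open>q = 0\<close>.\<close>

definition x_map :: "('k point \<Rightarrow> 'k point) \<Rightarrow> 'k poly \<Rightarrow> 'k poly \<Rightarrow> bool" where
  "x_map f p q \<longleftrightarrow> (\<forall>x. poly p x \<noteq> 0 \<or> poly q x \<noteq> 0) \<and> degree (pCons 0 q) \<le> degree p \<and>
     (\<forall>\<^sub>F Q in cofin. xnum (f Q) * poly q (xc Q) = hz (f Q) * poly p (xc Q))"

lemma x_map_nonzero: "x_map f p q \<Longrightarrow> p \<noteq> 0"
  by (auto simp: x_map_def split: if_splits)

lemma x_map_cross:
  assumes "x_map f p q" "x_map f p' q'"
  shows "p * q' = q * p'"
proof -
  have "\<forall>\<^sub>F Q in cofin. poly (p * q' - q * p') (xc Q) = 0"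
    using assms[unfolded x_map_def, THEN conjunct2, THEN conjunct2]
  proof eventually_elim
    case (elim Q)
    show ?case
    proof (cases "f Q")
      case (Affine x y)
      then have "poly p (xc Q) = x * poly q (xc Q)" "poly p' (xc Q) = x * poly q' (xc Q)" using elim by auto
      then show ?thesis by simp
    qed (use elim in auto)
  qed
  then show ?thesis using poly_zero_if_cofin by fastforce
qed

lemma x_map_unique:
  assumes "x_map f p q" "x_map f p' q'"
  shows "\<exists>c. c \<noteq> 0 \<and> p = smult c p' \<and> q = smult c q'"
proof -
  define v where "v = (\<lambda>i::nat. if i = 0 then p else q)"
  define w where "w = (\<lambda>i::nat. if i = 0 then p' else q')"
  have "\<exists>c. c \<noteq> 0 \<and> (\<forall>i\<in>{0, 1 :: nat}. v i = smult c (w i))"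
  proof (rule primitive_vectors_proportional)
    show "v i * w j = v j * w i" for i j using x_map_cross[OF assms] by (simp add: v_def w_def mult_ac)
  qed (use assms in \<open>auto simp: x_map_def v_def w_def\<close>)
  then show ?thesis by (auto simp: v_def w_def)
qed

definition endo_degree :: "('k point \<Rightarrow> 'k point) \<Rightarrow> int" where
  "endo_degree f = int (degree (fst (SOME (p, q). x_map f p q)))"

text \<open>The value of \<open>x q / p\<close> at infinity. Since \<open>x\<close> has the leading term
  \<open>T\<^sup>-\<^sup>2\<close> in a local parameter \<open>T\<close>, this is the square of the derivative
  of the endomorphism at the origin.\<close>

definition endo_slope :: "('k point \<Rightarrow> 'k point) \<Rightarrow> 'k" where
  "endo_slope f = (case (SOME (p, q). x_map f p q) of (p, q) \<Rightarrow> coeff (pCons 0 q) (degree p) / lead_coeff p)"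

lemma endo_degree_slope:
  assumes "x_map f p q"
  shows "endo_degree f = int (degree p)" "endo_slope f = coeff (pCons 0 q) (degree p) / lead_coeff p"
proof -
  have *: "case (SOME (p, q). x_map f p q) of (p, q) \<Rightarrow> x_map f p q"
    by (rule someI[of "\<lambda>(p, q). x_map f p q" "(p, q)"]) (use assms in simp)
  obtain p' q' where s: "(SOME (p, q). x_map f p q) = (p', q')" by fastforce
  then have "x_map f p' q'" using * by simp
  then obtain c where "c \<noteq> 0" "p' = smult c p" "q' = smult c q" using x_map_unique assms by blast
  then show "endo_degree f = int (degree p)" "endo_slope f = coeff (pCons 0 q) (degree p) / lead_coeff p"
    by (auto simp: endo_degree_def endo_slope_def s coeff_pCons split: nat.splits)
qed

text \<open>Take forms \<open>r0\<close>, \<open>r1\<close>, \<open>r2\<close> that represent \<open>f\<close>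
  at infinity. Since \<open>f\<close> commutes with negation, multiplying \<open>r0 / r2\<close> by the
  conjugate of \<open>r2\<close> gives \<open>x(f Q) = p / n2\<close> with the norm \<open>n2\<close> of
  \<open>r2\<close>. The equation of the curve becomes
  \<open>- n1 n2\<^sup>2 = p\<^sup>3 + a p n2\<^sup>2 + b n2\<^sup>3\<close>, and as \<open>f\<close> fixes
  infinity, the norm \<open>n1\<close> of \<open>r1\<close> has full degree \<open>3 d\<close> while
  \<open>n2\<close> has smaller degree. Therefore \<open>deg p > deg n2\<close>.\<close>

lemma x_map_exists:
  assumes f: "f \<in> Endo"
  shows "\<exists>p q. x_map f p q"
proof -
  obtain d r0 r1 r2 where r: "form d r0" "form d r1" "form d r2"
    and rep: "\<forall>\<^sub>F Q in near Infinity. represents f r0 r1 r2 Q"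
    by (rule forms_if_map_regular[OF points_Infinity endomorphismsD(2)[OF f] endomorphismsD(3)[OF f points_Infinity]])
  have "represents f r0 r1 r2 Infinity" using rep by (simp only: eventually_near)
  then have rI: "r1 Infinity \<noteq> 0" "r2 Infinity = 0"
    unfolding proj_equal_homog_coords hom_Infinity[OF f] by auto
  obtain A0 B0 where 0: "\<And>x y. Affine x y \<in> points E \<Longrightarrow> r0 (Affine x y) = yeval A0 B0 x y"
    using form_affine[OF r(1)] by blast
  obtain A1 B1 where 1: "pole_bound d (r1 Infinity) A1 B1"
    "\<And>x y. Affine x y \<in> points E \<Longrightarrow> r1 (Affine x y) = yeval A1 B1 x y"
    using form_affine[OF r(2)] by blast
  obtain A2 B2 where 2: "pole_bound d (r2 Infinity) A2 B2"
    "\<And>x y. Affine x y \<in> points E \<Longrightarrow> r2 (Affine x y) = yeval A2 B2 x y"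
    using form_affine[OF r(3)] by blast
  define n1 where "n1 = ynorm A1 B1"
  define n2 where "n2 = ynorm A2 B2"
  have rep': "\<forall>\<^sub>F Q in cofin. represents f r0 r1 r2 Q" using rep by (simp only: eventually_near)
  show ?thesis
  proof (cases "n2 = 0")
    case True
    then have A2: "A2 = 0" "B2 = 0" by (auto simp: n2_def ynorm_eq_0)
    have "\<forall>\<^sub>F Q in cofin. xnum (f Q) * poly 0 (xc Q) = hz (f Q) * poly 1 (xc Q)"
      using rep' cofin_points cofin_neq[of Infinity]
    proof eventually_elim
      case (elim Q)
      have "r2 Q = 0" using elim 2(2) A2 by (cases Q) (auto simp: yeval_def)
      then have "f Q = Infinity" using elim(1) unfolding proj_equal_homog_coords by (auto split: point.splits)
      then show ?case by simp
    qed
    then have "x_map f 1 0" by (simp add: x_map_def)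
    then show ?thesis by blast
  next
    case False
    define p where "p = A0 * A2 - cubic * (B0 * B2)"
    have "\<forall>\<^sub>F Q in cofin. \<exists>x y. f Q = Affine x y \<and> y ^ 2 = x ^ 3 + a * x + b \<and>
        x * poly n2 (xc Q) = poly p (xc Q) \<and> poly n1 (xc Q) = - (y ^ 2) * poly n2 (xc Q)"
      using rep' cofin_neg[OF rep'] cofin_points cofin_xc_poly[OF False]
    proof eventually_elim
      case (elim Q)
      obtain t s where Q: "Q = Affine t s" using elim by (cases Q) auto
      have on: "Affine t s \<in> points E" "Affine t (- s) \<in> points E" using elim Q by auto
      have n2: "poly n2 t = r2 Q * r2 (neg_point Q)"
        using poly_ynorm[OF on(1)] 2(2) on Q by (simp add: n2_def)
      have n1: "poly n1 t = r1 Q * r1 (neg_point Q)"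
        using poly_ynorm[OF on(1)] 1(2) on Q by (simp add: n1_def)
      have nz: "r2 Q \<noteq> 0" using n2 elim Q by auto
      then obtain x y where fQ: "f Q = Affine x y" "r0 Q = r2 Q * x" "r1 Q = r2 Q * y"
        using elim(1) unfolding proj_equal_homog_coords by (auto split: point.splits)
      have fnQ: "f (neg_point Q) = Affine x (- y)" using hom_neg[OF f elim(3)] fQ by simp
      then have m: "r0 (neg_point Q) = r2 (neg_point Q) * x" "r1 (neg_point Q) = - r2 (neg_point Q) * y"
        using elim(2) unfolding proj_equal_homog_coords by auto
      have cub: "poly cubic t = s ^ 2" using on by simp
      have "r0 Q * r2 (neg_point Q) + r0 (neg_point Q) * r2 Q = 2 * poly p t"
        using cub unfolding Q p_def neg_point.simps 0[OF on(1)] 0[OF on(2)] 2(2)[OF on(1)] 2(2)[OF on(2)]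
          yeval_def poly_diff poly_mult by Groebner_Basis.algebra
      then have "2 * (x * poly n2 t) = 2 * poly p t"
        unfolding fQ(2) m(1) n2 by (simp add: algebra_simps)
      then have "x * poly n2 t = poly p t" by (rule double_cancel)
      moreover have "poly n1 t = - (y ^ 2) * poly n2 t"
        unfolding n1 n2 fQ(3) m(2) by (simp add: power2_eq_square)
      moreover have "y ^ 2 = x ^ 3 + a * x + b" using endomorphismsD(5)[OF f elim(3)] fQ by simp
      ultimately show ?case unfolding Q xc.simps using fQ(1)[unfolded Q] by blast
    qed
    note ev = this
    have "\<forall>\<^sub>F Q in cofin. poly (n1 * n2 ^ 2 + (p ^ 3 + smult a (p * n2 ^ 2) + smult b (n2 ^ 3))) (xc Q) = 0"
      using ev
    proof eventually_elim
      case (elim Q)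
      then obtain x y where xy: "y ^ 2 = x ^ 3 + a * x + b" "x * poly n2 (xc Q) = poly p (xc Q)"
        "poly n1 (xc Q) = - (y ^ 2) * poly n2 (xc Q)" by blast
      show ?case
        unfolding poly_add poly_mult poly_power poly_smult xy(2)[symmetric] xy(3) xy(1)
        by Groebner_Basis.algebra
    qed
    then have eq: "n1 * n2 ^ 2 + (p ^ 3 + smult a (p * n2 ^ 2) + smult b (n2 ^ 3)) = 0"
      by (rule poly_zero_if_cofin)
    have c1: "coeff n1 (3 * d) \<noteq> 0" using degree_ynorm(2)[OF 1(1)] rI by (auto simp: n1_def)
    have d1: "degree n1 = 3 * d" using degree_ynorm(1)[OF 1(1)] le_degree[OF c1] by (simp add: n1_def)
    have d2: "degree n2 < 3 * d"
    proof (rule ccontr)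
      assume "\<not> degree n2 < 3 * d"
      then have "degree n2 = 3 * d" using degree_ynorm(1)[OF 2(1)] by (simp add: n2_def)
      then show False using degree_ynorm(2)[OF 2(1)] rI(2) False n2_def
        by (metis leading_coeff_0_iff minus_zero power_zero_numeral)
    qed
    have n1: "n1 \<noteq> 0" using c1 by auto
    (* Otherwise the cubic in p and n2 has degree at most 3 deg n2, less than deg (n1 n2^2). *)
    have dp: "degree n2 < degree p"
    proof (rule ccontr)
      assume "\<not> degree n2 < degree p"
      then have "top_term (degree n2) p (coeff p (degree n2))" "top_term (degree n2) n2 (lead_coeff n2)"
        by (auto simp: top_term_def)
      note tt = top_term_power[OF this(1), of 3] top_term_power[OF this(2), of 3]
        top_term_mult[OF this(1) top_term_power[OF this(2), of 2]]
      have "degree (p ^ 3 + smult a (p * n2 ^ 2) + smult b (n2 ^ 3)) \<le> 3 * degree n2"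
        using tt degree_smult_le[of a "p * n2 ^ 2"] degree_smult_le[of b "n2 ^ 3"]
        by (intro degree_add_le) (auto simp: top_term_def)
      moreover have "p ^ 3 + smult a (p * n2 ^ 2) + smult b (n2 ^ 3) = - (n1 * n2 ^ 2)"
        using eq by (simp add: add_eq_0_iff)
      ultimately have "degree (n1 * n2 ^ 2) \<le> 3 * degree n2" by simp
      then show False using d1 d2 n1 False by (simp add: degree_mult_eq degree_power_eq)
    qed
    then have "p \<noteq> 0" by auto
    from cancel_common_roots[OF this, of n2] obtain g p1 q1 where
      g: "p = g * p1" "n2 = g * q1" "\<forall>x. poly p1 x \<noteq> 0 \<or> poly q1 x \<noteq> 0" by blast
    have gnz: "g \<noteq> 0" "p1 \<noteq> 0" "q1 \<noteq> 0" using g False \<open>p \<noteq> 0\<close> by auto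
    have "degree q1 < degree p1" using dp gnz unfolding g by (simp add: degree_mult_eq)
    moreover have "\<forall>\<^sub>F Q in cofin. xnum (f Q) * poly q1 (xc Q) = hz (f Q) * poly p1 (xc Q)"
      using ev cofin_xc_poly[OF gnz(1)]
      by eventually_elim (auto simp: g)
    ultimately have "x_map f p1 q1" using g by (auto simp: x_map_def)
    then show ?thesis by blast
  qed
qed

end

section \<open>The parallelogram laws\<close>

context elliptic
begin

text \<open>The symmetric functions of \<open>x(U + V)\<close> and \<open>x(U - V)\<close> in homogeneous
  coordinates: the sum is \<open>kum_sum / kum_diff\<close> and the product is
  \<open>kum_prod / kum_diff\<close>, where \<open>(x1 : z1)\<close> and \<open>(x2 : z2)\<close> are the images
  of \<open>U\<close> and \<open>V\<close> on the projective line.\<close>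

definition kum_sum where "kum_sum x1 z1 x2 z2 =
  2 * ((x1 * z2 + x2 * z1) * (x1 * x2 + a * z1 * z2) + 2 * b * z1 ^ 2 * z2 ^ 2)"
definition kum_prod where "kum_prod x1 z1 x2 z2 =
  (x1 * x2 - a * z1 * z2) ^ 2 - 4 * b * z1 * z2 * (x1 * z2 + x2 * z1)"
definition kum_diff where "kum_diff x1 z1 x2 z2 = (x1 * z2 - x2 * z1) ^ (2::nat)"

lemma double_point:
  assumes "Affine x y \<in> points E" "y \<noteq> 0"
  shows "\<exists>x3 y3. Affine x y \<boxplus> Affine x y = Affine x3 y3 \<and>
    x3 * (4 * (x ^ 3 + a * x + b)) = (x ^ 2 - a) ^ 2 - 8 * b * x"
proof -
  define l where "l = (3 * x ^ 2 + a) / (2 * y)"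
  have l: "l * (2 * y) = 3 * x ^ 2 + a" using assms by (simp add: l_def)
  have c: "y ^ 2 = x ^ 3 + a * x + b" using assms by simp
  have "y \<noteq> - y" using assms(2) double_nonzero by (metis add_eq_0_iff mult_2)
  then have "Affine x y \<boxplus> Affine x y = Affine (l ^ 2 - x - x) (l * (x - (l ^ 2 - x - x)) - y)"
    by (simp add: add_points.simps(3) Let_def l_def)
  moreover have "(l ^ 2 - x - x) * (4 * (x ^ 3 + a * x + b)) = (x ^ 2 - a) ^ 2 - 8 * b * x"
    using l c by Groebner_Basis.algebra
  ultimately show ?thesis by blast
qed

lemma kummer_same:
  assumes U: "U \<in> points E"
  shows "xnum (U \<boxplus> U) * kum_sum (xnum U) (hz U) (xnum U) (hz U) =
    hz (U \<boxplus> U) * kum_prod (xnum U) (hz U) (xnum U) (hz U)"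
proof (cases U)
  case (Affine x y)
  then have c: "y ^ 2 = x ^ 3 + a * x + b" using U by simp
  show ?thesis
  proof (cases "y = 0")
    case True
    then have "U \<boxplus> U = Infinity" using Affine by (simp add: add_points.simps(3))
    moreover have "kum_sum x 1 x 1 = 4 * y ^ 2" unfolding kum_sum_def c power_one mult_1_right by Groebner_Basis.algebra
    ultimately show ?thesis using Affine True by simp
  next
    case False
    then obtain x3 y3 where "U \<boxplus> U = Affine x3 y3" "x3 * (4 * (x ^ 3 + a * x + b)) = (x ^ 2 - a) ^ 2 - 8 * b * x"
      using double_point[of x y] U Affine by auto
    moreover have "kum_sum x 1 x 1 = 4 * (x ^ 3 + a * x + b)" "kum_prod x 1 x 1 = (x ^ 2 - a) ^ 2 - 8 * b * x"
      unfolding kum_sum_def kum_prod_def power_one mult_1_right by Groebner_Basis.algebra+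
    ultimately show ?thesis using Affine by simp
  qed
qed (simp add: kum_sum_def)

text \<open>Written as cross products the relations are projective and remain true when some of the points are
  at infinity or \<open>U = \<plusminus> V\<close>. In the last case \<open>kum_diff\<close> vanishes and the
  relation left is the duplication formula.\<close>

lemma kummer_relations:
  assumes U: "U \<in> points E" and V: "V \<in> points E"
  defines "x3 \<equiv> xnum (U \<boxplus> V)" and "z3 \<equiv> hz (U \<boxplus> V)"
    and "x4 \<equiv> xnum (U \<boxplus> neg_point V)" and "z4 \<equiv> hz (U \<boxplus> neg_point V)"
    and "A \<equiv> kum_sum (xnum U) (hz U) (xnum V) (hz V)"
    and "B \<equiv> kum_prod (xnum U) (hz U) (xnum V) (hz V)"
    and "C \<equiv> kum_diff (xnum U) (hz U) (xnum V) (hz V)"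
  shows "(x3 * z4 + x4 * z3) * B = x3 * x4 * A \<and> (x3 * z4 + x4 * z3) * C = z3 * z4 * A \<and>
    x3 * x4 * C = z3 * z4 * B"
proof -
  note d = x3_def z3_def x4_def z4_def A_def B_def C_def
  note k = kum_sum_def kum_prod_def kum_diff_def
  show ?thesis
  proof (cases "U = Infinity \<or> V = Infinity")
    case True
    then show ?thesis
    proof
      assume "U = Infinity"
      then show ?thesis unfolding d by (simp add: k power2_eq_square)
    next
      assume "V = Infinity"
      then show ?thesis unfolding d by (simp add: k power2_eq_square)
    qed
  next
    case False
    then obtain x1 y1 x2 y2 where UV: "U = Affine x1 y1" "V = Affine x2 y2" by (metis point.exhaust)
    have c1: "y1 ^ 2 = x1 ^ 3 + a * x1 + b" and c2: "y2 ^ 2 = x2 ^ 3 + a * x2 + b" using U V UV by auto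
    show ?thesis
    proof (cases "x1 = x2")
      case True
      then have "V = U \<or> V = neg_point U" using same_x_iff[OF V U] UV by auto
      then show ?thesis
      proof
        assume "V = U"
        then show ?thesis using kummer_same[OF U] unfolding d by (simp add: kum_diff_def mult_ac)
      next
        assume "V = neg_point U"
        then show ?thesis using kummer_same[OF U] unfolding d by (simp add: kum_diff_def mult_ac)
      qed
    next
      case False
      define w where "w = x2 - x1"
      have w: "w \<noteq> 0" using False by (simp add: w_def)
      define l where "l = (y2 - y1) / w"
      define m where "m = (- y2 - y1) / w"
      have lw: "l * w = y2 - y1" and mw: "m * w = - y2 - y1" using w by (simp_all add: l_def m_def)
      have 3: "x3 = l ^ 2 - x1 - x2" "z3 = 1" and 4: "x4 = m ^ 2 - x1 - x2" "z4 = 1"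
        unfolding d UV using add_distinct[OF False] by (simp_all add: Let_def l_def m_def w_def)
      have C: "C = w ^ 2" unfolding C_def UV k w_def by simp Groebner_Basis.algebra
      have A: "A = 2 * ((x1 + x2) * (x1 * x2 + a) + 2 * b)" unfolding A_def UV k by simp
      have B: "B = (x1 * x2 - a) ^ 2 - 4 * b * (x1 + x2)" unfolding B_def UV k by simp
      have i: "(x3 + x4) * w ^ 2 = A"
        unfolding 3 4 A using lw mw c1 c2 w_def by Groebner_Basis.algebra
      have "x3 * w ^ 2 * (x4 * w ^ 2) = B * w ^ 2"
        unfolding 3 4 B using lw mw c1 c2 w_def by Groebner_Basis.algebra
      then have "(x3 * x4 * w ^ 2) * w ^ 2 = B * w ^ 2" by (simp only: mult_ac)
      then have ii: "x3 * x4 * w ^ 2 = B" using w by simp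
      show ?thesis unfolding 3(2) 4(2) C i[symmetric] ii[symmetric] mult_1_right mult_1_left
        by (simp only: ac_simps simp_thms)
    qed
  qed
qed

text \<open>If \<open>kum_diff\<close> vanishes, then the two points have the same \<open>x\<close>, and the
  other two expressions are the denominator and numerator of the duplication formula. A combination of these is
  the discriminant.\<close>

lemma kummer_no_common_zero:
  assumes "(x1, z1) \<noteq> (0, 0)" "(x2, z2) \<noteq> (0, 0)"
    and "kum_sum x1 z1 x2 z2 = 0" "kum_prod x1 z1 x2 z2 = 0" "kum_diff x1 z1 x2 z2 = 0"
  shows False
proof -
  have c: "x1 * z2 = x2 * z1" using assms(5) by (simp add: kum_diff_def)
  show False
  proof (cases "z1 = 0 \<or> z2 = 0")
    case True
    then have z: "z1 = 0" "z2 = 0" "x1 \<noteq> 0" "x2 \<noteq> 0" using c assms(1,2) by auto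
    then show False using assms(4) by (simp add: kum_prod_def)
  next
    case False
    define x where "x = x1 / z1"
    have x: "x1 = x * z1" "x2 = x * z2" using False c by (auto simp: x_def field_simps)
    have "4 * (x ^ 3 + a * x + b) * (z1 ^ 2 * z2 ^ 2) = 0"
      using assms(3) unfolding kum_sum_def x by Groebner_Basis.algebra
    then have 1: "x ^ 3 + a * x + b = 0" using False unfolding mult_eq_0_iff by simp
    have "((x ^ 2 - a) ^ 2 - 8 * b * x) * (z1 ^ 2 * z2 ^ 2) = 0"
      using assms(4) unfolding kum_prod_def x by Groebner_Basis.algebra
    then have 2: "(x ^ 2 - a) ^ 2 - 8 * b * x = 0" using False unfolding mult_eq_0_iff by simp
    have "4 * a ^ 3 + 27 * b ^ 2 =
      (3 * x ^ 2 + 4 * a) * ((x ^ 2 - a) ^ 2 - 8 * b * x) - (3 * x ^ 3 - 5 * a * x - 27 * b) * (x ^ 3 + a * x + b)"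
      by Groebner_Basis.algebra
    then show False using 1 2 disc_nonzero by simp
  qed
qed

lemma x_map_top_terms:
  assumes "x_map f p q"
  defines "s \<equiv> coeff (pCons 0 q) (degree p)"
  shows "top_term (degree p) p (lead_coeff p)" "top_term (degree p) q 0" "top_term (degree p) ([:0, 1:] * q) s"
    "lead_coeff p \<noteq> 0" "endo_slope f = s / lead_coeff p" "endo_degree f = int (degree p)"
proof -
  show "lead_coeff p \<noteq> 0" using x_map_nonzero[OF assms(1)] by simp
  show "top_term (degree p) p (lead_coeff p)" by (simp add: top_term_def)
  have d: "degree (pCons 0 q) \<le> degree p" using assms by (simp add: x_map_def)
  show "top_term (degree p) q 0"
  proof (cases "q = 0")
    case False
    then have "degree q < degree p" using d by simp
    then show ?thesis by (simp add: top_term_def coeff_eq_0)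
  qed (simp add: top_term_def)
  show "top_term (degree p) ([:0, 1:] * q) s" using d by (simp add: top_term_def s_def)
  show "endo_slope f = s / lead_coeff p" "endo_degree f = int (degree p)"
    using endo_degree_slope[OF assms(1)] by (simp_all add: s_def)
qed

text \<open>Substituting \<open>p1 / q1\<close> and \<open>p2 / q2\<close> for \<open>x(U)\<close> and
  \<open>x(V)\<close> gives polynomials \<open>A\<close>, \<open>B\<close>, \<open>C\<close> without common
  zero, proportional to \<open>p3 q4 + p4 q3\<close>, \<open>p3 p4\<close>, \<open>q3 q4\<close> by the
  relations above. The latter have no common zero either, so the factor is a constant. Comparing the degrees of
  \<open>B\<close> and \<open>p3 p4\<close> gives the first law; the top coefficients of \<open>x A\<close> and
  \<open>x\<^sup>2 C\<close>, relative to that of \<open>B\<close>, give the laws for the slope.\<close>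

lemma parallelogram:
  assumes f: "f \<in> Endo" and g: "g \<in> Endo"
  shows "endo_degree (endo_add f g) + endo_degree (endo_add f (endo_neg g)) = 2 * endo_degree f + 2 * endo_degree g"
    "endo_slope (endo_add f g) + endo_slope (endo_add f (endo_neg g)) = 2 * endo_slope f + 2 * endo_slope g"
    "endo_slope (endo_add f g) * endo_slope (endo_add f (endo_neg g)) = (endo_slope f - endo_slope g) ^ 2"
proof -
  obtain p1 q1 where 1: "x_map f p1 q1" using x_map_exists[OF f] by blast
  obtain p2 q2 where 2: "x_map g p2 q2" using x_map_exists[OF g] by blast
  obtain p3 q3 where 3: "x_map (endo_add f g) p3 q3" using x_map_exists[OF endo_add[OF f g]] by blast
  obtain p4 q4 where 4: "x_map (endo_add f (endo_neg g)) p4 q4"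
    using x_map_exists[OF endo_add[OF f endo_neg[OF g]]] by blast
  let ?x = "[:0, 1:]"
  define A where "A = smult 2 ((p1 * q2 + p2 * q1) * (p1 * p2 + smult a (q1 * q2)) + smult (2 * b) ((q1 * q2) ^ 2))"
  define B where "B = (p1 * p2 - smult a (q1 * q2)) ^ 2 - smult (4 * b) ((q1 * q2) * (p1 * q2 + p2 * q1))"
  define C where "C = (p1 * q2 - p2 * q1) ^ 2"
  have A: "poly A x = kum_sum (poly p1 x) (poly q1 x) (poly p2 x) (poly q2 x)"
    and B: "poly B x = kum_prod (poly p1 x) (poly q1 x) (poly p2 x) (poly q2 x)"
    and C: "poly C x = kum_diff (poly p1 x) (poly q1 x) (poly p2 x) (poly q2 x)" for x
    unfolding A_def B_def C_def kum_sum_def kum_prod_def kum_diff_def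
    by (simp_all add: power_mult_distrib mult.assoc)
  have rel: "\<forall>\<^sub>F Q in cofin. poly ((p3 * q4 + p4 * q3) * B - (p3 * p4) * A) (xc Q) = 0 \<and>
    poly ((p3 * q4 + p4 * q3) * C - (q3 * q4) * A) (xc Q) = 0 \<and> poly ((p3 * p4) * C - (q3 * q4) * B) (xc Q) = 0"
    using 1[unfolded x_map_def, THEN conjunct2, THEN conjunct2] 2[unfolded x_map_def, THEN conjunct2, THEN conjunct2]
      3[unfolded x_map_def, THEN conjunct2, THEN conjunct2] 4[unfolded x_map_def, THEN conjunct2, THEN conjunct2]
      cofin_points
  proof eventually_elim
    case (elim Q)
    let ?U = "f Q" and ?V = "g Q"
    have UV: "?U \<in> points E" "?V \<in> points E" using f g elim(5) endomorphismsD(5) by auto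
    have e: "endo_add f g Q = ?U \<boxplus> ?V" "endo_add f (endo_neg g) Q = ?U \<boxplus> neg_point ?V" using elim(5) by auto
    (* Each pair (p(x), q(x)) is a multiple of the coordinates of the image on the projective line. *)
    have propor: "\<exists>c. r = c * xnum P \<and> t = c * hz P" if "xnum P * t = hz P * r" for P :: "'k point" and r t
      using that by (cases P) auto
    from propor[OF elim(1)] propor[OF elim(2)] propor[OF elim(3)] propor[OF elim(4)]
    obtain c1 c2 c3 c4 where c:
      "poly p1 (xc Q) = c1 * xnum ?U" "poly q1 (xc Q) = c1 * hz ?U"
      "poly p2 (xc Q) = c2 * xnum ?V" "poly q2 (xc Q) = c2 * hz ?V"
      "poly p3 (xc Q) = c3 * xnum (?U \<boxplus> ?V)" "poly q3 (xc Q) = c3 * hz (?U \<boxplus> ?V)"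
      "poly p4 (xc Q) = c4 * xnum (?U \<boxplus> neg_point ?V)" "poly q4 (xc Q) = c4 * hz (?U \<boxplus> neg_point ?V)"
      unfolding e by blast
    have hom: "kum_sum (c1 * x1) (c1 * z1) (c2 * x2) (c2 * z2) = (c1 * c2) ^ 2 * kum_sum x1 z1 x2 z2"
      "kum_prod (c1 * x1) (c1 * z1) (c2 * x2) (c2 * z2) = (c1 * c2) ^ 2 * kum_prod x1 z1 x2 z2"
      "kum_diff (c1 * x1) (c1 * z1) (c2 * x2) (c2 * z2) = (c1 * c2) ^ 2 * kum_diff x1 z1 x2 z2"
      for x1 z1 x2 z2 unfolding kum_sum_def kum_prod_def kum_diff_def by Groebner_Basis.algebra+
    have fin: "c3 * x3 * (c4 * z4) + c4 * x4 * (c3 * z3) = c3 * c4 * (x3 * z4 + x4 * z3)" for x3 z3 x4 z4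
      by Groebner_Basis.algebra
    show ?case
      using kummer_relations[OF UV]
      unfolding poly_diff poly_mult poly_add A B C c hom fin right_minus_eq
      by (auto simp: mult_ac)
  qed
  have cross: "(p3 * q4 + p4 * q3) * B = (p3 * p4) * A" "(p3 * q4 + p4 * q3) * C = (q3 * q4) * A"
    "(p3 * p4) * C = (q3 * q4) * B"
    using poly_zero_if_cofin[OF eventually_mono[OF rel], of "(p3 * q4 + p4 * q3) * B - (p3 * p4) * A"]
      poly_zero_if_cofin[OF eventually_mono[OF rel], of "(p3 * q4 + p4 * q3) * C - (q3 * q4) * A"]
      poly_zero_if_cofin[OF eventually_mono[OF rel], of "(p3 * p4) * C - (q3 * q4) * B"]
    by simp_all
  define v where "v = (\<lambda>i. [p3 * q4 + p4 * q3, p3 * p4, q3 * q4] ! i)"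
  define w where "w = (\<lambda>i. [A, B, C] ! i)"
  have prim: "poly p x \<noteq> 0 \<or> poly q x \<noteq> 0" if "x_map h p q" for h p q x
    using that by (simp add: x_map_def)
  have "\<exists>c. c \<noteq> 0 \<and> (\<forall>i\<in>{0, 1, 2}. v i = smult c (w i))"
  proof (rule primitive_vectors_proportional)
    show "\<exists>i\<in>{0, 1, 2}. poly (v i) x \<noteq> 0" for x
      using prim[OF 3, of x] prim[OF 4, of x] by (auto simp: v_def)
    show "\<exists>i\<in>{0, 1, 2}. poly (w i) x \<noteq> 0" for x
      using kummer_no_common_zero[of "poly p1 x" "poly q1 x" "poly p2 x" "poly q2 x"] prim[OF 1, of x] prim[OF 2, of x]
      by (auto simp: w_def A B C)
    show "v i * w j = v j * w i" if "i \<in> {0, 1, 2}" "j \<in> {0, 1, 2}" for i j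
      using that cross by (auto simp: v_def w_def mult_ac)
  qed
  then obtain c where c: "c \<noteq> 0" "p3 * q4 + p4 * q3 = smult c A" "p3 * p4 = smult c B" "q3 * q4 = smult c C"
    by (auto simp: v_def w_def)
  note t1 = x_map_top_terms[OF 1] and t2 = x_map_top_terms[OF 2] and t3 = x_map_top_terms[OF 3] and t4 = x_map_top_terms[OF 4]
  define l1 where "l1 = lead_coeff p1" define l2 where "l2 = lead_coeff p2"
  define l3 where "l3 = lead_coeff p3" define l4 where "l4 = lead_coeff p4"
  define s1 where "s1 = coeff (pCons 0 q1) (degree p1)" define s2 where "s2 = coeff (pCons 0 q2) (degree p2)"
  define s3 where "s3 = coeff (pCons 0 q3) (degree p3)" define s4 where "s4 = coeff (pCons 0 q4) (degree p4)"
  note ls = l1_def[symmetric] l2_def[symmetric] l3_def[symmetric] l4_def[symmetric]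
    s1_def[symmetric] s2_def[symmetric] s3_def[symmetric] s4_def[symmetric]
  define n where "n = degree p1 + degree p2"
  define n' where "n' = degree p3 + degree p4"
  (* Multiplying q by x brings its top coefficient into the same nominal degree as that of p. *)
  have q12: "top_term n (q1 * q2) 0" using top_term_mult[OF t1(2) t2(2)] by (simp add: n_def)
  have p12: "top_term n (p1 * p2) (l1 * l2)" using top_term_mult[OF t1(1) t2(1)] by (simp add: n_def ls)
  have pq12: "top_term n (p1 * q2) 0" using top_term_mult[OF t1(1) t2(2)] by (simp add: n_def)
  have pq21: "top_term n (p2 * q1) 0" using top_term_mult[OF t2(1) t1(2)] by (simp add: n_def add.commute)
  have xpq12: "top_term n (p1 * (?x * q2)) (l1 * s2)" using top_term_mult[OF t1(1) t2(3)] by (simp only: n_def ls)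
  have xpq21: "top_term n (p2 * (?x * q1)) (l2 * s1)"
    using top_term_mult[OF t2(1) t1(3)] by (simp only: n_def ls add.commute[of "degree p2"])
  have xq12: "top_term n ((?x * q1) * q2) 0" using top_term_mult[OF t1(3) t2(2)] by (simp only: n_def mult_zero_right)
  have "top_term (2 * n) ((p1 * p2 - smult a (q1 * q2)) ^ 2 - smult (4 * b) ((q1 * q2) * (p1 * q2 + p2 * q1)))
      ((l1 * l2 - a * 0) ^ 2 - 4 * b * (0 * (0 + 0)))"
    unfolding mult_2
    by (intro top_term_diff top_term_smult top_term_mult q12 top_term_add pq12 pq21
      top_term_power[of n _ _ 2, unfolded mult_2] p12)
  then have tB: "top_term (2 * n) B ((l1 * l2) ^ 2)" by (simp add: B_def)
  have xA: "?x * A = smult 2 ((p1 * (?x * q2) + p2 * (?x * q1)) * (p1 * p2 + smult a (q1 * q2)) +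
      smult (2 * b) (((?x * q1) * q2) * (q1 * q2)))"
    unfolding A_def by (simp only: power2_eq_square algebra_simps mult_smult_right mult_smult_left smult_add_right)
  have "top_term (2 * n) (?x * A) (2 * ((l1 * s2 + l2 * s1) * (l1 * l2 + a * 0) + 2 * b * (0 * 0)))"
    unfolding xA unfolding mult_2[of n]
    by (intro top_term_diff top_term_smult top_term_mult q12 top_term_add xpq12 xpq21 xq12 p12)
  then have tA: "top_term (2 * n) (?x * A) (2 * ((l1 * s2 + l2 * s1) * (l1 * l2)))" by simp
  have xC: "?x * (?x * C) = (p1 * (?x * q2) - p2 * (?x * q1)) * (p1 * (?x * q2) - p2 * (?x * q1))"
    unfolding C_def power2_eq_square by (simp only: algebra_simps)
  have tC: "top_term (2 * n) (?x * (?x * C)) ((l1 * s2 - l2 * s1) * (l1 * s2 - l2 * s1))"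
    unfolding xC mult_2 by (intro top_term_mult top_term_diff xpq12 xpq21)
  have p34: "top_term n' (p3 * p4) (l3 * l4)" using top_term_mult[OF t3(1) t4(1)] by (simp add: n'_def ls)
  have s34: "top_term n' (?x * (p3 * q4 + p4 * q3)) (l3 * s4 + l4 * s3)"
    using top_term_add[OF top_term_mult[OF t3(1) t4(3)] top_term_mult[OF t4(1) t3(3), unfolded add.commute[of "degree p4"]]]
    by (simp only: n'_def ls distrib_left mult.left_commute[of p3 ?x] mult.left_commute[of p4 ?x])
  have ss34: "top_term n' (?x * (?x * (q3 * q4))) (s3 * s4)"
    using top_term_mult[OF t3(3) t4(3)] by (simp only: n'_def ls mult_ac)
  have nz: "l1 \<noteq> 0" "l2 \<noteq> 0" "l3 \<noteq> 0" "l4 \<noteq> 0" using t1(4) t2(4) t3(4) t4(4) by (simp_all add: ls)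
  have dB: "degree B = 2 * n"
    using tB nz by (intro antisym le_degree) (auto simp: top_term_def)
  have "degree (p3 * p4) = n'" using x_map_nonzero[OF 3] x_map_nonzero[OF 4] by (simp add: n'_def degree_mult_eq)
  then have n: "n' = 2 * n" using c(1,3) dB by simp
  have e1: "l3 * l4 = c * (l1 * l2) ^ 2"
    using p34 top_term_smult[OF tB, of c] unfolding c(3) n by (rule top_term_unique)
  have e2: "l3 * s4 + l4 * s3 = c * (2 * ((l1 * s2 + l2 * s1) * (l1 * l2)))"
    using s34 top_term_smult[OF tA, of c] unfolding c(2) n mult_smult_right by (rule top_term_unique)
  have e3: "s3 * s4 = c * ((l1 * s2 - l2 * s1) * (l1 * s2 - l2 * s1))"
    using ss34 top_term_smult[OF tC, of c] unfolding c(4) n mult_smult_right by (rule top_term_unique)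
  show "endo_degree (endo_add f g) + endo_degree (endo_add f (endo_neg g)) = 2 * endo_degree f + 2 * endo_degree g"
    using n unfolding n'_def n_def t1(6) t2(6) t3(6) t4(6) by simp
  define u1 where "u1 = s1 / l1" define u2 where "u2 = s2 / l2"
  define u3 where "u3 = s3 / l3" define u4 where "u4 = s4 / l4"
  have s: "s1 = u1 * l1" "s2 = u2 * l2" "s3 = u3 * l3" "s4 = u4 * l4"
    using nz by (simp_all add: u1_def u2_def u3_def u4_def)
  have cl: "c * (l1 * l2) ^ 2 \<noteq> 0" using c nz by simp
  have "(u3 + u4) * (c * (l1 * l2) ^ 2) = (2 * u1 + 2 * u2) * (c * (l1 * l2) ^ 2)"
    using e1 e2 unfolding s by Groebner_Basis.algebra
  then show "endo_slope (endo_add f g) + endo_slope (endo_add f (endo_neg g)) = 2 * endo_slope f + 2 * endo_slope g"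
    unfolding t1(5) t2(5) t3(5) t4(5) ls u1_def[symmetric] u2_def[symmetric] u3_def[symmetric] u4_def[symmetric]
    using cl mult_right_cancel by blast
  have "(u3 * u4) * (c * (l1 * l2) ^ 2) = (u1 - u2) ^ 2 * (c * (l1 * l2) ^ 2)"
    using e1 e3 unfolding s by Groebner_Basis.algebra
  then show "endo_slope (endo_add f g) * endo_slope (endo_add f (endo_neg g)) = (endo_slope f - endo_slope g) ^ 2"
    unfolding t1(5) t2(5) t3(5) t4(5) ls u1_def[symmetric] u2_def[symmetric] u3_def[symmetric] u4_def[symmetric]
    using cl mult_right_cancel by blast
qed

end

section \<open>Multiplicativity of degree and slope\<close>

text \<open>The form of degree \<open>n\<close> belonging to \<open>p\<close>, evaluated at
  \<open>(u : v)\<close>.\<close>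

definition homogenized :: "nat \<Rightarrow> 'a::field poly \<Rightarrow> 'a poly \<Rightarrow> 'a poly \<Rightarrow> 'a poly" where
  "homogenized n p u v = (\<Sum>i\<le>n. smult (coeff p i) (u ^ i * v ^ (n - i)))"

lemma poly_homogenized:
  assumes "degree p \<le> n"
  shows "poly v x \<noteq> 0 \<Longrightarrow> poly (homogenized n p u v) x = poly v x ^ n * poly p (poly u x / poly v x)"
    "poly v x = 0 \<Longrightarrow> poly (homogenized n p u v) x = coeff p n * poly u x ^ n"
proof -
  have e: "poly (homogenized n p u v) x = (\<Sum>i\<le>n. coeff p i * (poly u x ^ i * poly v x ^ (n - i)))"
    by (simp add: homogenized_def poly_sum)
  {
    assume v: "poly v x \<noteq> 0"
    have p: "poly p y = (\<Sum>i\<le>n. coeff p i * y ^ i)" for y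
      unfolding poly_altdef using assms
      by (intro sum.mono_neutral_left) (auto simp: coeff_eq_0)
    have "poly u x ^ i * poly v x ^ (n - i) = poly v x ^ n * (poly u x / poly v x) ^ i" if "i \<le> n" for i
      using v that by (simp add: power_divide power_diff field_simps)
    then show "poly (homogenized n p u v) x = poly v x ^ n * poly p (poly u x / poly v x)"
      unfolding e p sum_distrib_left by (intro sum.cong refl) simp
  next
    assume "poly v x = 0"
    then have "poly (homogenized n p u v) x = (\<Sum>i\<le>n. if i = n then coeff p n * poly u x ^ n else 0)"
      unfolding e by (intro sum.cong refl) (auto simp: power_0_left)
    then show "poly (homogenized n p u v) x = coeff p n * poly u x ^ n" by simp
  }
qed

context elliptic
begin

lemma x_mapD:
  assumes "x_map f p q"
  shows "poly p x \<noteq> 0 \<or> poly q x \<noteq> 0" "degree (pCons 0 q) \<le> degree p"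
    "\<forall>\<^sub>F Q in cofin. xnum (f Q) * poly q (xc Q) = hz (f Q) * poly p (xc Q)" "p \<noteq> 0"
  using assms x_map_nonzero[OF assms] unfolding x_map_def by blast+

text \<open>Every point is a difference of two points at which \<open>f\<close> vanishes.\<close>

lemma endo_zero_if_cofin:
  assumes f: "f \<in> Endo" and z: "\<forall>\<^sub>F Q in cofin. f Q = Infinity"
  shows "f = endo_zero"
proof -
  have "f P = Infinity" if P: "P \<in> points E" for P
  proof -
    from cofin_ex[OF eventually_conj[OF z cofin_translate[OF P z]]] obtain T where
      "T \<in> points E" "f T = Infinity" "f (P \<boxplus> T) = Infinity" by blast
    then show ?thesis using endomorphismsD(4)[OF f P] by simp
  qed
  then show ?thesis using endomorphismsD(1)[OF f] by (intro extensionalityI) auto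
qed

lemma x_map_zero: "x_map endo_zero 1 0"
proof -
  have "\<forall>\<^sub>F Q in cofin. xnum (endo_zero Q) * poly 0 (xc Q) = hz (endo_zero Q) * poly 1 (xc Q)"
    using cofin_points by eventually_elim simp
  then show ?thesis by (simp add: x_map_def)
qed

lemma endo_zero_if_x_map:
  assumes "f \<in> Endo" "x_map f p 0"
  shows "f = endo_zero"
proof (rule endo_zero_if_cofin[OF assms(1)])
  show "\<forall>\<^sub>F Q in cofin. f Q = Infinity"
    using x_mapD(3)[OF assms(2)] cofin_xc_poly[OF x_mapD(4)[OF assms(2)]]
  proof eventually_elim
    case (elim Q)
    then show ?case by (cases "f Q") auto
  qed
qed

lemma endo_degree_zero: "endo_degree endo_zero = 0" "endo_slope endo_zero = 0"
  using endo_degree_slope[OF x_map_zero] by simp_all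

lemma endo_degree_one: "endo_degree endo_one = 1" "endo_slope endo_one = 1"
proof -
  have "\<forall>\<^sub>F Q in cofin. xnum (endo_one Q) * poly 1 (xc Q) = hz (endo_one Q) * poly [:0, 1:] (xc Q)"
    using cofin_points cofin_neq[of Infinity]
  proof eventually_elim
    case (elim Q)
    then show ?case by (cases Q) auto
  qed
  then have "x_map endo_one [:0, 1:] 1" by (simp add: x_map_def one_pCons)
  from endo_degree_slope[OF this] show "endo_degree endo_one = 1" "endo_slope endo_one = 1"
    by (simp_all add: one_pCons)
qed

lemma endo_degree_nonneg: "endo_degree f \<ge> 0"
  by (simp add: endo_degree_def)

lemma endo_degree_eq_0:
  assumes f: "f \<in> Endo" and 0: "endo_degree f = 0"
  shows "f = endo_zero"
proof -
  obtain p q where x: "x_map f p q" using x_map_exists[OF f] by blast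
  then have "degree p = 0" using 0 endo_degree_slope(1)[OF x] by simp
  then have "q = 0" using x_mapD(2)[OF x] by (simp split: if_splits)
  then show ?thesis using endo_zero_if_x_map[OF f] x by simp
qed

text \<open>A nonzero endomorphism has finite fibres, because \<open>p - s q\<close> is a nonzero polynomial for
  every \<open>s\<close>.\<close>

lemma cofin_pullback:
  assumes g: "g \<in> Endo" and x: "x_map g p q" and q: "q \<noteq> 0" and A: "\<forall>\<^sub>F Q in cofin. A Q"
  shows "\<forall>\<^sub>F Q in cofin. A (g Q)"
proof -
  have fin: "finite {R \<in> points E. \<not> A R}" using A by (simp add: eventually_cofin)
  have dpq: "degree q < degree p" using x_mapD(2)[OF x] q by simp
  have "\<forall>\<^sub>F Q in cofin. g Q \<noteq> R" for R
  proof (cases R)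
    case Infinity
    show ?thesis using x_mapD(3)[OF x] cofin_xc_poly[OF q]
      by eventually_elim (auto simp: Infinity)
  next
    case (Affine u v)
    have "p - smult u q \<noteq> 0"
    proof
      assume "p - smult u q = 0"
      then have "degree p \<le> degree q" using degree_smult_le[of u q] by simp
      then show False using dpq by simp
    qed
    from x_mapD(3)[OF x] cofin_xc_poly[OF this] show ?thesis
      by eventually_elim (auto simp: Affine)
  qed
  then have "\<forall>\<^sub>F Q in cofin. \<forall>R\<in>{R \<in> points E. \<not> A R}. g Q \<noteq> R"
    by (intro eventually_ball_finite[OF fin] ballI)
  then show ?thesis using cofin_points
  proof eventually_elim
    case (elim Q)
    have "g Q \<in> points E" by (rule endomorphismsD(5)[OF g elim(2)])
    then show ?case using elim(1) by blast
  qed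
qed

text \<open>Homogenize \<open>p\<close> and \<open>q\<close> and substitute \<open>(u : v)\<close>: the result
  has no common zeros because neither pair has one, so no cancellation occurs and the degree is the product. At
  infinity only the terms of highest order in \<open>u\<close> survive.\<close>

lemma endo_degree_compose:
  assumes f: "f \<in> Endo" and g: "g \<in> Endo"
  shows "endo_degree (compose (points E) f g) = endo_degree f * endo_degree g"
    "endo_slope (compose (points E) f g) = endo_slope f * endo_slope g"
proof -
  obtain p q where 1: "x_map f p q" using x_map_exists[OF f] by blast
  obtain u v where 2: "x_map g u v" using x_map_exists[OF g] by blast
  have "endo_degree (compose (points E) f g) = endo_degree f * endo_degree g \<and>
    endo_slope (compose (points E) f g) = endo_slope f * endo_slope g"
  proof (cases "v = 0")
    case True
    then have "g = endo_zero" using endo_zero_if_x_map[OF g] 2 by simp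
    then have "compose (points E) f g = endo_zero"
      using hom_Infinity[OF f] by (auto simp: compose_def restrict_def)
    then show ?thesis using \<open>g = endo_zero\<close> endo_degree_zero by simp
  next
    case False
    define n where "n = degree p"
    define m where "m = degree u"
    define S where "S = homogenized n p u v"
    define T where "T = homogenized n q u v"
    note t1 = x_map_top_terms[OF 1, folded n_def] and t2 = x_map_top_terms[OF 2, folded m_def]
    define l where "l = coeff p n" define l' where "l' = coeff u m"
    define s where "s = coeff (pCons 0 q) n" define s' where "s' = coeff (pCons 0 v) m"
    note ls = l_def[symmetric] l'_def[symmetric] s_def[symmetric] s'_def[symmetric]
    have nz: "l \<noteq> 0" "l' \<noteq> 0" using t1(4) t2(4) by (simp_all add: ls)
    have dp: "degree p \<le> n" by (simp add: n_def)
    have dq: "degree q \<le> n" and cq: "coeff q n = 0" using t1(2) by (auto simp: top_term_def)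
    have tm: "top_term (n * m) (u ^ i * v ^ (n - i)) (l' ^ i * 0 ^ (n - i))" if "i \<le> n" for i
    proof -
      have "i * m + (n - i) * m = n * m" using that by (simp flip: add_mult_distrib)
      then show ?thesis
        using top_term_mult[OF top_term_power[OF t2(1), of i] top_term_power[OF t2(2), of "n - i"]]
        by (simp add: ls)
    qed
    have "top_term (n * m) S (\<Sum>i\<le>n. coeff p i * (l' ^ i * 0 ^ (n - i)))"
      unfolding S_def homogenized_def by (intro top_term_sum top_term_smult tm) simp
    moreover have "(\<Sum>i\<le>n. coeff p i * (l' ^ i * 0 ^ (n - i))) = (\<Sum>i\<le>n. if i = n then l * l' ^ n else 0)"
      by (intro sum.cong refl) (auto simp: power_0_left l_def)
    ultimately have tS: "top_term (n * m) S (l * l' ^ n)" by simp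
    have xterm: "top_term (n * m) ([:0, 1:] * (u ^ i * v ^ (n - i))) (l' ^ i * (s' * 0 ^ (n - Suc i)))" if "i < n" for i
    proof -
      have k: "n - i = Suc (n - Suc i)" using that by simp
      have "i * m + (m + (n - Suc i) * m) = n * m"
        using that by (simp flip: add_mult_distrib mult_Suc)
      moreover have "[:0, 1:] * (u ^ i * v ^ (n - i)) = u ^ i * (([:0, 1:] * v) * v ^ (n - Suc i))"
        unfolding k power_Suc by (simp only: mult_ac)
      ultimately show ?thesis
        using top_term_mult[OF top_term_power[OF t2(1), of i] top_term_mult[OF t2(3) top_term_power[OF t2(2), of "n - Suc i"]]]
        by (simp only: ls mult_zero_right power_0_left)
    qed
    have tT: "top_term (n * m) ([:0, 1:] * T) (\<Sum>i<n. coeff q i * (l' ^ i * (s' * 0 ^ (n - Suc i))))"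
    proof -
      have "[:0, 1:] * T = (\<Sum>i\<le>n. smult (coeff q i) ([:0, 1:] * (u ^ i * v ^ (n - i))))"
        unfolding T_def homogenized_def sum_distrib_left mult_smult_right ..
      also have "\<dots> = (\<Sum>i<n. smult (coeff q i) ([:0, 1:] * (u ^ i * v ^ (n - i))))"
        using cq by (intro sum.mono_neutral_right) (auto simp: not_less le_less)
      finally show ?thesis by (simp only:) (intro top_term_sum top_term_smult xterm, simp)
    qed
    have c: "(\<Sum>i<n. coeff q i * (l' ^ i * (s' * 0 ^ (n - Suc i)))) * l' = s * s' * l' ^ n"
    proof (cases n)
      case 0
      then show ?thesis by (simp add: s_def)
    next
      case (Suc k)
      have "(\<Sum>i<n. coeff q i * (l' ^ i * (s' * 0 ^ (n - Suc i)))) = (\<Sum>i<n. if i = k then coeff q k * (l' ^ k * s') else 0)"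
        using Suc by (intro sum.cong refl) (auto simp: power_0_left)
      then show ?thesis using Suc by (simp add: s_def)
    qed
    have "degree S = n * m" using tS nz by (intro antisym le_degree) (auto simp: top_term_def)
    have "x_map (compose (points E) f g) S T"
      unfolding x_map_def
    proof (intro conjI allI)
      show "degree (pCons 0 T) \<le> degree S" using tT \<open>degree S = n * m\<close> by (simp add: top_term_def)
      show "poly S x \<noteq> 0 \<or> poly T x \<noteq> 0" for x
      proof (cases "poly v x = 0")
        case True
        then have "poly u x \<noteq> 0" using x_mapD(1)[OF 2] by blast
        then show ?thesis using poly_homogenized(2)[OF dp True] nz by (simp add: S_def l_def)
      next
        case False
        then show ?thesis using poly_homogenized(1)[OF dp False] poly_homogenized(1)[OF dq False]
            x_mapD(1)[OF 1, of "poly u x / poly v x"] by (simp add: S_def T_def)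
      qed
      show "\<forall>\<^sub>F Q in cofin. xnum (compose (points E) f g Q) * poly T (xc Q) = hz (compose (points E) f g Q) * poly S (xc Q)"
        using cofin_pullback[OF g 2 False x_mapD(3)[OF 1]] x_mapD(3)[OF 2] cofin_xc_poly[OF False] cofin_points
      proof eventually_elim
        case (elim Q)
        obtain x y where gQ: "g Q = Affine x y" using elim by (cases "g Q") auto
        have x: "x = poly u (xc Q) / poly v (xc Q)" using elim gQ by (simp add: field_simps)
        have v: "poly v (xc Q) \<noteq> 0" using elim by simp
        show ?case using elim(1,4) unfolding S_def T_def poly_homogenized(1)[OF dp v] poly_homogenized(1)[OF dq v]
          by (simp add: compose_eq gQ x[symmetric])
      qed
    qed
    from endo_degree_slope[OF this] have
      "endo_degree (compose (points E) f g) = int (n * m)"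
      "endo_slope (compose (points E) f g) = coeff ([:0, 1:] * T) (n * m) / coeff S (n * m)"
      using \<open>degree S = n * m\<close> by simp_all
    moreover have "coeff ([:0, 1:] * T) (n * m) / coeff S (n * m) = (s / l) * (s' / l')"
    proof -
      have "coeff ([:0, 1:] * T) (n * m) = s * s' * l' ^ n / l'"
        using c tT nz by (simp add: top_term_def field_simps)
      moreover have "coeff S (n * m) = l * l' ^ n" using tS by (simp add: top_term_def)
      ultimately show ?thesis using nz by (simp add: field_simps)
    qed
    ultimately show ?thesis using t1(5,6) t2(5,6) by (simp add: ls)
  qed
  then show "endo_degree (compose (points E) f g) = endo_degree f * endo_degree g"
    "endo_slope (compose (points E) f g) = endo_slope f * endo_slope g" by auto
qed

end

section \<open>Rings with a norm and a slope\<close>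

text \<open>The properties of the degree \<open>N\<close> and the slope \<open>e\<close> that determine the
  endomorphism ring. The axioms for \<open>e\<close> are those satisfied by the square of a ring homomorphism to
  the field.\<close>

locale normed_ring = ring R for R (structure) +
  fixes N :: "'a \<Rightarrow> int" and e :: "'a \<Rightarrow> 'k::field_char_0"
  assumes N_nonneg: "N x \<ge> 0"
    and N_eq_0: "x \<in> carrier R \<Longrightarrow> N x = 0 \<Longrightarrow> x = \<zero>"
    and N_one: "N \<one> = 1"
    and N_mult: "x \<in> carrier R \<Longrightarrow> y \<in> carrier R \<Longrightarrow> N (x \<otimes> y) = N x * N y"
    and N_sum: "x \<in> carrier R \<Longrightarrow> y \<in> carrier R \<Longrightarrow> N (x \<oplus> y) + N (x \<ominus> y) = 2 * N x + 2 * N y"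
    and e_zero: "e \<zero> = 0" and e_one: "e \<one> = 1"
    and e_mult: "x \<in> carrier R \<Longrightarrow> y \<in> carrier R \<Longrightarrow> e (x \<otimes> y) = e x * e y"
    and e_sum: "x \<in> carrier R \<Longrightarrow> y \<in> carrier R \<Longrightarrow> e (x \<oplus> y) + e (x \<ominus> y) = 2 * e x + 2 * e y"
    and e_prod: "x \<in> carrier R \<Longrightarrow> y \<in> carrier R \<Longrightarrow> e (x \<oplus> y) * e (x \<ominus> y) = (e x - e y) ^ 2"
begin

text \<open>The polar form of \<open>N\<close>. In particular \<open>B x \<one>\<close> is the trace of
  \<open>x\<close>.\<close>

definition B :: "'a \<Rightarrow> 'a \<Rightarrow> int" where "B x y = N (x \<oplus> y) - N x - N y"

lemma N_add: "N (x \<oplus> y) = N x + N y + B x y" by (simp add: B_def)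

lemma N_zero [simp]: "N \<zero> = 0"
  using N_sum[of \<zero> \<zero>] by (simp add: minus_eq)

lemma N_minus [simp]: "x \<in> carrier R \<Longrightarrow> N (\<ominus> x) = N x"
  using N_sum[of \<zero> x] by (simp add: minus_eq)

lemma B_sym: "x \<in> carrier R \<Longrightarrow> y \<in> carrier R \<Longrightarrow> B x y = B y x"
  by (simp add: B_def a_comm)

text \<open>Additivity of the polar form follows from the parallelogram law (Jordan and von Neumann).\<close>

lemma B_add:
  assumes x: "x \<in> carrier R" and y: "y \<in> carrier R" and z: "z \<in> carrier R"
  shows "B (x \<oplus> y) z = B x z + B y z"
proof -
  have 1: "N (x \<oplus> z \<oplus> y) + N (x \<oplus> z \<ominus> y) = 2 * N (x \<oplus> z) + 2 * N y" using N_sum x y z by simp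
  have 2: "N (x \<oplus> (z \<ominus> y)) + N (x \<ominus> (z \<ominus> y)) = 2 * N x + 2 * N (z \<ominus> y)" using N_sum x y z by simp
  have 3: "N (x \<oplus> y \<oplus> z) + N (x \<oplus> y \<ominus> z) = 2 * N (x \<oplus> y) + 2 * N z" using N_sum x y z by simp
  have 4: "N (z \<oplus> y) + N (z \<ominus> y) = 2 * N z + 2 * N y" using N_sum y z by simp
  have e1: "x \<oplus> z \<oplus> y = x \<oplus> y \<oplus> z" using x y z by (simp add: a_ac)
  have e2: "x \<oplus> (z \<ominus> y) = x \<oplus> z \<ominus> y" using x y z by (simp add: minus_eq a_ac)
  have e3: "x \<ominus> (z \<ominus> y) = x \<oplus> y \<ominus> z" using x y z by (simp add: minus_eq minus_add a_ac)
  have e4: "z \<oplus> y = y \<oplus> z" using y z by (simp add: a_comm)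
  show ?thesis using 1 2 3 4 unfolding e1 e2 e3 e4 B_def by linarith
qed

lemma B_add_right:
  "x \<in> carrier R \<Longrightarrow> y \<in> carrier R \<Longrightarrow> z \<in> carrier R \<Longrightarrow> B z (x \<oplus> y) = B z x + B z y"
  using B_add[of x y z] B_sym[of z] by simp

lemma B_minus: "x \<in> carrier R \<Longrightarrow> y \<in> carrier R \<Longrightarrow> B (\<ominus> x) y = - B x y"
  using B_add[of x "\<ominus> x" y] by (simp add: r_neg B_def)

lemma B_minus_right: "x \<in> carrier R \<Longrightarrow> y \<in> carrier R \<Longrightarrow> B y (\<ominus> x) = - B y x"
  using B_minus[of x y] B_sym[of y] by simp

lemma B_self: "x \<in> carrier R \<Longrightarrow> B x x = 2 * N x"
  using N_sum[of x x] by (simp add: B_def minus_eq r_neg)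

abbreviation int_mult :: "int \<Rightarrow> 'a \<Rightarrow> 'a" where "int_mult k x \<equiv> add_pow R k x"

lemma int_mult_closed [simp]: "x \<in> carrier R \<Longrightarrow> int_mult k x \<in> carrier R"
  by simp

lemma int_mult_add: "x \<in> carrier R \<Longrightarrow> int_mult (i + j) x = int_mult i x \<oplus> int_mult j x"
  using add.int_pow_mult[of x i j] by simp

lemma int_mult_simps: "x \<in> carrier R \<Longrightarrow> int_mult 0 x = \<zero>" "x \<in> carrier R \<Longrightarrow> int_mult 1 x = x"
  "x \<in> carrier R \<Longrightarrow> int_mult (- k) x = \<ominus> (int_mult k x)"
  using add.int_pow_neg[of x k] by (auto simp: a_inv_def add_pow_def int_pow_def nat_pow_def)

lemma B_int_mult:
  assumes x: "x \<in> carrier R" and y: "y \<in> carrier R"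
  shows "B (int_mult k x) y = k * B x y"
proof -
  have B0: "B \<zero> y = 0" using y by (simp add: B_def)
  have n: "B (int_mult (int n) x) y = int n * B x y" for n
  proof (induction n)
    case 0
    show ?case using int_mult_simps(1)[OF x] B0 by simp
  next
    case (Suc n)
    have "int_mult (int (Suc n)) x = int_mult (int n) x \<oplus> x" using int_mult_add[OF x, of "int n" 1] int_mult_simps(2)[OF x] by (simp add: add.commute)
    then show ?case using Suc B_add[of "int_mult (int n) x" x y] x y by (simp add: algebra_simps)
  qed
  show ?thesis
  proof (cases "k \<ge> 0")
    case True
    then show ?thesis using n[of "nat k"] by simp
  next
    case False
    then have "int_mult k x = \<ominus> (int_mult (int (nat (- k))) x)" using int_mult_simps(3)[OF x, of "- k"] by simp
    then show ?thesis using n[of "nat (- k)"] B_minus[of "int_mult (int (nat (- k))) x" y] x y False by simp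
  qed
qed

lemma B_int_mult_right: "x \<in> carrier R \<Longrightarrow> y \<in> carrier R \<Longrightarrow> B y (int_mult k x) = k * B y x"
  using B_int_mult[of x y k] B_sym[of y] by simp

lemma N_int_mult: "x \<in> carrier R \<Longrightarrow> N (int_mult k x) = k ^ 2 * N x"
proof -
  assume x: "x \<in> carrier R"
  have "2 * N (int_mult k x) = B (int_mult k x) (int_mult k x)" using B_self[of "int_mult k x"] x by simp
  also have "\<dots> = k * B x (int_mult k x)" by (rule B_int_mult) (use x in simp_all)
  also have "B x (int_mult k x) = k * B x x" by (rule B_int_mult_right) (use x in simp_all)
  also have "B x x = 2 * N x" using x by (rule B_self)
  finally show ?thesis by (simp add: power2_eq_square)
qed

lemmas B_simps = B_add B_add_right B_minus B_minus_right B_int_mult B_int_mult_right B_self N_int_mult N_add N_one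

lemma e_minus [simp]: "x \<in> carrier R \<Longrightarrow> e (\<ominus> x) = e x"
  using e_sum[of \<zero> x] by (simp add: e_zero minus_eq)

lemma e_int_mult_one: "e (int_mult k \<one>) = of_int k ^ 2"
proof -
  have n: "e (int_mult (int n) \<one>) = of_nat n ^ 2" for n
  proof (induction n rule: less_induct)
    case (less n)
    show ?case
    proof (cases "n \<le> 1")
      case True
      then have "n = 0 \<or> n = 1" by auto
      then show ?thesis using int_mult_simps(1,2)[OF one_closed] by (auto simp: e_zero e_one)
    next
      case False
      then obtain m where m: "n = Suc (Suc m)" by (metis Suc_diff_Suc not_less_eq_eq One_nat_def less_Suc_eq_le Suc_le_D)
      let ?y = "int_mult (int (Suc m)) \<one>"
      have 1: "?y \<oplus> \<one> = int_mult (int n) \<one>"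
        using int_mult_add[OF one_closed, of "int (Suc m)" 1] int_mult_simps(2)[OF one_closed] m by (simp add: add.commute)
      have 2: "?y \<ominus> \<one> = int_mult (int m) \<one>"
        using int_mult_add[OF one_closed, of "int (Suc m)" "-1"] int_mult_simps(2)[OF one_closed] int_mult_simps(3)[OF one_closed, of 1] by (simp add: minus_eq)
      have "e (int_mult (int n) \<one>) + e (int_mult (int m) \<one>) = 2 * e ?y + 2"
        using e_sum[of ?y \<one>] unfolding 1 2 by (simp add: e_one)
      then have "e (int_mult (int n) \<one>) = 2 * (of_nat (Suc m)) ^ 2 + 2 - of_nat m ^ 2"
        using less[of m] less[of "Suc m"] m by (simp add: algebra_simps)
      also have "\<dots> = of_nat n ^ 2" unfolding m by (simp add: power2_eq_square algebra_simps)
      finally show ?thesis .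
    qed
  qed
  show ?thesis
  proof (cases "k \<ge> 0")
    case True
    then show ?thesis using n[of "nat k"] by simp
  next
    case False
    then have "int_mult k \<one> = \<ominus> (int_mult (int (nat (- k))) \<one>)" using int_mult_simps(3)[OF one_closed, of "- k"] by simp
    then show ?thesis using n[of "nat (- k)"] False by simp
  qed
qed

text \<open>Instead of using conjugates, one computes the norm of \<open>x\<^sup>2 - t x + n\<close>, where
  \<open>t\<close> is the trace and \<open>n\<close> the norm of \<open>x\<close>. The products
  \<open>B x\<^sup>2 x\<close> and \<open>B x\<^sup>2 1\<close> that occur follow from the norms of
  \<open>x (x + 1)\<close> and \<open>(x + 1) (x - 1)\<close>, and the result is zero.\<close>

lemma characteristic_equation:
  assumes x: "x \<in> carrier R"
  shows "x \<otimes> x \<oplus> (int_mult (- B x \<one>) x \<oplus> int_mult (N x) \<one>) = \<zero>"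
proof (rule N_eq_0)
  define t where "t = B x \<one>"
  define n where "n = N x"
  have xx: "x \<otimes> x \<in> carrier R" using x by simp
  have "N (x \<otimes> (x \<oplus> \<one>)) = n * (n + 1 + t)"
    using x by (simp add: N_mult N_add N_one n_def t_def)
  moreover have "x \<otimes> (x \<oplus> \<one>) = x \<otimes> x \<oplus> x" using x by (simp add: r_distr)
  ultimately have 1: "B (x \<otimes> x) x = n * t"
    using x by (simp add: N_add N_mult n_def algebra_simps)
  (* This gives the trace of the square of x. *)
  have "N ((x \<oplus> \<one>) \<otimes> (x \<oplus> \<ominus> \<one>)) = (n + 1 + t) * (n + 1 - t)"
    using x by (simp add: N_mult N_add N_one n_def t_def B_minus_right)
  moreover have "(x \<oplus> \<one>) \<otimes> (x \<oplus> \<ominus> \<one>) = x \<otimes> x \<oplus> \<ominus> \<one>"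
    using x by (simp add: l_distr r_distr r_minus minus_add a_ac r_neg r_neg1 r_neg2)
  ultimately have 2: "B (x \<otimes> x) \<one> = t * t - 2 * n"
    using x by (simp add: N_add N_mult N_one n_def B_minus_right algebra_simps)
  show "N (x \<otimes> x \<oplus> (int_mult (- B x \<one>) x \<oplus> int_mult (N x) \<one>)) = 0"
  proof -
    have "N (x \<otimes> x \<oplus> (int_mult (- t) x \<oplus> int_mult n \<one>)) =
        2 * n ^ 2 + t * t * n - t * B (x \<otimes> x) x + n * B (x \<otimes> x) \<one> - t * n * t"
      using x by (simp add: B_simps N_mult n_def[symmetric] t_def[symmetric] power2_eq_square algebra_simps)
    then show ?thesis unfolding 1 2 t_def[symmetric] n_def[symmetric]
      by (simp add: power2_eq_square algebra_simps)
  qed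
qed (use x in simp)

text \<open>From \<open>x\<^sup>2 = - n\<close> one gets \<open>e(x)\<^sup>2 = n\<^sup>2\<close>, and from
  \<open>(1 + x) (1 - x) = 1 + n\<close> the relation \<open>(1 - e(x))\<^sup>2 = (1 + n)\<^sup>2\<close>.
  Together they decide the sign.\<close>

lemma e_trace_zero:
  assumes x: "x \<in> carrier R" and t: "B x \<one> = 0"
  shows "e x = - of_int (N x)"
proof -
  define n where "n = N x"
  have "x \<otimes> x \<oplus> int_mult n \<one> = \<zero>"
    using characteristic_equation[OF x] t x by (simp add: int_mult_simps n_def)
  then have sq: "x \<otimes> x = \<ominus> (int_mult n \<one>)" using x by (metis int_mult_closed minus_equality one_closed m_closed)
  have 1: "e x ^ 2 = of_int n ^ 2"
    using e_mult[OF x x] x by (simp add: sq e_int_mult_one power2_eq_square)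
  have "x \<otimes> (\<one> \<ominus> x) = x \<ominus> x \<otimes> x" using x by (simp add: r_distr r_minus minus_eq)
  then have "(\<one> \<oplus> x) \<otimes> (\<one> \<ominus> x) = (\<one> \<ominus> x) \<oplus> (x \<ominus> x \<otimes> x)"
    using x l_distr[of \<one> x "\<one> \<ominus> x"] by simp
  also have "\<dots> = \<one> \<ominus> x \<otimes> x"
    using x by (simp add: minus_eq a_assoc r_neg1)
  also have "\<dots> = int_mult (1 + n) \<one>" unfolding sq minus_eq using int_mult_add[OF one_closed, of 1 n] by (simp add: int_mult_simps)
  finally have "e (\<one> \<oplus> x) * e (\<one> \<ominus> x) = of_int (1 + n) ^ 2"
    using e_mult[of "\<one> \<oplus> x" "\<one> \<ominus> x"] x by (metis a_closed e_int_mult_one minus_closed one_closed)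
  then have "(1 - e x) ^ 2 = (1 + of_int n) ^ 2" using e_prod[of \<one> x] x by (simp add: e_one)
  then have "2 * (e x + of_int n) = 0" using 1 by Groebner_Basis.algebra
  then have "e x + of_int n = 0" unfolding mult_eq_0_iff by simp
  then show ?thesis by (simp add: n_def eq_neg_iff_add_eq_0)
qed

text \<open>The roots of \<open>T\<^sup>2 + 5 T + 9\<close> are the squares of the roots of
  \<open>T\<^sup>2 - t T + 3\<close> exactly when \<open>t\<^sup>2 - 6 = - 5\<close>. The proof applies the
  slope laws to \<open>2 x = w + t\<close>, where \<open>w = 2 x - t\<close> has trace zero and hence a known
  slope.\<close>

lemma trace_from_slope:
  assumes x: "x \<in> carrier R" and n: "N x = 3" and s: "e x ^ 2 + 5 * e x + 9 = 0"
  shows "B x \<one> = 1 \<or> B x \<one> = - 1"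
proof -
  define t where "t = B x \<one>"
  define w where "w = int_mult 2 x \<oplus> int_mult (- t) \<one>"
  have w: "w \<in> carrier R" using x by (simp add: w_def)
  have "N w = 12 - t ^ 2"
    using x n unfolding w_def by (simp add: B_simps t_def[symmetric] power2_eq_square)
  moreover have "B w \<one> = 0" using x unfolding w_def by (simp add: B_simps t_def[symmetric])
  ultimately have ew: "e w = of_int t ^ 2 - 12" using e_trace_zero[OF w] by simp
  have x2: "int_mult 2 x = x \<oplus> x" using int_mult_add[OF x, of 1 1] int_mult_simps(2)[OF x] by simp
  have "w \<oplus> int_mult t \<one> = int_mult 2 x" using x unfolding w_def by (simp add: int_mult_simps a_assoc l_neg)
  moreover have "e (int_mult 2 x) = 4 * e x"
    unfolding x2 using e_sum[OF x x] x by (simp add: minus_eq r_neg e_zero)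
  ultimately have 1: "e (w \<oplus> int_mult t \<one>) = 4 * e x" by simp
  define h where "h = e (w \<ominus> int_mult t \<one>)"
  have 2: "4 * e x + h = 2 * (of_int t ^ 2 - 12) + 2 * of_int t ^ 2"
    using e_sum[of w "int_mult t \<one>"] w 1 by (simp add: ew e_int_mult_one h_def)
  have 3: "4 * e x * h = 144" using e_prod[of w "int_mult t \<one>"] w 1 by (simp add: ew e_int_mult_one h_def)
  have "16 * ((of_int t ^ 2 - 1) * e x) = 0" using 2 3 s by Groebner_Basis.algebra
  moreover have "e x \<noteq> 0" using s by auto
  ultimately have "(of_int t :: 'k) ^ 2 = of_int 1" by simp
  then have "of_int (t ^ 2) = (of_int 1 :: 'k)" by simp
  then have "t ^ 2 = 1" by (simp only: of_int_eq_iff)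
  then show ?thesis by (simp add: t_def power2_eq_1_iff)
qed

text \<open>Division with remainder in the order of discriminant -11, in the orthogonal coordinates given by
  \<open>1\<close> and the root of -11.\<close>

lemma euclid_bound:
  fixes t g :: int
  shows "\<exists>c d. 11 * (t - 2 * c - d) ^ 2 + (g - 11 * d) ^ 2 < 44"
proof -
  define d where "d = (g + 5) div 11"
  have "\<bar>g - 11 * d\<bar> \<le> 5" unfolding d_def by linarith
  then have 1: "(g - 11 * d) ^ 2 \<le> 5 ^ 2" by (metis abs_le_square_iff abs_numeral)
  define c where "c = (t - d) div 2"
  have "\<bar>t - 2 * c - d\<bar> \<le> 1" unfolding c_def by linarith
  then have "(t - 2 * c - d) ^ 2 \<le> 1 ^ 2" by (metis abs_le_square_iff abs_one)
  then have "11 * (t - 2 * c - d) ^ 2 + (g - 11 * d) ^ 2 < 44" using 1 by simp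
  then show ?thesis by blast
qed

text \<open>The element \<open>z\<close> is 22 times the component of \<open>y\<close> orthogonal to
  \<open>1\<close> and \<open>w = 2 x - 1\<close>. Computing the slope of \<open>w z\<close> as that of a
  trace-zero element and as a product gives \<open>22 N z = 0\<close> in the field of characteristic zero. So
  \<open>44 N y\<close> is a weighted sum of the squares of the two remaining components, and subtracting a
  nearby element of \<open>\<int> + \<int> x\<close> leaves norm below 1.\<close>

theorem generated_by_root:
  assumes x: "x \<in> carrier R" and n: "N x = 3" and t: "B x \<one> = 1" and y: "y \<in> carrier R"
  shows "\<exists>c d. y = int_mult c \<one> \<oplus> int_mult d x"
proof -
  define w where "w = int_mult 2 x \<oplus> \<ominus> \<one>"
  have w: "w \<in> carrier R" using x by (simp add: w_def)
  have Nw: "N w = 11" using x n t unfolding w_def by (simp add: B_simps)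
  have Bw: "B w \<one> = 0" using x t unfolding w_def by (simp add: B_simps)
  define s where "s = B y \<one>"
  define g where "g = B y w"
  define z where "z = int_mult 22 y \<oplus> (int_mult (- 11 * s) \<one> \<oplus> int_mult (- g) w)"
  have z: "z \<in> carrier R" using w y by (simp add: z_def)
  have Bz: "B z \<one> = 0" using w y Bw unfolding z_def by (simp add: B_simps s_def)
  have Bzw: "B z w = 0" using w y Bw Nw B_sym[of \<one> w] unfolding z_def by (simp add: B_simps g_def)
  (* The bilinear form of the norm: w has trace zero, so w u is orthogonal to u. *)
  have wu: "B (w \<otimes> u) u = 0" if u: "u \<in> carrier R" for u
  proof -
    have "N ((w \<oplus> \<one>) \<otimes> u) = (N w + 1) * N u" using u w Bw by (simp add: N_mult N_add N_one)
    moreover have "(w \<oplus> \<one>) \<otimes> u = w \<otimes> u \<oplus> u" using u w by (simp add: l_distr)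
    ultimately show ?thesis using u w by (simp add: N_add N_mult algebra_simps)
  qed
  have "B (w \<otimes> (z \<oplus> \<one>)) (z \<oplus> \<one>) = 0" using wu z by simp
  moreover have "w \<otimes> (z \<oplus> \<one>) = w \<otimes> z \<oplus> w" using w z by (simp add: r_distr)
  ultimately have "B (w \<otimes> z) \<one> = 0"
    using wu[OF z] w z Bw Bzw B_sym[of w z] by (simp add: B_simps)
  then have "e (w \<otimes> z) = - of_int (11 * N z)" using e_trace_zero[of "w \<otimes> z"] w z Nw by (simp add: N_mult)
  moreover have "e (w \<otimes> z) = (- 11) * (- of_int (N z))"
    using e_mult[OF w z] e_trace_zero[OF w Bw] e_trace_zero[OF z Bz] Nw by simp
  ultimately have "of_int (22 * N z) = (of_int 0 :: 'k)" by simp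
  then have "22 * N z = 0" by (simp only: of_int_eq_iff)
  then have Nz: "N z = 0" by simp
  have "N z = 484 * N y - 121 * s ^ 2 - 11 * g ^ 2"
    using w y Bw Nw B_sym[of \<one> w] unfolding z_def
    by (simp add: B_simps g_def[symmetric] s_def[symmetric] power2_eq_square algebra_simps)
  then have Ny: "44 * N y = 11 * s ^ 2 + g ^ 2" using Nz by simp
  obtain c d where cd: "11 * (s - 2 * c - d) ^ 2 + (g - 11 * d) ^ 2 < 44" using euclid_bound by blast
  define v where "v = int_mult c \<one> \<oplus> int_mult d x"
  have v: "v \<in> carrier R" using x by (simp add: v_def)
  have g: "g = 2 * B y x - s" unfolding g_def w_def using x y by (simp add: B_simps s_def)
  have "N (y \<oplus> \<ominus> v) = N y + c ^ 2 + 3 * d ^ 2 - c * s - d * B y x + c * d"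
    using x y t n B_sym[of \<one> x] unfolding v_def
    by (simp add: B_simps s_def power2_eq_square algebra_simps)
  then have "44 * N (y \<oplus> \<ominus> v) = 44 * N y + 44 * c ^ 2 + 132 * d ^ 2 - 44 * c * s - 22 * d * (g + s) + 44 * c * d"
    using g by (simp add: algebra_simps)
  also have "\<dots> = 11 * (s - 2 * c - d) ^ 2 + (g - 11 * d) ^ 2"
    unfolding Ny by (simp add: power2_eq_square algebra_simps)
  finally have "N (y \<oplus> \<ominus> v) = 0" using cd N_nonneg[of "y \<oplus> \<ominus> v"] by linarith
  then have "y \<oplus> \<ominus> v = \<zero>" using N_eq_0 y v by simp
  then have "y = v" using y v by (metis minus_equality minus_minus a_inv_closed a_comm)
  then show ?thesis by (auto simp: v_def)
qed

end

section \<open>An isogeny of degree three\<close>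

text \<open>The point \<open>(x0, y0)\<close> is a flex with tangent slope \<open>lam\<close>, that is, a point
  of order 3; with \<open>z = x - x0\<close> the curve is
  \<open>y\<^sup>2 = z\<^sup>3 + (lam z + y0)\<^sup>2\<close>. The last two assumptions say that the quotient by
  this point, whose coefficients are on the left-hand sides, is a rescaling of the curve itself by
  \<open>c\<close>.\<close>

locale three_isogeny = elliptic E for E :: "'k::{alg_closed_field,field_char_0} weierstrass" +
  fixes x0 y0 lam c :: 'k
  assumes flex: "3 * x0 = lam ^ 2" "a + 3 * x0 ^ 2 = 2 * lam * y0" "y0 ^ 2 = x0 ^ 3 + a * x0 + b"
    and y0: "y0 \<noteq> 0" and c: "c \<noteq> 0"
    and twist: "a - 20 * lam * y0 = c ^ 4 * a" "b - 28 * y0 ^ 2 - 28 * x0 * lam * y0 = c ^ 6 * b"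
begin

text \<open>The \<open>x\<close>-coordinate of the image, up to the shift by \<open>x0\<close>, is the sum of
  the values of \<open>z\<close> at \<open>P\<close> and its two translates by the kernel, whence the pole of
  order 2 at \<open>z = 0\<close>. The factor in \<open>velu_y\<close> is the derivative of
  \<open>velu_x\<close>.\<close>

definition velu_x where "velu_x z = z + 4 * lam * y0 / z + 4 * y0 ^ 2 / z ^ 2"
definition velu_y where "velu_y z y = y * (1 - 4 * lam * y0 / z ^ 2 - 8 * y0 ^ 2 / z ^ 3)"

definition isog_x where "isog_x x = (velu_x (x - x0) + x0) / c ^ 2"
definition isog_y where "isog_y x y = velu_y (x - x0) y / c ^ 3"

fun isog :: "'k point \<Rightarrow> 'k point" where
  "isog Infinity = Infinity"
| "isog (Affine x y) = (if x = x0 then Infinity else Affine (isog_x x) (isog_y x y))"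

lemma shifted_cubic: "x ^ 3 + a * x + b = (x - x0) ^ 3 + (lam * (x - x0) + y0) ^ 2"
  using flex by Groebner_Basis.algebra

lemma velu_inverse:
  assumes "z * v = 1"
  shows "velu_x z = z + 4 * lam * y0 * v + 4 * y0 ^ 2 * v ^ 2"
    "velu_y z y = y * (1 - 4 * lam * y0 * v ^ 2 - 8 * y0 ^ 2 * v ^ 3)"
proof -
  have "z \<noteq> 0" using assms by auto
  then have v: "v = 1 / z" using assms by (simp add: field_simps)
  show "velu_x z = z + 4 * lam * y0 * v + 4 * y0 ^ 2 * v ^ 2"
    "velu_y z y = y * (1 - 4 * lam * y0 * v ^ 2 - 8 * y0 ^ 2 * v ^ 3)"
    by (simp_all add: velu_x_def velu_y_def v power_divide)
qed

lemma velu_on_curve: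
  assumes zv: "z * v = 1" and y: "y ^ 2 = z ^ 3 + (lam * z + y0) ^ 2"
  shows "velu_y z y ^ 2 = (velu_x z + x0) ^ 3 + c ^ 4 * a * (velu_x z + x0) + c ^ 6 * b"
proof -
  have "velu_y z y ^ 2 = y ^ 2 * (1 - 4 * lam * y0 * v ^ 2 - 8 * y0 ^ 2 * v ^ 3) ^ 2"
    unfolding velu_inverse[OF zv] by (simp add: power_mult_distrib)
  also have "\<dots> = velu_x z ^ 3 + lam ^ 2 * velu_x z ^ 2 - 18 * lam * y0 * velu_x z - 27 * y0 ^ 2
      - 16 * lam ^ 3 * y0"
    unfolding velu_inverse[OF zv] y using zv by Groebner_Basis.algebra
  also have "\<dots> = (velu_x z + x0) ^ 3 + (a - 20 * lam * y0) * (velu_x z + x0) + (b - 28 * y0 ^ 2 - 28 * x0 * lam * y0)"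
    using flex by Groebner_Basis.algebra
  finally show ?thesis unfolding twist by simp
qed

lemma isog_closed:
  assumes "P \<in> points E"
  shows "isog P \<in> points E"
proof (cases P)
  case (Affine x y)
  show ?thesis
  proof (cases "x = x0")
    case False
    have "(x - x0) * (1 / (x - x0)) = 1" using False by simp
    from velu_on_curve[OF this, of y] have *: "velu_y (x - x0) y ^ 2 = (velu_x (x - x0) + x0) ^ 3 +
        c ^ 4 * a * (velu_x (x - x0) + x0) + c ^ 6 * b"
      using assms Affine shifted_cubic by simp
    define r where "r = velu_x (x - x0) + x0"
    have "(velu_y (x - x0) y / c ^ 3) ^ 2 = (r / c ^ 2) ^ 3 + a * (r / c ^ 2) + b"
      using * c unfolding r_def[symmetric] by (simp add: power_divide field_simps flip: power_mult power_add)
    then show ?thesis using Affine False by (simp add: isog_x_def isog_y_def r_def)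
  qed (use Affine in simp)
qed simp

lemma isog_neg: "isog (neg_point P) = neg_point (isog P)"
  by (cases P) (auto simp: isog_y_def velu_y_def)

text \<open>Invariance under translation by the kernel. Let \<open>l\<close> be the slope of the chord and
  \<open>d = l - lam\<close>. With \<open>z = d p\<close> for the given point and \<open>z3 = d q\<close> for
  the translate, the equations become \<open>p + q = d + 2 lam\<close> and \<open>d p q = - 2 y0\<close>,
  symmetric in \<open>p\<close> and \<open>q\<close>, and the coordinates of the images become polynomials in
  \<open>d\<close>, \<open>p\<close>, \<open>q\<close>.\<close>

lemma isog_add_kernel:
  assumes Q: "Affine x y \<in> points E" and z0: "x \<noteq> x0" and z30: "xc (Affine x0 y0 \<boxplus> Affine x y) \<noteq> x0"
  shows "isog (Affine x0 y0 \<boxplus> Affine x y) = isog (Affine x y)"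
proof -
  define z where "z = x - x0"
  have z: "z \<noteq> 0" using z0 by (simp add: z_def)
  define l where "l = (y - y0) / (x - x0)"
  have y: "y = l * z + y0" using z by (simp add: l_def z_def)
  define z3 where "z3 = l ^ 2 - lam ^ 2 - z"
  have sum: "Affine x0 y0 \<boxplus> Affine x y = Affine (z3 + x0) (- (l * z3 + y0))"
  proof -
    have "l ^ 2 - x0 - x = z3 + x0" unfolding z3_def z_def flex(1)[symmetric] by simp
    moreover have "Affine x0 y0 \<boxplus> Affine x y = Affine (l ^ 2 - x0 - x) (l * (x0 - (l ^ 2 - x0 - x)) - y0)"
      using add_distinct[of x0 x y0 y] z0 unfolding Let_def l_def by simp
    ultimately show ?thesis by (simp add: algebra_simps)
  qed
  then have z3: "z3 \<noteq> 0" using z30 by simp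
  define d where "d = l - lam"
  have "y ^ 2 = z ^ 3 + (lam * z + y0) ^ 2" using Q shifted_cubic by (simp add: z_def)
  then have "z * (z ^ 2) = z * (d * ((d + 2 * lam) * z + 2 * y0))"
    unfolding y d_def by Groebner_Basis.algebra
  then have zz: "z ^ 2 = d * ((d + 2 * lam) * z + 2 * y0)" using z by simp
  have zz3: "z * z3 = - (2 * y0 * d)" using zz unfolding z3_def d_def by Groebner_Basis.algebra
  then have d: "d \<noteq> 0" using z z3 by auto
  define p where "p = z / d"
  define q where "q = z3 / d"
  have pq: "z = d * p" "z3 = d * q" using d by (simp_all add: p_def q_def)
  have "d * (p + q) = d * (d + 2 * lam)" using pq unfolding z3_def d_def by Groebner_Basis.algebra
  then have s: "p + q = d + 2 * lam" using d by simp
  have "d * (d * p * q) = d * (- 2 * y0)" using zz3 unfolding pq by Groebner_Basis.algebra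
  then have t: "d * p * q = - 2 * y0" using mult_left_cancel[OF d] by blast
  have nz: "p \<noteq> 0" "q \<noteq> 0" using pq z z3 by auto
  have v: "z * (1 / z) = 1" "z3 * (1 / z3) = 1" using z z3 by auto
  have i: "2 * y0 * (1 / z) = - q" "2 * y0 * (1 / z3) = - p"
    using t d nz unfolding pq by (simp_all add: field_simps)
  have fx: "velu_x z = z - 2 * lam * q + q ^ 2" "velu_x z3 = z3 - 2 * lam * p + p ^ 2"
    unfolding velu_inverse(1)[OF v(1)] velu_inverse(1)[OF v(2)] using i by Groebner_Basis.algebra+
  have "velu_x z = velu_x z3" unfolding fx unfolding pq using s by Groebner_Basis.algebra
  moreover have "velu_y z y = velu_y z3 (- (l * z3 + y0))"
  proof -
    have 1: "y0 * velu_y z y = y * (y0 - lam * q ^ 2 + q ^ 3)"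
      and 2: "y0 * velu_y z3 (- (l * z3 + y0)) = - (l * z3 + y0) * (y0 - lam * p ^ 2 + p ^ 3)"
      unfolding velu_inverse(2)[OF v(1)] velu_inverse(2)[OF v(2)] using i by Groebner_Basis.algebra+
    have e: "2 * y0 = - d * p * q" "2 * lam = p + q - d" "2 * l = p + q + d"
      using s t d_def by Groebner_Basis.algebra+
    have "8 * (y0 * velu_y z y) = 8 * (y0 * velu_y z3 (- (l * z3 + y0)))"
      unfolding 1 2 unfolding y pq using e by Groebner_Basis.algebra
    then have "8 * y0 * velu_y z y = 8 * y0 * velu_y z3 (- (l * z3 + y0))" by (simp only: mult.assoc)
    moreover have "8 * y0 \<noteq> 0" using y0 by simp
    ultimately show ?thesis using mult_left_cancel by blast
  qed
  ultimately show ?thesis unfolding sum using z z3 z0 by (simp add: isog_x_def isog_y_def z_def)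
qed

text \<open>Points on the line of slope \<open>l\<close> with ordinate \<open>m\<close> at \<open>z = 0\<close>
  go to points on a line of slope \<open>L\<close>: after multiplication by \<open>z\<^sup>3\<close> the
  difference of the two sides is divisible by the cubic whose roots are the intersections with the original
  line. The letters \<open>i\<close> and \<open>j\<close> stand for the inverses of \<open>m - y0\<close> and
  \<open>m + y0\<close>, which are nonzero when the line avoids the kernel.\<close>

lemma velu_line:
  assumes z: "z * v = 1" and r: "z ^ 3 + (lam * z + y0) ^ 2 = (l * z + m) ^ 2"
    and i: "(m - y0) * i = 1" and j: "(m + y0) * j = 1"
    and L: "L = (l - lam) * (m + y0) * i + (m - y0) * (l + lam) * j - l"
    and k: "k = 8 * y0 ^ 2 * m * i * j"
  shows "velu_y z (l * z + m) = L * velu_x z + (m - k + (l - L) * (l ^ 2 - lam ^ 2))"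
proof -
  have "(z * z * z) * (velu_y z (l * z + m)) = (z * z * z) * (L * velu_x z + (m - k + (l - L) * (l ^ 2 - lam ^ 2)))"
  proof -
    have x: "(z * z * z) * velu_x z = z * (z ^ 3 + 4 * lam * y0 * z + 4 * y0 ^ 2)"
      unfolding velu_inverse[OF z] using z by Groebner_Basis.algebra
    have y: "(z * z * z) * velu_y z (l * z + m) = (l * z + m) * (z ^ 3 - 4 * lam * y0 * z - 8 * y0 ^ 2)"
      unfolding velu_inverse[OF z] using z by Groebner_Basis.algebra
    have r': "z ^ 3 = (l ^ 2 - lam ^ 2) * z ^ 2 - (2 * lam * y0 - 2 * l * m) * z + (m ^ 2 - y0 ^ 2)"
      using r by Groebner_Basis.algebra
    define e1 where "e1 = l ^ 2 - lam ^ 2"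
    define e2 where "e2 = 2 * lam * y0 - 2 * l * m"
    define e3 where "e3 = m ^ 2 - y0 ^ 2"
    (* The coefficients of z^2, z and 1 in the quotient identity; the quotient is (l - L) z + k. *)
    have c2: "- 4 * lam * y0 * (l + L) = (l - L) * e2 - k * e1"
      unfolding L k e1_def e2_def using i j by Groebner_Basis.algebra
    have c1: "- (8 * y0 ^ 2 * l + 4 * lam * y0 * m + L * (4 * y0 ^ 2)) = k * e2 - (l - L) * e3"
      unfolding L k e2_def e3_def using i j by Groebner_Basis.algebra
    have c0: "- 8 * y0 ^ 2 * m = - k * e3"
      unfolding k e3_def using i j by Groebner_Basis.algebra
    have "(z * z * z) * velu_y z (l * z + m) - L * ((z * z * z) * velu_x z) - (m - k + (l - L) * e1) * z ^ 3
       = ((l - L) * z + k) * (z ^ 3 - e1 * z ^ 2 + e2 * z - e3)"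
      unfolding x y using c2 c1 c0 by Groebner_Basis.algebra
    moreover have "z ^ 3 - e1 * z ^ 2 + e2 * z - e3 = 0" using r' unfolding e1_def e2_def e3_def by simp
    ultimately have "(z * z * z) * velu_y z (l * z + m) - L * ((z * z * z) * velu_x z) - (m - k + (l - L) * e1) * z ^ 3 = 0"
      by simp
    then show ?thesis unfolding e1_def by Groebner_Basis.algebra
  qed
  moreover have "z * z * z \<noteq> 0" using z by auto
  ultimately show ?thesis using mult_left_cancel by blast
qed

text \<open>Vieta's relation for the image line, from the elementary symmetric functions of the inverses of
  \<open>z1\<close>, \<open>z2\<close>, \<open>z3\<close>, whose product is \<open>i j\<close>.\<close>

lemma velu_sum:
  assumes v: "z1 * v1 = 1" "z2 * v2 = 1" "z3 * v3 = 1"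
    and e: "z1 + z2 + z3 = l ^ 2 - lam ^ 2" "z1 * z2 + z1 * z3 + z2 * z3 = 2 * lam * y0 - 2 * l * m"
      "z1 * z2 * z3 = m ^ 2 - y0 ^ 2"
    and i: "(m - y0) * i = 1" and j: "(m + y0) * j = 1"
    and L: "L = (l - lam) * (m + y0) * i + (m - y0) * (l + lam) * j - l"
  shows "velu_x z1 + velu_x z2 + velu_x z3 + lam ^ 2 = L ^ 2"
proof -
  have ij: "(m ^ 2 - y0 ^ 2) * (i * j) = 1" using i j by Groebner_Basis.algebra
  have vvv: "v1 * v2 * v3 = i * j" using v e(3) ij by Groebner_Basis.algebra
  have s1: "v1 + v2 + v3 = (2 * lam * y0 - 2 * l * m) * (i * j)"
    unfolding e(2)[symmetric] vvv[symmetric] using v by Groebner_Basis.algebra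
  have s2: "v1 * v2 + v1 * v3 + v2 * v3 = (l ^ 2 - lam ^ 2) * (i * j)"
    unfolding e(1)[symmetric] vvv[symmetric] using v by Groebner_Basis.algebra
  have "velu_x z1 + velu_x z2 + velu_x z3 + lam ^ 2 = (z1 + z2 + z3) + 4 * lam * y0 * (v1 + v2 + v3)
      + 4 * y0 ^ 2 * ((v1 + v2 + v3) ^ 2 - 2 * (v1 * v2 + v1 * v3 + v2 * v3)) + lam ^ 2"
    unfolding velu_inverse(1)[OF v(1)] velu_inverse(1)[OF v(2)] velu_inverse(1)[OF v(3)]
    by Groebner_Basis.algebra
  also have "\<dots> = L ^ 2"
    unfolding s1 s2 e(1) L using i j by Groebner_Basis.algebra
  finally show ?thesis .
qed

lemma isog_add_distinct:
  assumes P: "Affine x1 y1 \<in> points E" and Q: "Affine x2 y2 \<in> points E"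
    and n: "Affine x1 y1 \<boxplus> Affine x2 y2 = Affine x3 y3"
    and k: "x1 \<noteq> x0" "x2 \<noteq> x0" "x3 \<noteq> x0" and ne: "isog_x x1 \<noteq> isog_x x2"
  shows "isog (Affine x3 y3) = isog (Affine x1 y1) \<boxplus> isog (Affine x2 y2)"
proof -
  have "\<not> (x1 = x2 \<and> y1 = - y2)" using n by (auto simp: add_points.simps(3))
  from collinear_exists[OF P Q this] obtain l m x3' where
    col: "collinear l m x1 x2 x3'" and y: "y1 = l * x1 + m" "y2 = l * x2 + m" by blast
  have x3: "x3' = x3" "y3 = - (l * x3 + m)" using add_collinear[OF col] n y by auto
  note cd = collinearD[OF col[unfolded x3]]
  define m' where "m' = m + l * x0"
  define z1 where "z1 = x1 - x0" define z2 where "z2 = x2 - x0" define z3 where "z3 = x3 - x0"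
  have z: "z1 * (1 / z1) = 1" "z2 * (1 / z2) = 1" "z3 * (1 / z3) = 1"
    using k by (auto simp: z1_def z2_def z3_def)
  have yz: "y1 = l * z1 + m'" "y2 = l * z2 + m'" "y3 = - (l * z3 + m')"
    unfolding y x3 z1_def z2_def z3_def m'_def by Groebner_Basis.algebra+
  have e: "z1 + z2 + z3 = l ^ 2 - lam ^ 2" "z1 * z2 + z1 * z3 + z2 * z3 = 2 * lam * y0 - 2 * l * m'"
      "z1 * z2 * z3 = m' ^ 2 - y0 ^ 2"
    using cd flex unfolding z1_def z2_def z3_def m'_def by Groebner_Basis.algebra+
  have "m' ^ 2 - y0 ^ 2 \<noteq> 0" using e(3) z by auto
  moreover have "m' ^ 2 - y0 ^ 2 = (m' - y0) * (m' + y0)" by Groebner_Basis.algebra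
  ultimately have nz: "m' - y0 \<noteq> 0" "m' + y0 \<noteq> 0" by auto
  define i where "i = 1 / (m' - y0)" define j where "j = 1 / (m' + y0)"
  have i: "(m' - y0) * i = 1" and j: "(m' + y0) * j = 1" using nz by (auto simp: i_def j_def)
  define L where "L = (l - lam) * (m' + y0) * i + (m' - y0) * (l + lam) * j - l"
  define M where "M = m' - 8 * y0 ^ 2 * m' * i * j + (l - L) * (l ^ 2 - lam ^ 2)"
  have root: "z ^ 3 + (lam * z + y0) ^ 2 = (l * z + m') ^ 2" if "z \<in> {z1, z2, z3}" for z
    using that e by auto Groebner_Basis.algebra+
  have ln: "velu_y z (l * z + m') = L * velu_x z + M" if "z \<in> {z1, z2, z3}" "z * (1 / z) = 1" for z
    unfolding M_def by (rule velu_line[OF that(2) root[OF that(1)] i j L_def refl])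
  have 1: "velu_y z1 y1 = L * velu_x z1 + M" and 2: "velu_y z2 y2 = L * velu_x z2 + M"
    using ln[of z1] ln[of z2] z yz by simp_all
  have "velu_y z3 y3 = - velu_y z3 (l * z3 + m')" unfolding yz velu_y_def by (simp only: mult_minus_left)
  then have 3: "velu_y z3 y3 = - (L * velu_x z3 + M)" using ln[of z3] z by simp
  have sum: "velu_x z1 + velu_x z2 + velu_x z3 + lam ^ 2 = L ^ 2"
    by (rule velu_sum[OF z e i j L_def])
  define u1 where "u1 = isog_x x1" define u2 where "u2 = isog_x x2" define u3 where "u3 = isog_x x3"
  have u: "u1 * c ^ 2 = velu_x z1 + x0" "u2 * c ^ 2 = velu_x z2 + x0" "u3 * c ^ 2 = velu_x z3 + x0"
    using c by (simp_all add: u1_def u2_def u3_def isog_x_def z1_def z2_def z3_def)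
  define w1 where "w1 = isog_y x1 y1" define w2 where "w2 = isog_y x2 y2" define w3 where "w3 = isog_y x3 y3"
  have w: "w1 * c ^ 3 = velu_y z1 y1" "w2 * c ^ 3 = velu_y z2 y2" "w3 * c ^ 3 = velu_y z3 y3"
    using c by (simp_all add: w1_def w2_def w3_def isog_y_def z1_def z2_def z3_def)
  define k' where "k' = L / c"
  have L': "L = k' * c" using c by (simp add: k'_def)
  have c2: "c ^ 2 \<noteq> 0" and c3: "c ^ 3 \<noteq> 0" using c by auto
  have u12: "u2 - u1 \<noteq> 0" using ne by (simp add: u1_def u2_def)
  have "(w2 - w1) * c ^ 3 = (k' * (u2 - u1)) * c ^ 3"
    using w(1,2) u(1,2) 1 2 unfolding L' by Groebner_Basis.algebra
  then have "w2 - w1 = k' * (u2 - u1)" using c3 mult_right_cancel by blast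
  then have slope: "(w2 - w1) / (u2 - u1) = k'" using u12 by simp
  have "(k' ^ 2 - u1 - u2) * c ^ 2 = u3 * c ^ 2"
    using u sum flex(1) unfolding L' by Groebner_Basis.algebra
  then have u3: "k' ^ 2 - u1 - u2 = u3" using c2 mult_right_cancel by blast
  have "(k' * (u1 - u3) - w1) * c ^ 3 = w3 * c ^ 3"
    using w u 1 3 unfolding L' by Groebner_Basis.algebra
  then have w3: "k' * (u1 - u3) - w1 = w3" using c3 mult_right_cancel by blast
  have "isog (Affine x1 y1) \<boxplus> isog (Affine x2 y2) = Affine u1 w1 \<boxplus> Affine u2 w2"
    using k by (simp add: u1_def u2_def w1_def w2_def)
  also have "\<dots> = Affine u3 w3"
    using add_distinct[of u1 u2 w1 w2] u12 unfolding Let_def slope u3 w3 by simp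
  also have "\<dots> = isog (Affine x3 y3)" using k by (simp add: u3_def w3_def)
  finally show ?thesis by simp
qed

end

section \<open>The isogeny as an endomorphism, and the norm on the endomorphism ring\<close>

context three_isogeny
begin

text \<open>Fibres of the isogeny are cut out by a nonzero cubic polynomial in \<open>x\<close>.\<close>

lemma isog_x_fiber: "\<forall>\<^sub>F Q in cofin. Q \<noteq> Infinity \<and> xc Q \<noteq> x0 \<and> isog_x (xc Q) \<noteq> s"
proof -
  define p where "p = [:- x0, 1:] ^ 3 + smult (x0 - s * c ^ 2) ([:- x0, 1:] ^ 2) + smult (4 * lam * y0) [:- x0, 1:] + [:4 * y0 ^ 2:]"
  have pz: "poly p x = (x - x0) ^ 3 + (x0 - s * c ^ 2) * (x - x0) ^ 2 + 4 * lam * y0 * (x - x0) + 4 * y0 ^ 2" for x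
    unfolding p_def by simp Groebner_Basis.algebra
  have "poly p x0 \<noteq> 0" using y0 by (simp add: pz)
  then have "p \<noteq> 0" by auto
  from cofin_xc_poly[OF this] cofin_xc[of "{x0}", simplified] show ?thesis
  proof eventually_elim
    case (elim Q)
    define z where "z = xc Q - x0"
    have z: "z \<noteq> 0" using elim by (simp add: z_def)
    have "isog_x (xc Q) \<noteq> s"
    proof
      assume "isog_x (xc Q) = s"
      then have *: "velu_x z + x0 = s * c ^ 2" using c by (simp add: isog_x_def z_def field_simps)
      have zv: "z * (1 / z) = 1" using z by simp
      have "z ^ 3 + (x0 - s * c ^ 2) * z ^ 2 + 4 * lam * y0 * z + 4 * y0 ^ 2 = 0"
        unfolding *[symmetric] velu_inverse(1)[OF zv] using zv by Groebner_Basis.algebra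
      then show False using elim(1) unfolding pz z_def by simp
    qed
    then show ?case using elim by simp
  qed
qed

lemma kernel_points:
  assumes "Affine x0 y \<in> points E"
  shows "y = y0 \<or> y = - y0"
  using assms flex(3) by (simp add: power2_eq_iff[symmetric])

lemma isog_add_generic:
  assumes P: "P \<in> points E"
  shows "\<forall>\<^sub>F Q in cofin. isog (P \<boxplus> Q) = isog P \<boxplus> isog Q"
proof (cases P)
  case Infinity
  then show ?thesis by simp
next
  case (Affine x1 y1)
  show ?thesis
  proof (cases "x1 = x0")
    case True
    have K: "Affine x0 y0 \<in> points E" using flex(3) by simp
    have *: "\<forall>\<^sub>F Q in cofin. isog (Affine x0 y0 \<boxplus> Q) = isog Q"
      using isog_x_fiber[of 0] cofin_translate[OF K isog_x_fiber[of 0]] cofin_points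
    proof eventually_elim
      case (elim Q)
      then show ?case using isog_add_kernel[of "xc Q" "yc Q"] by (cases Q) auto
    qed
    have "P = Affine x0 y0 \<or> P = neg_point (Affine x0 y0)"
      using kernel_points P Affine True by auto
    then show ?thesis
    proof
      assume "P = Affine x0 y0"
      then show ?thesis using * by simp
    next
      assume P': "P = neg_point (Affine x0 y0)"
      show ?thesis using cofin_neg[OF *] cofin_points
      proof eventually_elim
        case (elim Q)
        have "isog (neg_point (neg_point (Affine x0 y0) \<boxplus> Q)) = isog (neg_point Q)"
          using elim neg_add[OF neg_closed[OF K] elim(2)] by simp
        then show ?case unfolding isog_neg P' by simp
      qed
    qed
  next
    case False
    show ?thesis
      using isog_x_fiber[of "isog_x x1"] cofin_translate[OF P isog_x_fiber[of 0]] cofin_points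
    proof eventually_elim
      case (elim Q)
      obtain x2 y2 where Q: "Q = Affine x2 y2" using elim by (cases Q) auto
      obtain x3 y3 where S: "P \<boxplus> Q = Affine x3 y3" using elim by (cases "P \<boxplus> Q") auto
      show ?case
        using isog_add_distinct[of x1 y1 x2 y2 x3 y3] P elim False unfolding S unfolding Affine Q
        using S[unfolded Affine Q] by auto
    qed
  qed
qed

text \<open>As for associativity, the additivity for generic summands extends to all points by adding and
  cancelling a generic point.\<close>

lemma isog_add:
  assumes P: "P \<in> points E" and Q: "Q \<in> points E"
  shows "isog (P \<boxplus> Q) = isog P \<boxplus> isog Q"
proof -
  have PQ: "P \<boxplus> Q \<in> points E" using P Q by simp
  from cofin_ex[OF eventually_conj[OF isog_add_generic[OF PQ]
      eventually_conj[OF cofin_translate[OF Q isog_add_generic[OF P]] isog_add_generic[OF Q]]]]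
  obtain T where T: "T \<in> points E" "isog (P \<boxplus> Q \<boxplus> T) = isog (P \<boxplus> Q) \<boxplus> isog T"
    "isog (P \<boxplus> (Q \<boxplus> T)) = isog P \<boxplus> isog (Q \<boxplus> T)" "isog (Q \<boxplus> T) = isog Q \<boxplus> isog T" by blast
  have "isog (P \<boxplus> Q) \<boxplus> isog T = (isog P \<boxplus> isog Q) \<boxplus> isog T"
    using T P Q isog_closed by (simp add: add_assoc)
  then show ?thesis using add_right_cancel P Q T(1) isog_closed by simp
qed

text \<open>The formulas are regular away from the kernel and infinity. Translating the argument by a suitable
  \<open>V\<close> moves \<open>Q0\<close> to such a place, and additivity turns this into a translation of the
  value.\<close>

lemma map_regular_isog:
  assumes Q0: "Q0 \<in> points E"
  shows "map_regular_at Q0 isog"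
proof -
  have id: "map_regular_at Q0 (\<lambda>P. P)"
    by (rule map_regular_at_cong[OF Q0 endomorphismsD(3)[OF endo_one Q0]]) simp
  (* V makes Q0 + V an affine point outside the kernel. *)
  from cofin_ex[OF eventually_conj[OF id[unfolded map_regular_at_def] cofin_translate[OF Q0 isog_x_fiber[of 0]]]]
  obtain V where V: "V \<in> points E" "affine_near Q0 (\<lambda>Q. Q \<boxplus> V)" "xc (Q0 \<boxplus> V) \<noteq> x0" by blast
  define u where "u = (\<lambda>Q. xc (Q \<boxplus> V))"
  define v where "v = (\<lambda>Q. yc (Q \<boxplus> V))"
  have uv: "regular_at Q0 u" "regular_at Q0 v" using V(2) by (auto simp: affine_near_def u_def v_def)
  have nz: "u Q0 - x0 \<noteq> 0" using V(3) by (simp add: u_def)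
  have z: "regular_at Q0 (\<lambda>Q. u Q - x0)" using uv by (intro regular_at_intros)
  have "affine_near Q0 (\<lambda>Q. isog (Q \<boxplus> V))"
  proof (rule affine_near_intro)
    show "regular_at Q0 (\<lambda>Q. isog_x (u Q))" unfolding isog_x_def velu_x_def
      using Q0 z nz c uv by (intro regular_at_intros) auto
    show "regular_at Q0 (\<lambda>Q. isog_y (u Q) (v Q))" unfolding isog_y_def velu_y_def
      using Q0 z nz c uv by (intro regular_at_intros) auto
    have "\<forall>\<^sub>F Q in near Q0. Q \<boxplus> V \<noteq> Infinity" using V(2) by (simp add: affine_near_def)
    then show "\<forall>\<^sub>F Q in near Q0. isog (Q \<boxplus> V) = Affine (isog_x (u Q)) (isog_y (u Q) (v Q))"
      using regular_at_nonzero[OF Q0 z nz]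
    proof eventually_elim
      case (elim Q)
      then show ?case by (cases "Q \<boxplus> V") (auto simp: u_def v_def)
    qed
  qed
  from aff_imp_map_regular[OF Q0 this] have "map_regular_at Q0 (\<lambda>Q. isog Q \<boxplus> isog V)"
    by (rule map_regular_at_cong[OF Q0]) (use V(1) isog_add in auto)
  then show ?thesis
    by (rule map_regular_at_unshift[OF Q0, rotated 2]) (use isog_closed V(1) in auto)
qed

abbreviation "endo_isog \<equiv> \<lambda>P\<in>points E. isog P"

lemma endo_isog: "endo_isog \<in> Endo"
  using isog_closed by (intro restrict_endo map_regular_isog isog_add) auto

lemma isog_degree: "endo_degree endo_isog = 3" "endo_slope endo_isog = c ^ 2"
proof -
  define p where "p = [:4 * y0 ^ 2 - 4 * lam * y0 * x0, x0 ^ 2 + 4 * lam * y0, - 2 * x0, 1:]"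
  define q where "q = [:c ^ 2 * x0 ^ 2, - 2 * c ^ 2 * x0, c ^ 2:]"
  have p: "poly p x = (x - x0) ^ 3 + 4 * lam * y0 * (x - x0) + 4 * y0 ^ 2 + x0 * (x - x0) ^ 2" for x
    unfolding p_def by simp Groebner_Basis.algebra
  have q: "poly q x = c ^ 2 * (x - x0) ^ 2" for x
    unfolding q_def by simp Groebner_Basis.algebra
  have "x_map endo_isog p q"
    unfolding x_map_def
  proof (intro conjI allI)
    show "poly p x \<noteq> 0 \<or> poly q x \<noteq> 0" for x
      using c y0 by (cases "x = x0") (auto simp: p q)
    show "degree (pCons 0 q) \<le> degree p" using c by (simp add: p_def q_def)
    show "\<forall>\<^sub>F Q in cofin. xnum (endo_isog Q) * poly q (xc Q) = hz (endo_isog Q) * poly p (xc Q)"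
      using isog_x_fiber[of 0] cofin_points
    proof eventually_elim
      case (elim Q)
      obtain x y where Q: "Q = Affine x y" using elim by (cases Q) auto
      have zv: "(x - x0) * (1 / (x - x0)) = 1" using elim Q by simp
      have "isog_x x * c ^ 2 = velu_x (x - x0) + x0" using c by (simp add: isog_x_def)
      then have "isog_x x * poly q x = poly p x"
        unfolding p q velu_inverse(1)[OF zv] using zv by Groebner_Basis.algebra
      then show ?case using elim Q by auto
    qed
  qed
  from endo_degree_slope[OF this] show "endo_degree endo_isog = 3" "endo_slope endo_isog = c ^ 2"
    using c by (simp_all add: p_def q_def numeral_3_eq_3)
qed

end

sublocale elliptic \<subseteq> endo: ring "endomorphism_ring E"
  by (rule ring_endomorphism_ring)

context elliptic
begin

lemma endo_ring_simps:
  "carrier (endomorphism_ring E) = Endo" "\<zero>\<^bsub>endomorphism_ring E\<^esub> = endo_zero"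
  "\<one>\<^bsub>endomorphism_ring E\<^esub> = endo_one"
  "f \<oplus>\<^bsub>endomorphism_ring E\<^esub> g = endo_add f g"
  "f \<otimes>\<^bsub>endomorphism_ring E\<^esub> g = compose (points E) f g"
  by (simp_all add: endomorphism_ring_def)

lemma endo_minus:
  assumes f: "f \<in> Endo" and g: "g \<in> Endo"
  shows "f \<ominus>\<^bsub>endomorphism_ring E\<^esub> g = endo_add f (endo_neg g)"
proof -
  have "endo_add (endo_neg g) g = endo_zero" by (rule restrict_ext) simp
  then have "\<ominus>\<^bsub>endomorphism_ring E\<^esub> g = endo_neg g"
    using endo.minus_equality[of "endo_neg g" g] endo_neg[OF g] g by (simp add: endo_ring_simps)
  then show ?thesis by (simp add: a_minus_def endo_ring_simps)
qed

sublocale endo: normed_ring "endomorphism_ring E" endo_degree endo_slope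
proof
  fix f g
  show "endo_degree f \<ge> 0" by (rule endo_degree_nonneg)
  assume "f \<in> carrier (endomorphism_ring E)" "g \<in> carrier (endomorphism_ring E)"
  then have fg: "f \<in> Endo" "g \<in> Endo" by (simp_all add: endo_ring_simps)
  show "endo_degree (f \<oplus>\<^bsub>endomorphism_ring E\<^esub> g) + endo_degree (f \<ominus>\<^bsub>endomorphism_ring E\<^esub> g) =
      2 * endo_degree f + 2 * endo_degree g"
    "endo_slope (f \<oplus>\<^bsub>endomorphism_ring E\<^esub> g) + endo_slope (f \<ominus>\<^bsub>endomorphism_ring E\<^esub> g) =
      2 * endo_slope f + 2 * endo_slope g"
    "endo_slope (f \<oplus>\<^bsub>endomorphism_ring E\<^esub> g) * endo_slope (f \<ominus>\<^bsub>endomorphism_ring E\<^esub> g) =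
      (endo_slope f - endo_slope g) ^ 2"
    unfolding endo_minus[OF fg] unfolding endo_ring_simps by (rule parallelogram[OF fg])+
qed (simp_all add: endo_ring_simps endo_degree_zero endo_degree_one endo_degree_compose endo_degree_eq_0)

end

section \<open>Integers of the quadratic field of discriminant -11\<close>

definition sqrt_m11 :: complex where "sqrt_m11 = csqrt (of_int (- 11))"

lemma sqrt_m11: "Re sqrt_m11 = 0" "Im sqrt_m11 = sqrt 11"
proof -
  have "sqrt_m11 = csqrt (of_real (- 11))" by (simp add: sqrt_m11_def)
  also have "\<dots> = \<i> * sqrt 11" by (subst csqrt_of_real_nonpos) auto
  finally have e: "sqrt_m11 = \<i> * of_real (sqrt 11)" .
  show "Re sqrt_m11 = 0" "Im sqrt_m11 = sqrt 11" unfolding e by simp_all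
qed

lemma sqrt_m11_sq: "sqrt_m11 * sqrt_m11 = - 11"
  by (simp add: complex_eq_iff sqrt_m11)

definition omega :: complex where "omega = (1 + sqrt_m11) / 2"

lemma omega: "Re omega = 1 / 2" "Im omega = sqrt 11 / 2"
  by (simp_all add: omega_def sqrt_m11)

lemma omega_sq: "omega * omega = omega - 3"
  by (simp add: omega_def field_simps sqrt_m11_sq)

text \<open>The powers of the reduced denominator \<open>q\<close> of \<open>r\<close> all divide
  \<open>D\<close>, which is possible only for \<open>q = 1\<close>.\<close>

lemma of_rat_power_bounded_denom:
  fixes r :: rat and D :: int
  assumes D: "D \<noteq> 0" and int: "\<And>k. of_int D * r ^ k \<in> \<int>"
  shows "r \<in> \<int>"
proof -
  obtain p q where q: "quotient_of r = (p, q)" by fastforce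
  then have r: "r = of_int p / of_int q" and q0: "q > 0" and cop: "coprime p q"
    by (auto simp: quotient_of_div quotient_of_denom_pos quotient_of_coprime)
  have dvd: "q ^ k dvd D" for k
  proof -
    obtain m where "of_int D * r ^ k = (of_int m :: rat)" using int[of k] by (auto elim: Ints_cases)
    then have "of_int D * of_int p ^ k = (of_int m * of_int q ^ k :: rat)"
      using q0 by (simp add: r power_divide field_simps)
    then have "of_int (D * p ^ k) = (of_int (m * q ^ k) :: rat)" by simp
    then have "D * p ^ k = m * q ^ k" by (simp only: of_int_eq_iff)
    then have "q ^ k dvd D * p ^ k" by simp
    moreover have "coprime (q ^ k) (p ^ k)" using cop by (simp add: coprime_commute)
    ultimately show ?thesis by (simp add: coprime_dvd_mult_left_iff)
  qed
  have "q = 1"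
  proof (rule ccontr)
    assume "q \<noteq> 1"
    then have "q \<ge> 2" using q0 by simp
    then have "(2::int) ^ nat \<bar>D\<bar> \<le> q ^ nat \<bar>D\<bar>" by (intro power_mono) auto
    also have "\<dots> \<le> \<bar>D\<bar>" using dvd[of "nat \<bar>D\<bar>"] D by (simp add: zdvd_imp_le)
    also have "\<bar>D\<bar> = int (nat \<bar>D\<bar>)" by simp
    also have "\<dots> < int (2 ^ nat \<bar>D\<bar>)" using less_exp[of "nat \<bar>D\<bar>"] by (simp only: of_nat_less_iff)
    also have "\<dots> = 2 ^ nat \<bar>D\<bar>" by simp
    finally show False by simp
  qed
  then show ?thesis by (simp add: r)
qed

text \<open>The order \<open>\<int>[\<surd>-11]\<close>, of index 2 in the ring of integers. Up to a common
  denominator it contains the powers of a quadratic integer, and norms of its elements are integral.\<close>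

definition sqrt_lattice :: "complex set" where
  "sqrt_lattice = {of_int i + of_int j * sqrt_m11 | i j. True}"

lemma sqrt_lattice_add: "z \<in> sqrt_lattice \<Longrightarrow> w \<in> sqrt_lattice \<Longrightarrow> z + w \<in> sqrt_lattice"
proof -
  assume "z \<in> sqrt_lattice" "w \<in> sqrt_lattice"
  then obtain i j i' j' where "z = of_int i + of_int j * sqrt_m11" "w = of_int i' + of_int j' * sqrt_m11"
    by (auto simp: sqrt_lattice_def)
  then have "z + w = of_int (i + i') + of_int (j + j') * sqrt_m11" by (simp add: algebra_simps)
  then show ?thesis unfolding sqrt_lattice_def by blast
qed

lemma sqrt_lattice_mult: "z \<in> sqrt_lattice \<Longrightarrow> of_int k * z \<in> sqrt_lattice"
proof -
  assume "z \<in> sqrt_lattice"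
  then obtain i j where "z = of_int i + of_int j * sqrt_m11" by (auto simp: sqrt_lattice_def)
  then have "of_int k * z = of_int (k * i) + of_int (k * j) * sqrt_m11" by (simp add: algebra_simps)
  then show ?thesis unfolding sqrt_lattice_def by blast
qed

lemma sqrt_lattice_zero: "0 \<in> sqrt_lattice"
proof -
  have "0 = of_int 0 + of_int 0 * sqrt_m11" by simp
  then show ?thesis unfolding sqrt_lattice_def by blast
qed

lemma sqrt_lattice_sum: "(\<And>i. i \<in> S \<Longrightarrow> f i \<in> sqrt_lattice) \<Longrightarrow> (\<Sum>i\<in>S. f i) \<in> sqrt_lattice"
  by (induction S rule: infinite_finite_induct) (auto intro: sqrt_lattice_add sqrt_lattice_zero)

lemma of_rat_fraction:
  obtains p q :: int where "q \<noteq> 0" "(of_rat r :: 'a::field_char_0) = of_int p / of_int q"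
    "(of_rat r :: 'b::field_char_0) = of_int p / of_int q"
proof -
  obtain p q where "quotient_of r = (p, q)" by fastforce
  then have "r = of_int p / of_int q" "q > 0" by (auto simp: quotient_of_div quotient_of_denom_pos)
  then show ?thesis by (intro that[of q p]) (auto simp: of_rat_divide)
qed

lemma complex_of_rat: "(of_rat r :: complex) = of_real (of_rat r)"
proof -
  obtain p q :: int where "(of_rat r :: complex) = of_int p / of_int q" "(of_rat r :: real) = of_int p / of_int q"
    by (rule of_rat_fraction)
  then show ?thesis by simp
qed

lemma sqrt_lattice_norm:
  assumes "z \<in> sqrt_lattice" shows "\<exists>m::int. cmod z ^ 2 = of_int m"
proof -
  obtain i j where "z = of_int i + of_int j * sqrt_m11" using assms by (auto simp: sqrt_lattice_def)
  then have "cmod z ^ 2 = of_int (i ^ 2 + 11 * j ^ 2)"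
    by (simp add: cmod_power2 sqrt_m11 power_mult_distrib)
  then show ?thesis by blast
qed

lemma rational_common_denominator:
  "\<exists>D::int. D \<noteq> 0 \<and> of_int D * (of_rat r + of_rat s * sqrt_m11) \<in> sqrt_lattice"
proof -
  obtain p q :: int where pq: "(of_rat r :: complex) = of_int p / of_int q" "q \<noteq> 0"
    by (rule of_rat_fraction[where 'b = complex])
  obtain p' q' :: int where pq': "(of_rat s :: complex) = of_int p' / of_int q'" "q' \<noteq> 0"
    by (rule of_rat_fraction[where 'b = complex])
  have "of_int (q * q') * (of_rat r + of_rat s * sqrt_m11) = of_int (p * q') + of_int (p' * q) * sqrt_m11"
    unfolding pq(1) pq'(1) using pq(2) pq'(2) by (simp add: field_simps)
  then have "of_int (q * q') * (of_rat r + of_rat s * sqrt_m11) \<in> sqrt_lattice"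
    unfolding sqrt_lattice_def by blast
  moreover have "q * q' \<noteq> 0" using pq(2) pq'(2) by simp
  ultimately show ?thesis by blast
qed

lemma quadratic_power:
  "\<exists>r s. (of_rat a' + of_rat b' * sqrt_m11) ^ k = of_rat r + of_rat s * sqrt_m11"
proof (induction k)
  case 0
  have "(1::complex) = of_rat 1 + of_rat 0 * sqrt_m11" by simp
  then show ?case by (metis power_0)
next
  case (Suc k)
  then obtain r s where "(of_rat a' + of_rat b' * sqrt_m11) ^ k = of_rat r + of_rat s * sqrt_m11" by blast
  then have "(of_rat a' + of_rat b' * sqrt_m11) ^ Suc k =
     of_rat a' * of_rat r + of_rat b' * of_rat s * (sqrt_m11 * sqrt_m11) + (of_rat a' * of_rat s + of_rat b' * of_rat r) * sqrt_m11"
    by (simp add: algebra_simps)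
  also have "\<dots> = of_rat (a' * r - 11 * (b' * s)) + of_rat (a' * s + b' * r) * sqrt_m11"
    unfolding sqrt_m11_sq by (simp add: of_rat_add of_rat_mult of_rat_diff)
  finally show ?case by blast
qed

text \<open>An integral equation expresses all powers of \<open>z\<close> through finitely many.\<close>

lemma powers_common_denominator:
  assumes z: "z = of_rat a' + of_rat b' * sqrt_m11" and int: "algebraic_int z"
  shows "\<exists>D::int. D \<noteq> 0 \<and> (\<forall>k. of_int D * z ^ k \<in> sqrt_lattice)"
proof -
  obtain p where p: "lead_coeff p = 1" "\<And>i. coeff p i \<in> \<int>" "poly p z = 0"
    using int by (auto elim: algebraic_int.cases)
  define n where "n = degree p"
  have "\<exists>d::int. d \<noteq> 0 \<and> of_int d * z ^ k \<in> sqrt_lattice" for k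
    using quadratic_power[of a' b' k] rational_common_denominator unfolding z by metis
  then obtain d :: "nat \<Rightarrow> int" where d: "\<And>k. d k \<noteq> 0" "\<And>k. of_int (d k) * z ^ k \<in> sqrt_lattice" by metis
  define D where "D = (\<Prod>k<n. d k)"
  have D: "D \<noteq> 0" using d(1) by (simp add: D_def)
  have low: "of_int D * z ^ k \<in> sqrt_lattice" if "k < n" for k
  proof -
    have "D = (\<Prod>j\<in>{..<n} - {k}. d j) * d k"
      unfolding D_def using that by (subst prod.remove[of _ k]) (auto simp: mult.commute)
    then have e: "of_int D * z ^ k = of_int (\<Prod>j\<in>{..<n} - {k}. d j) * (of_int (d k) * z ^ k)"
      by (simp only: of_int_mult mult.assoc)
    show ?thesis unfolding e by (rule sqrt_lattice_mult[OF d(2)])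
  qed
  have rel: "z ^ n = (\<Sum>i<n. - coeff p i * z ^ i)"
  proof -
    have "(\<Sum>i\<le>n. coeff p i * z ^ i) = 0" using p(3) by (simp add: poly_altdef n_def)
    moreover have "(\<Sum>i\<le>n. coeff p i * z ^ i) = z ^ n + (\<Sum>i<n. coeff p i * z ^ i)"
      using p(1) by (simp add: lessThan_Suc_atMost[symmetric] n_def)
    ultimately show ?thesis by (simp add: sum_negf add_eq_0_iff2)
  qed
  have "of_int D * z ^ k \<in> sqrt_lattice" for k
  proof (induction k rule: less_induct)
    case (less k)
    show ?case
    proof (cases "k < n")
      case False
      have "z ^ k = z ^ (k - n) * z ^ n" using False by (simp flip: power_add)
      also have "\<dots> = (\<Sum>i<n. - coeff p i * z ^ (k - n + i))"
        unfolding rel by (simp add: sum_distrib_left power_add algebra_simps)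
      finally have "of_int D * z ^ k = (\<Sum>i<n. - coeff p i * (of_int D * z ^ (k - n + i)))"
        by (simp add: sum_distrib_left mult_ac)
      moreover have "- coeff p i * (of_int D * z ^ (k - n + i)) \<in> sqrt_lattice" if "i < n" for i
      proof -
        obtain m where "coeff p i = of_int m" using p(2)[of i] by (auto elim: Ints_cases)
        then have e: "- coeff p i * (of_int D * z ^ (k - n + i)) = of_int (- m) * (of_int D * z ^ (k - n + i))" by simp
        show ?thesis unfolding e by (rule sqrt_lattice_mult[OF less]) (use that False in simp)
      qed
      ultimately show ?thesis by (auto intro: sqrt_lattice_sum)
    qed (rule low)
  qed
  then show ?thesis using D by blast
qed

text \<open>If the powers of \<open>w\<close> have a common denominator, so do those of its norm.\<close>

lemma norm_integral:
  assumes w: "cmod w ^ 2 = of_rat r" and D: "D \<noteq> 0" "\<And>k. of_int D * w ^ k \<in> sqrt_lattice"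
  shows "r \<in> \<int>"
proof (rule of_rat_power_bounded_denom)
  show "D ^ 2 \<noteq> (0::int)" using D by simp
  fix k
  obtain m :: int where "cmod (of_int D * w ^ k) ^ 2 = of_int m" using sqrt_lattice_norm[OF D(2)] by blast
  moreover have "cmod (of_int D * w ^ k) ^ 2 = of_int (D ^ 2) * (cmod w ^ 2) ^ k"
    by (simp add: norm_mult norm_power power_mult_distrib flip: power_mult) (simp add: mult.commute)
  ultimately have "of_rat (of_int (D ^ 2) * r ^ k) = (of_rat (of_int m) :: real)"
    unfolding w by (simp add: of_rat_mult of_rat_power)
  then have "of_int (D ^ 2) * r ^ k = of_int m" by (simp only: of_rat_eq_iff)
  then show "of_int (D ^ 2) * r ^ k \<in> \<int>" by simp
qed

text \<open>For an integer \<open>z = a' + b' \<surd>-11\<close> the norms of \<open>z\<close> and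
  \<open>z + 1\<close> are rational integers, hence so are \<open>2 a'\<close> and
  \<open>(2 a')\<^sup>2 + 11 (2 b')\<^sup>2\<close>, the latter being divisible by 4. As 11 is squarefree,
  \<open>2 b'\<close> is an integer, of the same parity as \<open>2 a'\<close>.\<close>

lemma quadratic_integers_carrier:
  "carrier (quadratic_integers (- 11)) = {of_int c + of_int d * omega | c d. True}"
proof (intro equalityI subsetI)
  fix z assume "z \<in> carrier (quadratic_integers (- 11))"
  then obtain a' b' where z: "z = of_rat a' + of_rat b' * sqrt_m11" and int: "algebraic_int z"
    by (auto simp: quadratic_integers_def quadratic_field_def sqrt_m11_def)
  obtain D :: int where D: "D \<noteq> 0" "\<And>k. of_int D * z ^ k \<in> sqrt_lattice"
    using powers_common_denominator[OF z int] by blast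
  have n1: "cmod z ^ 2 = of_rat (a' ^ 2 + 11 * b' ^ 2)"
    by (simp add: z complex_of_rat cmod_power2 sqrt_m11 of_rat_add of_rat_mult of_rat_power power_mult_distrib)
  have n2: "cmod (z + 1) ^ 2 = of_rat ((a' + 1) ^ 2 + 11 * b' ^ 2)"
    by (simp add: z complex_of_rat cmod_power2 sqrt_m11 of_rat_add of_rat_mult of_rat_power power_mult_distrib)
  have i1: "a' ^ 2 + 11 * b' ^ 2 \<in> \<int>" by (rule norm_integral[OF n1 D])
  (* The same denominator D serves for the powers of z + 1, by the binomial theorem. *)
  have "of_int D * (z + 1) ^ k \<in> sqrt_lattice" for k
  proof -
    have "of_int D * (z + 1) ^ k = (\<Sum>i\<le>k. of_int (int (k choose i)) * (of_int D * z ^ i))"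
      by (simp add: binomial_ring sum_distrib_left mult_ac)
    also have "\<dots> \<in> sqrt_lattice" by (intro sqrt_lattice_sum sqrt_lattice_mult D)
    finally show ?thesis .
  qed
  then have i2: "(a' + 1) ^ 2 + 11 * b' ^ 2 \<in> \<int>" by (rule norm_integral[OF n2 D(1)])
  obtain m where m: "a' ^ 2 + 11 * b' ^ 2 = of_int m" using i1 by (auto elim: Ints_cases)
  obtain m' where m': "(a' + 1) ^ 2 + 11 * b' ^ 2 = of_int m'" using i2 by (auto elim: Ints_cases)
  define n where "n = m' - m - 1"
  have n: "2 * a' = of_int n" using m m' by (simp add: n_def power2_eq_square algebra_simps)
  obtain p q where pq: "quotient_of (2 * b') = (p, q)" by fastforce
  then have b': "2 * b' = of_int p / of_int q" and q0: "q > 0" and cop: "coprime p q"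
    by (auto simp: quotient_of_div quotient_of_denom_pos quotient_of_coprime)
  have "11 * (2 * b') ^ 2 = 4 * of_int m - (2 * a') ^ 2" using m by (simp add: power2_eq_square algebra_simps)
  then have "11 * of_int p ^ 2 = (4 * of_int m - of_int n ^ 2) * (of_int q ^ 2 :: rat)"
  proof -
    assume h: "11 * (2 * b') ^ 2 = 4 * of_int m - (2 * a') ^ 2"
    have e: "2 * b' * of_int q = of_int p" using b' q0 by simp
    have "11 * of_int p ^ 2 = (11 * (2 * b') ^ 2) * (of_int q ^ 2 :: rat)"
      unfolding e[symmetric] by (simp only: power_mult_distrib mult.assoc)
    then show ?thesis unfolding h n .
  qed
  then have "of_int (11 * p ^ 2) = (of_int ((4 * m - n ^ 2) * q ^ 2) :: rat)" by simp
  then have e: "11 * p ^ 2 = (4 * m - n ^ 2) * q ^ 2" by (simp only: of_int_eq_iff)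
  have "q ^ 2 dvd 11 * p ^ 2" unfolding e by simp
  moreover have "coprime (q ^ 2) (p ^ 2)" using cop by (simp add: coprime_commute)
  ultimately have "q ^ 2 dvd 11" by (simp add: coprime_dvd_mult_left_iff)
  then have "q ^ 2 \<le> 11" by (rule zdvd_imp_le) simp
  then have "q < 4" using power_mono[of 4 q 2] by (cases "q \<ge> 4") auto
  then have "q = 1 \<or> q = 2 \<or> q = 3" using q0 by auto
  then have q1: "q = 1" using \<open>q ^ 2 dvd 11\<close> by auto
  then have b2: "2 * b' = of_int p" using b' by simp
  have "even (n - p)"
  proof -
    have "11 * p ^ 2 + n ^ 2 = 4 * m" using e q1 by simp
    then have "even (11 * p ^ 2 + n ^ 2)" by simp
    then show ?thesis by simp
  qed
  then obtain k where "n - p = 2 * k" by (elim evenE)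
  then have k: "n = p + 2 * k" by simp
  have "2 * a' = of_int p + 2 * of_int k" using n k by simp
  then have a'': "a' = of_int k + of_int p / 2" and b'': "b' = of_int p / 2" using b2 by simp_all
  have ca: "(of_rat a' :: complex) = of_int k + of_int p / 2" and cb: "(of_rat b' :: complex) = of_int p / 2"
    unfolding a'' b'' by (simp_all add: of_rat_add of_rat_divide)
  have "z = of_int k + of_int p * omega"
    unfolding z ca cb omega_def by (simp add: add_divide_distrib distrib_left)
  then show "z \<in> {of_int c + of_int d * omega | c d. True}" by blast
next
  fix z assume "z \<in> {of_int c + of_int d * omega | c d. True}"
  then obtain c d :: int where z: "z = of_int c + of_int d * omega" by blast
  have q: "z = of_rat (of_int c + of_int d / 2) + of_rat (of_int d / 2) * sqrt_m11"
    unfolding z omega_def by (simp add: of_rat_add of_rat_divide add_divide_distrib distrib_left)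
  define p :: "complex poly" where "p = [:of_int (c ^ 2 + c * d + 3 * d ^ 2), of_int (- (2 * c + d)), 1:]"
  have "poly p z = of_int d ^ 2 * (omega * omega - omega + 3)"
    unfolding p_def z by (simp add: power2_eq_square algebra_simps)
  then have "poly p z = 0" by (simp add: omega_sq)
  moreover have "coeff p i \<in> \<int>" for i by (auto simp: p_def coeff_pCons split: nat.splits)
  ultimately have "algebraic_int z" by (intro algebraic_int.intros[of p]) (auto simp: p_def)
  then show "z \<in> carrier (quadratic_integers (- 11))"
    using q unfolding quadratic_integers_def quadratic_field_def sqrt_m11_def by auto
qed

context normed_ring
begin

lemma int_mult_distrib:
  assumes "x \<in> carrier R" "y \<in> carrier R"
  shows "int_mult k (x \<oplus> y) = int_mult k x \<oplus> int_mult k y"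
proof -
  have e: "int_mult k z = int_mult k \<one> \<otimes> z" if "z \<in> carrier R" for z
    using add_pow_ldistr_int[OF one_closed that, of k] that by simp
  show ?thesis unfolding e[OF a_closed[OF assms]] e[OF assms(1)] e[OF assms(2)]
    by (rule r_distr) (use assms in simp_all)
qed

lemma int_mult_im: "x \<in> carrier R \<Longrightarrow> int_mult k (int_mult j x) = int_mult (k * j) x"
  using add.int_pow_pow[of x k j] by (simp add: mult.commute)

text \<open>The characteristic equation \<open>x\<^sup>2 = x - 3\<close> is that of \<open>omega\<close>, and
  \<open>c + d x\<close> determines \<open>c\<close> and \<open>d\<close> because its norm
  \<open>c\<^sup>2 + c d + 3 d\<^sup>2\<close> is positive definite.\<close>

theorem ring_iso_quadratic_integers:
  assumes x: "x \<in> carrier R" and n: "N x = 3" and t: "B x \<one> = 1"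
  shows "R \<simeq> quadratic_integers (- 11)"
proof -
  define g where "g = (\<lambda>(c, d). int_mult c \<one> \<oplus> int_mult d x)"
  define G :: "int \<times> int \<Rightarrow> complex" where "G = (\<lambda>(c, d). of_int c + of_int d * omega)"
  have g_closed: "g p \<in> carrier R" for p using x by (auto simp: g_def split: prod.splits)
  have g_surj: "\<exists>p. y = g p" if "y \<in> carrier R" for y
    using generated_by_root[OF x n t that] by (auto simp: g_def)
  have g_add: "g (c, d) \<oplus> g (c', d') = g (c + c', d + d')" for c d c' d'
    using x by (simp add: g_def int_mult_add a_ac)
  have g_int_mult: "int_mult k (g (c, d)) = g (k * c, k * d)" for k c d
    using x by (simp add: g_def int_mult_distrib int_mult_im)
  have xx: "x \<otimes> x = g (- 3, 1)"
  proof -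
    define r where "r = int_mult (- 1) x \<oplus> int_mult 3 \<one>"
    have r: "r \<in> carrier R" using x by (simp add: r_def)
    have "x \<otimes> x \<oplus> r = \<zero>" using characteristic_equation[OF x] by (simp add: n t r_def)
    moreover have "g (- 3, 1) \<oplus> r = g (- 3, 1) \<oplus> g (3, - 1)" using x by (simp add: r_def g_def a_comm)
    then have "g (- 3, 1) \<oplus> r = \<zero>" using x by (simp add: g_add) (simp add: g_def int_mult_simps)
    ultimately show ?thesis using r x g_closed by (metis add.right_cancel m_closed)
  qed
  have xg: "x \<otimes> g (c, d) = g (- 3 * d, c + d)" for c d
  proof -
    have "x \<otimes> g (c, d) = int_mult c x \<oplus> int_mult d (x \<otimes> x)"
      using x add_pow_rdistr_int[OF x one_closed, of c] add_pow_rdistr_int[OF x x, of d]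
      by (simp add: g_def r_distr)
    also have "int_mult c x = g (0, c)" using x by (simp add: g_def int_mult_simps)
    finally show ?thesis by (simp add: xx g_int_mult g_add mult.commute)
  qed
  have g_mult: "g (c, d) \<otimes> g (c', d') = g (c * c' - 3 * d * d', c * d' + d * (c' + d'))" for c d c' d'
  proof -
    let ?y = "g (c', d')"
    have "g (c, d) \<otimes> ?y = int_mult c ?y \<oplus> int_mult d (x \<otimes> ?y)"
      using x g_closed add_pow_ldistr_int[OF one_closed g_closed, of c "(c', d')"]
        add_pow_ldistr_int[OF x g_closed, of d "(c', d')"]
      by (simp add: g_def[of] l_distr)
    then show ?thesis by (simp add: xg g_int_mult g_add algebra_simps)
  qed
  have inj: "p = p'" if "g p = g p'" for p p'
  proof -
    obtain c d c' d' where p: "p = (c, d)" "p' = (c', d')" by fastforce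
    have "N (g (c - c', d - d')) = 0"
    proof -
      have "g (c - c', d - d') = g (c, d) \<oplus> int_mult (- 1) (g (c', d'))" by (simp add: g_int_mult g_add)
      also have "\<dots> = \<zero>" using that p g_closed[of p'] int_mult_simps(2)[of "g p'"] int_mult_simps(3)[of "g p'" 1] by (simp add: r_neg)
      finally show ?thesis by simp
    qed
    moreover have "N (g (i, j)) = i ^ 2 + i * j + 3 * j ^ 2" for i j
      using x t n B_sym[of \<one> x] by (simp add: g_def B_simps algebra_simps)
    ultimately have "4 * ((c - c') ^ 2 + (c - c') * (d - d') + 3 * (d - d') ^ 2) = 0" by simp
    then have "(2 * (c - c') + (d - d')) ^ 2 + 11 * (d - d') ^ 2 = 0" by (simp add: power2_eq_square algebra_simps)
    moreover have "(2 * (c - c') + (d - d')) ^ 2 \<ge> 0" "11 * (d - d') ^ 2 \<ge> 0" by simp_all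
    ultimately have "(d - d') ^ 2 = 0" "(2 * (c - c') + (d - d')) ^ 2 = 0" by linarith+
    then show ?thesis using p by simp
  qed
  define h where "h = (\<lambda>y. G (inv_into UNIV g y))"
  have "inj g" using inj by (auto simp: inj_def)
  then have hg: "h (g p) = G p" for p by (simp add: h_def)
  have G_carrier: "carrier (quadratic_integers (- 11)) = range G"
    unfolding quadratic_integers_carrier G_def by (auto simp: image_def)
  have "h \<in> ring_iso R (quadratic_integers (- 11))"
  proof (rule ring_iso_memI)
    fix y assume "y \<in> carrier R"
    then obtain p where "y = g p" using g_surj by blast
    then show "h y \<in> carrier (quadratic_integers (- 11))" unfolding G_carrier by (simp add: hg)
  next
    fix y y' assume "y \<in> carrier R" "y' \<in> carrier R"
    then obtain c d c' d' where y: "y = g (c, d)" "y' = g (c', d')" using g_surj by (metis surj_pair)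
    have "G (c * c' - 3 * d * d', c * d' + d * (c' + d')) =
      of_int c * of_int c' + (of_int c * of_int d' + of_int d * of_int c') * omega + of_int d * of_int d' * (omega - 3)"
      by (simp add: G_def algebra_simps)
    also have "\<dots> = G (c, d) * G (c', d')"
      unfolding omega_sq[symmetric] by (simp add: G_def algebra_simps)
    finally show "h (y \<otimes> y') = h y \<otimes>\<^bsub>quadratic_integers (- 11)\<^esub> h y'"
      unfolding y g_mult hg by (simp add: quadratic_integers_def)
    show "h (y \<oplus> y') = h y \<oplus>\<^bsub>quadratic_integers (- 11)\<^esub> h y'"
      unfolding y g_add hg by (simp add: quadratic_integers_def G_def algebra_simps)
  next
    have "g (1, 0) = \<one>" using x by (simp add: g_def int_mult_simps)
    then show "h \<one> = \<one>\<^bsub>quadratic_integers (- 11)\<^esub>"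
      using hg[of "(1, 0)"] by (simp add: quadratic_integers_def G_def)
  next
    have "inj G"
      by (auto simp: inj_def G_def complex_eq_iff omega)
    show "bij_betw h (carrier R) (carrier (quadratic_integers (- 11)))"
      unfolding bij_betw_def
    proof
      show "inj_on h (carrier R)"
        using \<open>inj G\<close> g_surj by (auto simp: inj_on_def inj_def) (metis hg)
      show "h ` carrier R = carrier (quadratic_integers (- 11))"
        unfolding G_carrier using g_surj g_closed hg by (auto simp: image_def) metis+
    qed
  qed
  then show ?thesis by (auto simp: is_ring_iso_def)
qed

end

section \<open>Torsion points and 2-adic poles\<close>

context elliptic
begin

lemma mult_point_closed: "P \<in> points E \<Longrightarrow> mult_point E k P \<in> points E"
  by (induction k) (auto simp: mult_point_def)

lemma mult_point_Suc: "mult_point E (Suc k) P = P \<boxplus> mult_point E k P"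
  by (simp add: mult_point_def)

lemma mult_point_add:
  assumes "P \<in> points E"
  shows "mult_point E (j + k) P = mult_point E j P \<boxplus> mult_point E k P"
proof (induction j)
  case 0
  then show ?case by (simp add: mult_point_def)
next
  case (Suc j)
  then show ?case using assms mult_point_closed by (simp add: mult_point_Suc add_assoc)
qed

text \<open>The multiples of a torsion point are periodic.\<close>

lemma finite_multiples:
  assumes P: "P \<in> points E" and k: "k \<ge> 1" and t: "mult_point E k P = Infinity"
  shows "finite (range (\<lambda>j. mult_point E j P))"
proof -
  have "mult_point E j P \<in> (\<lambda>j. mult_point E j P) ` {..<k}" for j
  proof (induction j rule: less_induct)
    case (less j)
    show ?case
    proof (cases "j < k")
      case False
      then have "mult_point E j P = mult_point E (k + (j - k)) P" by simp
      also have "\<dots> = mult_point E (j - k) P" unfolding mult_point_add[OF P] t by simp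
      finally show ?thesis using less[of "j - k"] False k by simp
    qed simp
  qed
  then have "range (\<lambda>j. mult_point E j P) \<subseteq> (\<lambda>j. mult_point E j P) ` {..<k}" by blast
  then show ?thesis by (rule finite_subset) simp
qed

end

text \<open>The 2-adic valuation of \<open>r\<close> is \<open>- f\<close>.\<close>

definition two_adic_pole :: "nat \<Rightarrow> rat \<Rightarrow> bool" where
  "two_adic_pole f r \<longleftrightarrow> (\<exists>p q. odd p \<and> odd q \<and> r = of_int p / (2 ^ f * of_int q))"

lemma two_adic_pole_unique:
  assumes "two_adic_pole f r" "two_adic_pole g r"
  shows "f = g"
proof -
  have False if *: "two_adic_pole f r" "two_adic_pole g r" "f < g" for f g
  proof -
    obtain p q where 1: "odd p" "odd q" "r = of_int p / (2 ^ f * of_int q)"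
      using * unfolding two_adic_pole_def by blast
    obtain p' q' where 2: "odd p'" "odd q'" "r = of_int p' / (2 ^ g * of_int q')"
      using * unfolding two_adic_pole_def by blast
    have "q \<noteq> 0" "q' \<noteq> 0" using 1 2 by auto
    have p: "of_int p = r * (2 ^ f * of_int q)" using 1 \<open>q \<noteq> 0\<close> by simp
    have "of_int p' = r * (2 ^ g * of_int q')" using 2 \<open>q' \<noteq> 0\<close> by simp
    also have "(2::rat) ^ g = 2 ^ f * 2 ^ (g - f)" using * by (simp flip: power_add)
    finally have p': "of_int p' = r * (2 ^ f * 2 ^ (g - f) * of_int q')" .
    have "of_int p * 2 ^ (g - f) * of_int q' = of_int p' * (of_int q :: rat)"
      unfolding p p' by (simp only: mult_ac)
    then have "of_int (p * 2 ^ (g - f) * q') = (of_int (p' * q) :: rat)" by simp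
    then have e: "p * 2 ^ (g - f) * q' = p' * q" by (simp only: of_int_eq_iff)
    have "even (p * 2 ^ (g - f) * q')" using * by simp
    then have "even (p' * q)" unfolding e .
    then show False using 1 2 by simp
  qed
  then show ?thesis using assms by (metis linorder_neqE_nat)
qed

text \<open>The duplication formula of the model
  \<open>Y\<^sup>2 + Y = r\<^sup>3 - r\<^sup>2 - 7 r + 10\<close>, for \<open>r = m / n\<close>. With
  \<open>n = 1\<close>, the denominator is the polynomial \<open>(2 Y + 1)\<^sup>2\<close> in \<open>r\<close>.\<close>

definition dup_num :: "'a::comm_ring_1 \<Rightarrow> 'a \<Rightarrow> 'a" where
  "dup_num m n = m ^ 4 + 14 * m ^ 2 * n ^ 2 - 82 * m * n ^ 3 + 90 * n ^ 4"
definition dup_den :: "'a::comm_ring_1 \<Rightarrow> 'a \<Rightarrow> 'a" where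
  "dup_den m n = 4 * m ^ 3 - 4 * m ^ 2 * n - 28 * m * n ^ 2 + 41 * n ^ 3"

lemma dup_of_int: "of_int (dup_num m n) = dup_num (of_int m) (of_int n)"
  "of_int (dup_den m n) = dup_den (of_int m) (of_int n)"
  by (simp_all add: dup_num_def dup_den_def)

lemma dup_homogeneous:
  fixes m n :: rat
  assumes "n \<noteq> 0"
  shows "dup_num (m / n) 1 = dup_num m n / n ^ 4" "dup_den (m / n) 1 = dup_den m n / n ^ 3"
proof -
  define r where "r = m / n"
  have m: "m = r * n" using assms by (simp add: r_def)
  have "dup_num r 1 * n ^ 4 = dup_num m n" "dup_den r 1 * n ^ 3 = dup_den m n"
    unfolding m dup_num_def dup_den_def power_one mult_1_right by Groebner_Basis.algebra+
  then show "dup_num (m / n) 1 = dup_num m n / n ^ 4" "dup_den (m / n) 1 = dup_den m n / n ^ 3"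
    using assms unfolding r_def[symmetric] by (simp_all add: nonzero_eq_divide_eq)
qed

text \<open>With \<open>r = p / (2 h)\<close> and \<open>p\<close> odd, the numerator is odd and the denominator
  is 4 times an odd number: the leading coefficient 4 of the denominator is what raises the pole order.\<close>

lemma duplication_pole:
  assumes f: "f \<ge> 1" and r: "two_adic_pole f r"
  shows "dup_den r 1 \<noteq> 0" "two_adic_pole (f + 2) (dup_num r 1 / dup_den r 1)"
proof -
  obtain p q where 1: "odd p" "odd q" "r = of_int p / (2 ^ f * of_int q)"
    using r unfolding two_adic_pole_def by blast
  define h where "h = 2 ^ (f - 1) * q"
  have fs: "Suc (f - 1) = f" using f by simp
  have h2: "2 ^ f * q = 2 * h" unfolding h_def by (subst fs[symmetric]) simp
  have h0: "h \<noteq> 0" using 1 by (auto simp: h_def)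
  have r': "r = of_int p / of_int (2 * h)" unfolding 1(3) h2[symmetric] by simp
  have nz: "(of_int (2 * h) :: rat) \<noteq> 0" using h0 by simp
  define s where "s = p ^ 3 - 2 * p ^ 2 * h - 28 * p * h ^ 2 + 82 * h ^ 3"
  have s: "odd s" using 1 by (simp add: s_def)
  have d: "dup_den p (2 * h) = 4 * s" unfolding dup_den_def s_def by Groebner_Basis.algebra
  have o: "odd (dup_num p (2 * h))" using 1 by (simp add: dup_num_def)
  have dd: "dup_den r 1 = of_int (4 * s) / of_int (2 * h) ^ 3"
    unfolding r' dup_homogeneous[OF nz] dup_of_int[symmetric] d ..
  have dn: "dup_num r 1 = of_int (dup_num p (2 * h)) / of_int (2 * h) ^ 4"
    unfolding r' dup_homogeneous[OF nz] dup_of_int[symmetric] ..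
  have s0: "s \<noteq> 0" using s by auto
  then show "dup_den r 1 \<noteq> 0" unfolding dd using h0 by simp
  have "dup_num r 1 / dup_den r 1 = of_int (dup_num p (2 * h)) / (of_int (2 * h) * of_int (4 * s))"
    unfolding dd dn using nz s0 by (simp add: field_simps eval_nat_numeral)
  also have "(of_int (2 * h) * of_int (4 * s) :: rat) = 2 ^ (f + 2) * of_int (q * s)"
    unfolding h2[symmetric] by (simp add: power_add)
  finally show "two_adic_pole (f + 2) (dup_num r 1 / dup_den r 1)"
    unfolding two_adic_pole_def using o 1 s by (intro exI[of _ "dup_num p (2 * h)"] exI[of _ "q * s"]) simp
qed

lemma two_adic_pole_if_even_denom:
  assumes "odd p" "even q" "q \<noteq> 0"
  shows "\<exists>f\<ge>1. two_adic_pole f (of_int p / of_int q)"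
proof -
  define f where "f = multiplicity 2 q"
  obtain s where s: "q = 2 ^ f * s" "odd s"
    using multiplicity_decompose'[of q 2] assms(3) unfolding f_def by auto
  have "f \<ge> 1" using s assms(2) by (cases f) auto
  moreover have "two_adic_pole f (of_int p / of_int q)"
    unfolding two_adic_pole_def using assms s by (intro exI[of _ p] exI[of _ s]) simp
  ultimately show ?thesis by blast
qed

text \<open>The 3-division polynomial of the model, homogenized, has no zero on the projective line over the
  field of 7 elements.\<close>

lemma psi3_mod_7:
  fixes m n :: int
  assumes "3 * m ^ 4 - 4 * m ^ 3 * n - 42 * m ^ 2 * n ^ 2 + 123 * m * n ^ 3 - 90 * n ^ 4 = 0"
  shows "7 dvd m \<and> 7 dvd n"
proof -
  define r where "r = m mod 7"
  define s where "s = n mod 7"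
  have "(3 * r ^ 4 - 4 * r ^ 3 * s - 42 * r ^ 2 * s ^ 2 + 123 * r * s ^ 3 - 90 * s ^ 4) mod 7 =
        (3 * m ^ 4 - 4 * m ^ 3 * n - 42 * m ^ 2 * n ^ 2 + 123 * m * n ^ 3 - 90 * n ^ 4) mod 7"
    unfolding r_def s_def by (intro mod_diff_cong mod_add_cong mod_mult_cong refl) (simp_all add: power_mod)
  then have *: "(3 * r ^ 4 - 4 * r ^ 3 * s - 42 * r ^ 2 * s ^ 2 + 123 * r * s ^ 3 - 90 * s ^ 4) mod 7 = 0"
    unfolding assms by simp
  have "r \<in> {0, 1, 2, 3, 4, 5, 6}" "s \<in> {0, 1, 2, 3, 4, 5, 6}"
  proof -
    have "0 \<le> r" "r < 7" "0 \<le> s" "s < 7" by (simp_all add: r_def s_def)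
    then show "r \<in> {0, 1, 2, 3, 4, 5, 6}" "s \<in> {0, 1, 2, 3, 4, 5, 6}" by auto
  qed
  then have "r = 0 \<and> s = 0" using * by auto
  then show ?thesis by (auto simp: r_def s_def)
qed

text \<open>If \<open>r = r(P)\<close> is integral at 2 then so is \<open>t = r(2 P)\<close>, and
  \<open>t - r\<close> is even: modulo 2 the points \<open>2 P\<close> and \<open>- P\<close> coincide. It is
  nonzero, its numerator being the negative of the 3-division polynomial. The last expression is
  \<open>r(3 P)\<close>, by the formula for \<open>r(2 P + P) + r(2 P - P)\<close>; it has odd numerator over
  the even number \<open>n e\<^sup>2\<close>.\<close>

lemma triple_pole:
  fixes m n :: int
  assumes cop: "coprime m n" and n: "odd n"
  defines "r \<equiv> (of_int m / of_int n :: rat)"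
  defines "t \<equiv> dup_num r 1 / dup_den r 1"
  shows "dup_den r 1 \<noteq> 0" "t \<noteq> r"
    "\<exists>f\<ge>1. two_adic_pole f ((2 * (r + t) * (r * t) - 14 * (r + t) - 4 * (r * t) + 41) / (t - r) ^ 2 - r)"
proof -
  have n0: "(of_int n :: rat) \<noteq> 0" using n by auto
  define N where "N = dup_num m n"
  define D where "D = dup_den m n"
  have D: "odd D" using n by (simp add: D_def dup_den_def)
  then have D0: "(of_int D :: rat) \<noteq> 0" by auto
  have dd: "dup_den r 1 = of_int D / of_int n ^ 3"
    unfolding r_def dup_homogeneous[OF n0] D_def dup_of_int ..
  have dn: "dup_num r 1 = of_int N / of_int n ^ 4"
    unfolding r_def dup_homogeneous[OF n0] N_def dup_of_int ..
  show "dup_den r 1 \<noteq> 0" unfolding dd using D0 n0 by simp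
  have t: "t = of_int N / (of_int n * of_int D)"
    unfolding t_def dd dn using n0 D0 by (simp add: field_simps eval_nat_numeral)
  define e where "e = N - m * D"
  have tr: "t - r = of_int e / (of_int n * of_int D)"
    unfolding t r_def e_def using n0 D0 by (simp add: field_simps)
  have "e = - (3 * m ^ 4 - 4 * m ^ 3 * n - 42 * m ^ 2 * n ^ 2 + 123 * m * n ^ 3 - 90 * n ^ 4)"
    unfolding e_def N_def D_def dup_num_def dup_den_def by Groebner_Basis.algebra
  moreover have "\<not> (7 dvd m \<and> 7 dvd n)" using coprime_common_divisor[OF cop, of 7] by auto
  ultimately have e0: "e \<noteq> 0" using psi3_mod_7[of m n] by auto
  then show "t \<noteq> r" using tr n0 D0 by auto
  have "even e" using D n by (cases "even m") (simp_all add: e_def N_def dup_num_def)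
  define K where "K = 2 * ((N + m * D) * (m * N)) - 14 * ((N + m * D) * n ^ 2 * D) - 4 * (m * N * n * D) + 41 * (n ^ 3 * D ^ 2)"
  have "odd (41 * (n ^ 3 * D ^ 2))" using n D by simp
  then have K: "odd K" by (simp add: K_def)
  define Q where "Q = 2 * (r + t) * (r * t) - 14 * (r + t) - 4 * (r * t) + 41"
  have rn: "r * of_int n = of_int m" using n0 by (simp add: r_def)
  have tN: "t * (of_int n * of_int D) = of_int N" using n0 D0 by (simp add: t)
  have Q: "Q * (of_int n ^ 3 * of_int D ^ 2) = of_int K"
    unfolding Q_def K_def of_int_add of_int_diff of_int_mult of_int_power of_int_numeral rn[symmetric] tN[symmetric]
    by Groebner_Basis.algebra
  have x: "(t - r) * (of_int n * of_int D) = of_int e" using n0 D0 by (simp add: tr)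
  have "of_int n * of_int e ^ 2 = (t - r) ^ 2 * (of_int n ^ 3 * of_int D ^ 2)"
    unfolding x[symmetric] by Groebner_Basis.algebra
  then have "Q / (t - r) ^ 2 * (of_int n * of_int e ^ 2) = of_int K"
    using \<open>t \<noteq> r\<close> Q by simp
  then have "(Q / (t - r) ^ 2 - r) * (of_int n * of_int e ^ 2) = of_int (K - m * e ^ 2)"
    using rn by (simp add: left_diff_distrib mult.assoc[symmetric])
  then have "Q / (t - r) ^ 2 - r = of_int (K - m * e ^ 2) / of_int (n * e ^ 2)"
    using n0 e0 by (simp add: nonzero_eq_divide_eq)
  moreover have "odd (K - m * e ^ 2)" "even (n * e ^ 2)" "n * e ^ 2 \<noteq> 0" using K \<open>even e\<close> e0 n by auto
  ultimately show "\<exists>f\<ge>1. two_adic_pole f ((2 * (r + t) * (r * t) - 14 * (r + t) - 4 * (r * t) + 41) / (t - r) ^ 2 - r)"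
    using two_adic_pole_if_even_denom[of "K - m * e ^ 2" "n * e ^ 2"] unfolding Q_def by simp
qed

locale cm_curve = elliptic E for E :: "rat alg_closure weierstrass" +
  fixes u :: rat
  assumes u: "u \<noteq> 0" and a_eq: "a = to_ac (- 264 * u ^ 2)" and b_eq: "b = to_ac (1694 * u ^ 3)"
begin

abbreviation model_x :: "rat \<Rightarrow> rat alg_closure" where "model_x r \<equiv> to_ac (u * (6 * r - 2))"

lemma model_x_surj: "\<exists>r. to_ac x = model_x r"
proof -
  have "6 * ((x / u + 2) / 6) - 2 = x / u" by (simp add: add_divide_distrib)
  then have "u * (6 * ((x / u + 2) / 6) - 2) = x" using u by (simp only:) simp
  then show ?thesis by metis
qed

lemma model_x_inj: "model_x r = model_x s \<longleftrightarrow> r = s"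
  unfolding to_ac_eq_iff using u by simp

lemma curve_model:
  assumes "Affine (model_x r) y \<in> points E"
  shows "y ^ 2 = to_ac (54 * u ^ 3 * dup_den r 1)"
proof -
  have "y ^ 2 = to_ac ((u * (6 * r - 2)) ^ 3 + (- 264 * u ^ 2) * (u * (6 * r - 2)) + 1694 * u ^ 3)"
    using assms unfolding points_Affine a_eq b_eq by (simp only: to_ac_add to_ac_mult to_ac_power)
  also have "(u * (6 * r - 2)) ^ 3 + (- 264 * u ^ 2) * (u * (6 * r - 2)) + 1694 * u ^ 3 = 54 * u ^ 3 * dup_den r 1"
    unfolding dup_den_def power_one mult_1_right by Groebner_Basis.algebra
  finally show ?thesis .
qed

lemma double_model:
  assumes P: "Affine (model_x r) y \<in> points E" and d: "dup_den r 1 \<noteq> 0"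
  shows "\<exists>y'. Affine (model_x r) y \<boxplus> Affine (model_x r) y = Affine (model_x (dup_num r 1 / dup_den r 1)) y'"
proof -
  have "y \<noteq> 0" using curve_model[OF P] d u by (auto simp del: to_ac_mult to_ac_power)
  then obtain x3 y3 where 3: "Affine (model_x r) y \<boxplus> Affine (model_x r) y = Affine x3 y3"
    "x3 * (4 * (model_x r ^ 3 + a * model_x r + b)) = (model_x r ^ 2 - a) ^ 2 - 8 * b * model_x r"
    using double_point[OF P] by blast
  define x where "x = u * (6 * r - 2)"
  define t where "t = dup_num r 1 / dup_den r 1"
  have t: "t * dup_den r 1 = dup_num r 1" using d by (simp add: t_def)
  have "x3 * to_ac (4 * (x ^ 3 + (- 264 * u ^ 2) * x + 1694 * u ^ 3)) =
      to_ac ((x ^ 2 - (- 264 * u ^ 2)) ^ 2 - 8 * (1694 * u ^ 3) * x)"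
    using 3(2) unfolding a_eq b_eq x_def[symmetric]
    by (simp only: to_ac_add to_ac_mult to_ac_power to_ac_diff to_ac_numeral)
  also have "4 * (x ^ 3 + (- 264 * u ^ 2) * x + 1694 * u ^ 3) = 216 * u ^ 3 * dup_den r 1"
    unfolding x_def dup_den_def power_one mult_1_right by Groebner_Basis.algebra
  also have "(x ^ 2 - (- 264 * u ^ 2)) ^ 2 - 8 * (1694 * u ^ 3) * x = u * (6 * t - 2) * (216 * u ^ 3 * dup_den r 1)"
  proof -
    have "(x ^ 2 - (- 264 * u ^ 2)) ^ 2 - 8 * (1694 * u ^ 3) * x = 216 * u ^ 4 * (6 * dup_num r 1 - 2 * dup_den r 1)"
      unfolding x_def dup_den_def dup_num_def power_one mult_1_right by Groebner_Basis.algebra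
    then show ?thesis unfolding t[symmetric] by Groebner_Basis.algebra
  qed
  finally have "x3 * to_ac (216 * u ^ 3 * dup_den r 1) = model_x t * to_ac (216 * u ^ 3 * dup_den r 1)"
    by (simp only: to_ac_mult)
  moreover have "to_ac (216 * u ^ 3 * dup_den r 1) \<noteq> 0" using u d unfolding to_ac_eq_0_iff by simp
  ultimately have "x3 = model_x t" using mult_right_cancel by blast
  then show ?thesis using 3(1) unfolding t_def by blast
qed

text \<open>The point \<open>2 P + P\<close> is reached without computing its ordinate: the sum of
  \<open>x(U + V)\<close> and \<open>x(U - V)\<close> depends on \<open>x(U)\<close> and \<open>x(V)\<close>
  only, and \<open>U - V\<close> will be \<open>P\<close>.\<close>

lemma add_model:
  assumes P: "Affine (model_x r) y \<in> points E" and Q: "Affine (model_x t) y' \<in> points E"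
    and n: "t \<noteq> r" and m: "Affine (model_x t) y' \<boxplus> neg_point (Affine (model_x r) y) = Affine (model_x s) z"
  shows "\<exists>z'. Affine (model_x t) y' \<boxplus> Affine (model_x r) y =
    Affine (model_x ((2 * (r + t) * (r * t) - 14 * (r + t) - 4 * (r * t) + 41) / (t - r) ^ 2 - s)) z'"
proof -
  have "model_x t \<noteq> model_x r" using n model_x_inj by blast
  then obtain x3 y3 where S: "Affine (model_x t) y' \<boxplus> Affine (model_x r) y = Affine x3 y3"
    using add_distinct by (metis Let_def)
  have rel: "(x3 + model_x s) * (model_x t - model_x r) ^ 2 =
      2 * ((model_x t + model_x r) * (model_x t * model_x r + a) + 2 * b)"
    using kummer_relations[OF Q P] unfolding S m by (simp add: kum_sum_def kum_diff_def)
  define p where "p = u * (6 * t - 2)"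
  define q where "q = u * (6 * r - 2)"
  define w where "w = (2 * (r + t) * (r * t) - 14 * (r + t) - 4 * (r * t) + 41) / (t - r) ^ 2"
  have w: "w * (t - r) ^ 2 = 2 * (r + t) * (r * t) - 14 * (r + t) - 4 * (r * t) + 41" using n by (simp add: w_def)
  have pq: "p - q \<noteq> 0" using n u by (simp add: p_def q_def)
  have "(x3 + model_x s) * to_ac ((p - q) ^ 2) = to_ac (2 * ((p + q) * (p * q + (- 264 * u ^ 2)) + 2 * (1694 * u ^ 3)))"
    using rel unfolding a_eq b_eq p_def[symmetric] q_def[symmetric]
    by (simp only: to_ac_add to_ac_mult to_ac_power to_ac_diff to_ac_numeral)
  also have "2 * ((p + q) * (p * q + (- 264 * u ^ 2)) + 2 * (1694 * u ^ 3)) = (u * (6 * w - 4)) * (p - q) ^ 2"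
  proof -
    have "2 * ((p + q) * (p * q + (- 264 * u ^ 2)) + 2 * (1694 * u ^ 3)) =
      36 * u ^ 3 * (6 * (2 * (r + t) * (r * t) - 14 * (r + t) - 4 * (r * t) + 41) - 4 * (t - r) ^ 2)"
      unfolding p_def q_def by Groebner_Basis.algebra
    then show ?thesis unfolding w[symmetric] p_def q_def by Groebner_Basis.algebra
  qed
  finally have "(x3 + model_x s) * to_ac ((p - q) ^ 2) = to_ac (u * (6 * w - 4)) * to_ac ((p - q) ^ 2)"
    by (simp only: to_ac_mult)
  moreover have "to_ac ((p - q) ^ 2) \<noteq> 0" using pq unfolding to_ac_eq_0_iff by simp
  ultimately have "x3 + model_x s = to_ac (u * (6 * w - 4))" using mult_right_cancel by blast
  then have "x3 = to_ac (u * (6 * w - 4) - u * (6 * s - 2))" unfolding to_ac_diff by (simp only: eq_diff_eq)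
  also have "u * (6 * w - 4) - u * (6 * s - 2) = u * (6 * (w - s) - 2)" by Groebner_Basis.algebra
  finally show ?thesis using S unfolding w_def by blast
qed

text \<open>One of \<open>P\<close> and \<open>3 P\<close> has a 2-adic pole, and repeated doubling gives
  multiples of \<open>P\<close> with poles of different orders, so \<open>P\<close> would have infinitely many
  multiples.\<close>

theorem no_torsion_with_rational_x:
  assumes P: "P \<in> points E" "P = Affine (to_ac x) y" and k: "k \<ge> 1" and t: "mult_point E k P = Infinity"
  shows False
proof -
  let ?M = "range (\<lambda>j. mult_point E j P)"
  have fin: "finite ?M" by (rule finite_multiples[OF P(1) k t])
  have add_M: "A \<boxplus> B \<in> ?M" if AB: "A \<in> ?M" "B \<in> ?M" for A B
  proof -
    obtain i j where "A = mult_point E i P" "B = mult_point E j P" using AB by auto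
    then have "A \<boxplus> B = mult_point E (i + j) P" using mult_point_add[OF P(1)] by simp
    then show ?thesis by blast
  qed
  have M: "A \<in> points E" if "A \<in> ?M" for A using that mult_point_closed[OF P(1)] by auto
  have "mult_point E 1 P = P" by (simp add: mult_point_def)
  then have PM: "P \<in> ?M" by (metis rangeI)
  obtain r where r: "P = Affine (model_x r) y" using P(2) model_x_surj by metis
  have "\<exists>f\<ge>1. \<exists>s z. two_adic_pole f s \<and> Affine (model_x s) z \<in> ?M"
  proof -
    obtain m n where q: "quotient_of r = (m, n)" by fastforce
    then have mn: "r = of_int m / of_int n" "n > 0" "coprime m n"
      by (auto simp: quotient_of_div quotient_of_denom_pos quotient_of_coprime)
    show ?thesis
    proof (cases "even n")
      case True
      then have "odd m" using mn(3) by (metis coprime_common_divisor odd_one)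
      then have "\<exists>f\<ge>1. two_adic_pole f r" unfolding mn(1) using True mn(2) by (intro two_adic_pole_if_even_denom) auto
      then show ?thesis using PM r by blast
    next
      case False
      define s where "s = dup_num r 1 / dup_den r 1"
      note tp = triple_pole[OF mn(3) False, folded mn(1), folded s_def]
      obtain y' where D: "P \<boxplus> P = Affine (model_x s) y'"
        using double_model[of r y] tp(1) P(1) r unfolding s_def by metis
      have DM: "P \<boxplus> P \<in> ?M" using add_M PM by blast
      have "P \<boxplus> P \<boxplus> neg_point P = P" using add_neg_cancel P(1) by blast
      then have "\<exists>z'. P \<boxplus> P \<boxplus> P = Affine (model_x ((2 * (r + s) * (r * s) - 14 * (r + s) - 4 * (r * s) + 41) / (s - r) ^ 2 - r)) z'"
        using add_model[of r y s y' r y] P(1) M[OF DM] tp(2) unfolding r unfolding D[unfolded r] by blast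
      moreover have "P \<boxplus> P \<boxplus> P \<in> ?M" using add_M DM PM by blast
      ultimately show ?thesis using tp(3) by metis
    qed
  qed
  then obtain f s z where 0: "f \<ge> 1" "two_adic_pole f s" "Affine (model_x s) z \<in> ?M" by blast
  have "\<exists>s z. two_adic_pole (f + 2 * i) s \<and> Affine (model_x s) z \<in> ?M" for i
  proof (induction i)
    case 0
    show ?case using \<open>two_adic_pole f s\<close> \<open>Affine (model_x s) z \<in> ?M\<close> by auto
  next
    case (Suc i)
    then obtain s z where s: "two_adic_pole (f + 2 * i) s" "Affine (model_x s) z \<in> ?M" by blast
    have "1 \<le> f + 2 * i" using 0(1) by simp
    note dp = duplication_pole[OF this s(1)]
    obtain z' where "Affine (model_x s) z \<boxplus> Affine (model_x s) z = Affine (model_x (dup_num s 1 / dup_den s 1)) z'"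
      using double_model[OF M[OF s(2)] dp(1)] by blast
    then have "Affine (model_x (dup_num s 1 / dup_den s 1)) z' \<in> ?M" using add_M[OF s(2) s(2)] by metis
    moreover have "f + 2 * i + 2 = f + 2 * Suc i" by simp
    ultimately show ?case using dp(2) by metis
  qed
  then obtain S Z where SZ: "\<And>i. two_adic_pole (f + 2 * i) (S i)" "\<And>i. Affine (model_x (S i)) (Z i) \<in> ?M" by metis
  (* Distinct pole orders distinguish the points. *)
  have "inj (\<lambda>i. Affine (model_x (S i)) (Z i))"
  proof (rule injI)
    fix i j assume "Affine (model_x (S i)) (Z i) = Affine (model_x (S j)) (Z j)"
    then have "S i = S j" using model_x_inj by blast
    then show "i = j" using two_adic_pole_unique[of "f + 2 * i" "S i" "f + 2 * j"] SZ(1)[of i] SZ(1)[of j] by simp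
  qed
  then have "infinite (range (\<lambda>i. Affine (model_x (S i)) (Z i)))" by (rule range_inj_infinite)
  moreover have "range (\<lambda>i. Affine (model_x (S i)) (Z i)) \<subseteq> ?M" using SZ(2) by blast
  ultimately show False using fin finite_subset by blast
qed

end

section \<open>The curves with complex multiplication\<close>

context cm_curve
begin

text \<open>Since 3 splits in \<open>\<rat>(\<surd>-11)\<close>, the 3-division polynomial has the roots
  \<open>u (11 \<plusminus> w)\<close> in this field, the abscissas of the kernels of endomorphisms of norm 3;
  \<open>x0\<close> is one of them. The twisting factor satisfies \<open>c\<^sup>2 = (- 5 - w) / 2\<close>, the
  square of an element of norm 3, and its powers \<open>2 c\<^sup>4 = 7 + 5 w\<close> and
  \<open>c\<^sup>6 = 5 - 8 w\<close> match the coefficients of the quotient curve.\<close>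

lemma has_three_isogeny:
  obtains x0 y0 lam c where "three_isogeny E x0 y0 lam c" "(c ^ 2) ^ 2 + 5 * c ^ 2 + 9 = 0"
proof -
  obtain w :: "rat alg_closure" where w: "w ^ 2 = - 11" using nth_root_exists[of 2] by auto
  define v where "v = to_ac u"
  have v: "v \<noteq> 0" using u by (simp add: v_def)
  have a': "a = - 264 * v ^ 2" and b': "b = 1694 * v ^ 3" by (simp_all add: a_eq b_eq v_def)
  obtain y0 where y0: "y0 ^ 2 = v ^ 3 * (88 * w - 242)" using nth_root_exists[of 2] by auto
  have "\<exists>c. c ^ 2 = (- 5 - w) / 2" by (rule nth_root_exists) simp
  then obtain c where c: "c ^ 2 = (- 5 - w) / 2" ..
  have c2: "2 * c ^ 2 = - 5 - w" unfolding c by simp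
  define x0 where "x0 = v * (11 + w)"
  define lam where "lam = v ^ 2 * (33 + 33 * w) / y0"
  have "(88 * w - 242) * (- 88 * w - 242) = 143748" using w by Groebner_Basis.algebra
  then have "88 * w - 242 \<noteq> 0" by (metis mult_zero_left zero_neq_numeral)
  then have y0z: "y0 \<noteq> 0" using y0 v by auto
  have ly: "lam * y0 = v ^ 2 * (33 + 33 * w)" using y0z by (simp add: lam_def)
  have "(- 5 - w) * (w - 5) = 36" using w by Groebner_Basis.algebra
  then have "2 * c ^ 2 \<noteq> 0" unfolding c2 by auto
  then have cz: "c \<noteq> 0" by auto
  have "lam ^ 2 * (y0 ^ 2) = (3 * x0) * (y0 ^ 2)"
  proof -
    have "lam ^ 2 * (y0 ^ 2) = (v ^ 2 * (33 + 33 * w)) ^ 2" unfolding ly[symmetric] by Groebner_Basis.algebra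
    also have "\<dots> = (3 * x0) * (y0 ^ 2)" unfolding y0 x0_def using w by Groebner_Basis.algebra
    finally show ?thesis .
  qed
  then have 1: "3 * x0 = lam ^ 2" using y0z by simp
  have 2: "a + 3 * x0 ^ 2 = 2 * lam * y0"
    unfolding mult.assoc ly a' x0_def using w by Groebner_Basis.algebra
  have 3: "y0 ^ 2 = x0 ^ 3 + a * x0 + b"
    unfolding y0 a' b' x0_def using w by Groebner_Basis.algebra
  have c4: "2 * c ^ 4 = 7 + 5 * w"
  proof -
    have "2 * (2 * c ^ 4) = (2 * c ^ 2) ^ 2" by Groebner_Basis.algebra
    also have "\<dots> = 2 * (7 + 5 * w)" unfolding c2 using w by Groebner_Basis.algebra
    finally show ?thesis by (rule double_cancel)
  qed
  have c6: "c ^ 6 = 5 - 8 * w"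
  proof -
    have "2 * (2 * c ^ 6) = (2 * c ^ 2) * (2 * c ^ 4)" by Groebner_Basis.algebra
    also have "\<dots> = 2 * (2 * (5 - 8 * w))" unfolding c2 c4 using w by Groebner_Basis.algebra
    finally have "2 * c ^ 6 = 2 * (5 - 8 * w)" by (rule double_cancel)
    then show ?thesis by (rule double_cancel)
  qed
  have 4: "a - 20 * lam * y0 = c ^ 4 * a"
  proof (rule double_cancel)
    have "2 * (c ^ 4 * a) = (7 + 5 * w) * a" unfolding c4[symmetric] by Groebner_Basis.algebra
    also have "\<dots> = 2 * (a - 20 * (lam * y0))" unfolding ly a' by Groebner_Basis.algebra
    finally show "2 * (a - 20 * lam * y0) = 2 * (c ^ 4 * a)" by (simp only: mult.assoc)
  qed
  have 5: "b - 28 * y0 ^ 2 - 28 * x0 * lam * y0 = c ^ 6 * b"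
  proof -
    have "b - 28 * y0 ^ 2 - 28 * x0 * (lam * y0) = c ^ 6 * b"
      unfolding c6 ly y0 b' x0_def using w by Groebner_Basis.algebra
    then show ?thesis by (simp only: mult.assoc)
  qed
  have "three_isogeny E x0 y0 lam c"
    by unfold_locales (fact 1 2 3 4 5 y0z cz)+
  moreover have "(c ^ 2) ^ 2 + 5 * c ^ 2 + 9 = 0"
  proof (rule double_cancel, rule double_cancel)
    have "2 * (2 * ((c ^ 2) ^ 2 + 5 * c ^ 2 + 9)) = (2 * c ^ 2) ^ 2 + 10 * (2 * c ^ 2) + 36"
      by Groebner_Basis.algebra
    also have "\<dots> = 0" unfolding c2 using w by Groebner_Basis.algebra
    finally show "2 * (2 * ((c ^ 2) ^ 2 + 5 * c ^ 2 + 9)) = 2 * (2 * 0)" by simp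
  qed
  ultimately show ?thesis by (rule that)
qed

theorem endomorphism_ring_iso: "endomorphism_ring E \<simeq> quadratic_integers (- 11)"
proof -
  obtain x0 y0 lam c where i: "three_isogeny E x0 y0 lam c" and norm: "(c ^ 2) ^ 2 + 5 * c ^ 2 + 9 = 0"
    by (rule has_three_isogeny)
  interpret three_isogeny E x0 y0 lam c by (rule i)
  have m: "endo_isog \<in> carrier (endomorphism_ring E)" using endo_isog by (simp only: endo_ring_simps)
  have "endo.B endo_isog \<one>\<^bsub>endomorphism_ring E\<^esub> = 1 \<or> endo.B endo_isog \<one>\<^bsub>endomorphism_ring E\<^esub> = - 1"
  proof (rule endo.trace_from_slope[OF m isog_degree(1)])
    show "endo_slope endo_isog ^ 2 + 5 * endo_slope endo_isog + 9 = 0"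
      unfolding isog_degree(2) by (rule norm)
  qed
  then show ?thesis
  proof
    assume "endo.B endo_isog \<one>\<^bsub>endomorphism_ring E\<^esub> = 1"
    then show ?thesis by (rule endo.ring_iso_quadratic_integers[OF m isog_degree(1)])
  next
    (* The negative of the isogeny then has trace 1. *)
    assume t: "endo.B endo_isog \<one>\<^bsub>endomorphism_ring E\<^esub> = - 1"
    let ?g = "\<ominus>\<^bsub>endomorphism_ring E\<^esub> endo_isog"
    have "?g \<in> carrier (endomorphism_ring E)" using m by (rule endo.a_inv_closed)
    moreover have "endo_degree ?g = 3" using endo.N_minus[OF m] isog_degree(1) by simp
    moreover have "endo.B ?g \<one>\<^bsub>endomorphism_ring E\<^esub> = 1"
      using endo.B_minus[OF m endo.one_closed] t by simp
    ultimately show ?thesis by (rule endo.ring_iso_quadratic_integers)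
  qed
qed

end

lemma curve_E_elliptic:
  assumes "u \<noteq> 0"
  shows "elliptic_curve (curve_E u)" "cm_curve (geometric (curve_E u)) u"
proof -
  (* The discriminant is -2^6 3^6 11^3 times u^6. *)
  have d: "discriminant (curve_E u) = - 62099136 * u ^ 6"
    unfolding discriminant_def curve_E_def weierstrass.sel by Groebner_Basis.algebra
  then show e: "elliptic_curve (curve_E u)" using assms by (simp add: elliptic_curve_def)
  have g: "coeff_a (geometric F) = to_ac (coeff_a F)" "coeff_b (geometric F) = to_ac (coeff_b F)" for F
    by (cases F; simp add: geometric_def)+
  have "discriminant (geometric (curve_E u)) = to_ac (discriminant (curve_E u))"
    unfolding discriminant_def g by simp
  then have "elliptic_curve (geometric (curve_E u))" using e unfolding elliptic_curve_def by simp
  then show "cm_curve (geometric (curve_E u)) u"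
    by unfold_locales (simp_all add: assms g curve_E_def)
qed

theorem proposition14:
  fixes u :: rat
  assumes "u \<noteq> 0"
  shows "elliptic_curve (curve_E u) \<and>
    has_CM_by (curve_E u) (quadratic_integers (- 11)) \<and>
    \<not> (\<exists>P. torsion_point (curve_E u) 2 P \<and> rational_x P) \<and>
    \<not> (\<exists>P. torsion_point (curve_E u) 3 P \<and> rational_x P) \<and>
    (\<forall>k\<ge>1. 6 dvd k \<longrightarrow> \<not> (\<exists>P. torsion_point (curve_E u) k P \<and> rational_x P))"
proof -
  interpret cm_curve "geometric (curve_E u)" u by (rule curve_E_elliptic(2)[OF assms])
  have no_torsion: "\<not> (\<exists>P. torsion_point (curve_E u) k P \<and> rational_x P)" if k: "k \<ge> 1" for k
  proof
    assume "\<exists>P. torsion_point (curve_E u) k P \<and> rational_x P"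
    then obtain P x y where "P \<in> points (geometric (curve_E u))" "P = Affine (to_ac x) y"
      "mult_point (geometric (curve_E u)) k P = Infinity"
      unfolding torsion_point_def rational_x_def by blast
    then show False using no_torsion_with_rational_x k by blast
  qed
  have "has_CM_by (curve_E u) (quadratic_integers (- 11))"
    unfolding has_CM_by_def by (rule endomorphism_ring_iso)
  moreover have "\<not> (\<exists>P. torsion_point (curve_E u) 2 P \<and> rational_x P)" by (rule no_torsion) simp
  moreover have "\<not> (\<exists>P. torsion_point (curve_E u) 3 P \<and> rational_x P)" by (rule no_torsion) simp
  ultimately show ?thesis using curve_E_elliptic(1)[OF assms] no_torsion by blast
qed

end
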